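(* Let $\mathcal{C}$ be an extension-closed pseudovariety of finite groups, and suppose that $A$ and $B$ are non-trivial $\mathcal{C}$-hereditarily conjugacy separable groups. Then the restricted wreath product $A \wr B$ is $\mathcal{C}$-hereditarily conjugacy separable if and only if at least one of the following is true: (i) $B \in \mathcal{C}$ and $A$ is $\mathcal{C}$-hereditarily conjugacy separable; (ii) $A$ is abelian and residually-$\mathcal{C}$, $B$ is $\mathcal{C}$-hereditarily conjugacy separable, and every cyclic subgroup of $B$ is $\mathcal{C}$-separable in $B$.
   Context: An extension-closed pseudovariety of finite groups is a (non-empty, isomorphism-closed) class of finite groups closed under subgroups, finite direct products, quotients and extensions. For a group $G$ let $\mathcal{N}_{\mathcal{C}}(G)$ be the set of normal subgroups $N \unlhd G$ with $G/N \in \mathcal{C}$. The pro-$\mathcal{C}$ topology on $G$ has as base of open sets all cosets $gN$, $g \in G$, $N \in \mathcal{N}_{\mathcal{C}}(G)$. A subset of $G$ is $\mathcal{C}$-separable (equivalently $\mathcal{C}$-closed) if it is closed in this topology, and $\mathcal{C}$-open if it is open; a subgroup $H\leq G$ is $\mathcal{C}$-open iff it contains some $N \in \mathcal{N}_{\mathcal{C}}(G)$. $G$ is residually-$\mathcal{C}$ if $\{1\}$ is $\mathcal{C}$-closed; $G$ is $\mathcal{C}$-conjugacy separable if every conjugacy class of $G$ is $\mathcal{C}$-closed in $G$; $G$ is $\mathcal{C}$-hereditarily conjugacy separable if $G$ and every $\mathcal{C}$-open subgroup $H \leq G$ are $\mathcal{C}$-conjugacy separable (each with respect to its own pro-$\mathcal{C}$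 topology). The restricted wreath product is $A \wr B = A^B \rtimes B$, where $A^B$ denotes the group of finitely supported functions $B \to A$, on which $B$ acts by left translation of coordinates. *)

theory Defs
  imports "HOL-Algebra.Algebra" "HOL-Analysis.Abstract_Topology"
begin

section \<open>Classes of finite groups\<close>

text \<open>
  HOL has no type of all groups, so a class of finite groups is represented by its members whose
  underlying set consists of natural numbers. Since every finite group is isomorphic to such a
  group, an isomorphism-closed class is determined by these members; \<open>in_class\<close> is membership of
  a group over an arbitrary type.
\<close>

definition in_class :: "nat monoid set \<Rightarrow> ('a, 'm) monoid_scheme \<Rightarrow> bool" where
  "in_class \<C> G \<longleftrightarrow> group G \<and> (\<exists>K\<in>\<C>. G \<cong> K)"

definition extension_closed_pseudovariety :: "nat monoid set \<Rightarrow> bool" where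
  "extension_closed_pseudovariety \<C> \<longleftrightarrow>
     \<C> \<noteq> {} \<and>
     (\<forall>G\<in>\<C>. group G \<and> finite (carrier G)) \<and>
     (\<forall>G\<in>\<C>. \<forall>K. group K \<longrightarrow> G \<cong> K \<longrightarrow> K \<in> \<C>) \<and>
     (\<forall>G\<in>\<C>. \<forall>H. subgroup H G \<longrightarrow> G\<lparr>carrier := H\<rparr> \<in> \<C>) \<and>
     (\<forall>(I :: nat set) G. finite I \<longrightarrow> (\<forall>i\<in>I. G i \<in> \<C>) \<longrightarrow> in_class \<C> (product_group I G)) \<and>
     (\<forall>G\<in>\<C>. \<forall>N. N \<lhd> G \<longrightarrow> in_class \<C> (G Mod N)) \<and>
     (\<forall>G N. group G \<longrightarrow> N \<lhd> G \<longrightarrow> G\<lparr>carrier := N\<rparr> \<in> \<C> \<longrightarrow> in_class \<C> (G Mod N) \<longrightarrow> G \<in> \<C>)"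


section \<open>The pro-\<open>\<C>\<close> topology\<close>

definition co_normal_subgroups :: "nat monoid set \<Rightarrow> ('a, 'm) monoid_scheme \<Rightarrow> 'a set set" where
  "co_normal_subgroups \<C> G = {N. N \<lhd> G \<and> in_class \<C> (G Mod N)}"

definition pro_topology :: "nat monoid set \<Rightarrow> ('a, 'm) monoid_scheme \<Rightarrow> 'a topology" where
  "pro_topology \<C> G = topology (arbitrary union_of
     (\<lambda>U. \<exists>g\<in>carrier G. \<exists>N\<in>co_normal_subgroups \<C> G. U = g <#\<^bsub>G\<^esub> N))"

lemma co_normal_subgroups_Int:
  assumes C: "extension_closed_pseudovariety \<C>" and G: "group G"
    and N: "N \<in> co_normal_subgroups \<C> G" and M: "M \<in> co_normal_subgroups \<C> G"
  shows "N \<inter> M \<in> co_normal_subgroups \<C> G"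
proof -
  interpret G: group G by (rule G)
  note C = C[unfolded extension_closed_pseudovariety_def]
  note Cgrp = C[THEN conjunct2, THEN conjunct1]
  note Csub = C[THEN conjunct2, THEN conjunct2, THEN conjunct2, THEN conjunct1]
  note Cprod = C[THEN conjunct2, THEN conjunct2, THEN conjunct2, THEN conjunct2, THEN conjunct1]
  from N have N': "N \<lhd> G" and NC: "in_class \<C> (G Mod N)"
    by (auto simp: co_normal_subgroups_def)
  from M have M': "M \<lhd> G" and MC: "in_class \<C> (G Mod M)"
    by (auto simp: co_normal_subgroups_def)
  obtain K1 f1 where K1: "K1 \<in> \<C>" and f1: "f1 \<in> iso (G Mod N) K1"
    using NC by (auto simp: in_class_def is_iso_def)
  obtain K2 f2 where K2: "K2 \<in> \<C>" and f2: "f2 \<in> iso (G Mod M) K2"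
    using MC by (auto simp: in_class_def is_iso_def)
  define F where "F = (\<lambda>i::nat. if i = 0 then K1 else K2)"
  define P where "P = product_group {0, 1::nat} F"
  have grp: "group (F i)" for i
    using Cgrp K1 K2 by (simp add: F_def)
  have "in_class \<C> P"
    unfolding P_def using K1 K2 by (intro Cprod[rule_format]) (auto simp: F_def)
  then obtain K f where K: "K \<in> \<C>" and f: "f \<in> iso P K" and gP: "group P"
    by (auto simp: in_class_def is_iso_def)
  have gK: "group K"
    using Cgrp K by simp
  define h where "h = (\<lambda>g. \<lambda>i\<in>{0, 1::nat}. if i = 0 then f1 (N #>\<^bsub>G\<^esub> g) else f2 (M #>\<^bsub>G\<^esub> g))"
  have hN: "(\<lambda>g. f1 (N #>\<^bsub>G\<^esub> g)) \<in> hom G K1"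
    using Group.hom_compose[OF normal.r_coset_hom_Mod[OF N'], of f1 K1] f1
    by (simp add: iso_def o_def)
  have hM: "(\<lambda>g. f2 (M #>\<^bsub>G\<^esub> g)) \<in> hom G K2"
    using Group.hom_compose[OF normal.r_coset_hom_Mod[OF M'], of f2 K2] f2
    by (simp add: iso_def o_def)
  have hP: "h \<in> hom G P"
    using hN hM by (auto simp: hom_def P_def h_def F_def Pi_iff fun_eq_iff)
  have fh: "f \<circ> h \<in> hom G K"
    using Group.hom_compose[OF hP] f by (auto simp: iso_def)
  have gh: "group_hom G K (f \<circ> h)"
    by (simp add: group_hom_def group_hom_axioms_def G gK fh)
  define I where "I = (f \<circ> h) ` carrier G"
  have I: "subgroup I K"
    unfolding I_def by (rule group_hom.img_is_subgroup[OF gh])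
  have IC: "K\<lparr>carrier := I\<rparr> \<in> \<C>"
    using Csub K I by simp
  have gI: "group (K\<lparr>carrier := I\<rparr>)"
    using group.subgroup_imp_group[OF gK I] .
  have gh': "group_hom G (K\<lparr>carrier := I\<rparr>) (f \<circ> h)"
    using fh gI G unfolding group_hom_def group_hom_axioms_def by (auto simp: hom_def I_def)
  have one: "f1 (N #>\<^bsub>G\<^esub> g) = \<one>\<^bsub>K1\<^esub> \<longleftrightarrow> g \<in> N" if "g \<in> carrier G" for g
  proof -
    have gm: "group (G Mod N)" using NC by (simp add: in_class_def)
    have m: "N #>\<^bsub>G\<^esub> g \<in> carrier (G Mod N)" using that by (auto simp: carrier_FactGroup)
    have o: "f1 \<one>\<^bsub>G Mod N\<^esub> = \<one>\<^bsub>K1\<^esub>"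
      using hom_one[OF _ gm] f1 grp[of 0] by (auto simp: iso_def F_def)
    have "f1 (N #>\<^bsub>G\<^esub> g) = \<one>\<^bsub>K1\<^esub> \<longleftrightarrow> N #>\<^bsub>G\<^esub> g = \<one>\<^bsub>G Mod N\<^esub>"
      using f1 m o group.is_monoid[OF gm] unfolding iso_def bij_betw_def
      by (metis (mono_tags, lifting) inj_on_eq_iff mem_Collect_eq monoid.one_closed)
    also have "\<dots> \<longleftrightarrow> g \<in> N"
      using that N' G.coset_join1 G.coset_join2 normal_imp_subgroup subgroup.subset
      by (metis one_FactGroup)
    finally show ?thesis .
  qed
  have one': "f2 (M #>\<^bsub>G\<^esub> g) = \<one>\<^bsub>K2\<^esub> \<longleftrightarrow> g \<in> M" if "g \<in> carrier G" for g
  proof -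
    have gm: "group (G Mod M)" using MC by (simp add: in_class_def)
    have m: "M #>\<^bsub>G\<^esub> g \<in> carrier (G Mod M)" using that by (auto simp: carrier_FactGroup)
    have o: "f2 \<one>\<^bsub>G Mod M\<^esub> = \<one>\<^bsub>K2\<^esub>"
      using hom_one[OF _ gm] f2 grp[of 1] by (auto simp: iso_def F_def)
    have "f2 (M #>\<^bsub>G\<^esub> g) = \<one>\<^bsub>K2\<^esub> \<longleftrightarrow> M #>\<^bsub>G\<^esub> g = \<one>\<^bsub>G Mod M\<^esub>"
      using f2 m o group.is_monoid[OF gm] unfolding iso_def bij_betw_def
      by (metis (mono_tags, lifting) inj_on_eq_iff mem_Collect_eq monoid.one_closed)
    also have "\<dots> \<longleftrightarrow> g \<in> M"
      using that M' G.coset_join1 G.coset_join2 normal_imp_subgroup subgroup.subset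
      by (metis one_FactGroup)
    finally show ?thesis .
  qed
  have fone: "f x = \<one>\<^bsub>K\<^esub> \<longleftrightarrow> x = \<one>\<^bsub>P\<^esub>" if "x \<in> carrier P" for x
    using f that hom_one[OF _ gP gK, of f] group.is_monoid[OF gP] unfolding iso_def bij_betw_def
    by (metis (mono_tags, lifting) inj_on_eq_iff mem_Collect_eq monoid.one_closed)
  have hone: "h g = \<one>\<^bsub>P\<^esub> \<longleftrightarrow> g \<in> N \<inter> M" if "g \<in> carrier G" for g
    using one[OF that] one'[OF that] by (auto simp: h_def P_def F_def fun_eq_iff)
  have ker: "kernel G (K\<lparr>carrier := I\<rparr>) (f \<circ> h) = N \<inter> M"
  proof -
    have "N \<subseteq> carrier G"
      using N' by (simp add: normal_imp_subgroup subgroup.subset)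
    then show ?thesis
      using fone hone hom_in_carrier[OF hP] by (auto simp: kernel_def)
  qed
  have "G Mod (N \<inter> M) \<cong> K\<lparr>carrier := I\<rparr>"
    using group_hom.FactGroup_iso[OF gh', unfolded ker] by (simp add: I_def)
  moreover have "N \<inter> M \<lhd> G"
    using group_hom.normal_kernel[OF gh', unfolded ker] .
  ultimately show ?thesis
    using IC normal.factorgroup_is_group[of "N \<inter> M" G]
    by (auto simp: co_normal_subgroups_def in_class_def)
qed

lemma openin_pro_topology:
  assumes C: "extension_closed_pseudovariety \<C>" and G: "group G"
  shows "openin (pro_topology \<C> G) = arbitrary union_of
     (\<lambda>U. \<exists>g\<in>carrier G. \<exists>N\<in>co_normal_subgroups \<C> G. U = g <#\<^bsub>G\<^esub> N)"
    (is "_ = arbitrary union_of ?P")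
proof -
  interpret G: group G by (rule G)
  have "(arbitrary union_of ?P) (S \<inter> T)" if S: "?P S" and T: "?P T" for S T
  proof -
    from S T obtain g N h M where N: "N \<in> co_normal_subgroups \<C> G" "g \<in> carrier G" "S = g <#\<^bsub>G\<^esub> N"
      and M: "M \<in> co_normal_subgroups \<C> G" "h \<in> carrier G" "T = h <#\<^bsub>G\<^esub> M" by blast
    have sub: "subgroup N G" "subgroup M G"
      using N M by (auto simp: co_normal_subgroups_def normal_imp_subgroup)
    have NM: "N \<inter> M \<in> co_normal_subgroups \<C> G"
      using co_normal_subgroups_Int[OF C G N(1) M(1)] .
    have car: "x \<in> carrier G" if "x \<in> S" for x
      using G.l_coset_carrier N sub that by blast
    have Sx: "S = x <#\<^bsub>G\<^esub> N" if "x \<in> S" for x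
      using G.l_repr_independence[of x g N] N sub that by simp
    have Tx: "T = x <#\<^bsub>G\<^esub> M" if "x \<in> T" for x
      using G.l_repr_independence[of x h M] M sub that by simp
    have "S \<inter> T = (\<Union>x\<in>S \<inter> T. x <#\<^bsub>G\<^esub> (N \<inter> M))"
    proof (intro equalityI subsetI)
      fix x assume x: "x \<in> S \<inter> T"
      then have "x \<in> x <#\<^bsub>G\<^esub> (N \<inter> M)"
        using car sub subgroup.one_closed by (force simp: l_coset_def)
      with x show "x \<in> (\<Union>x\<in>S \<inter> T. x <#\<^bsub>G\<^esub> (N \<inter> M))" by blast
    next
      fix y assume "y \<in> (\<Union>x\<in>S \<inter> T. x <#\<^bsub>G\<^esub> (N \<inter> M))"
      then obtain x where "x \<in> S" "x \<in> T" "y \<in> x <#\<^bsub>G\<^esub> (N \<inter> M)" by blast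
      then show "y \<in> S \<inter> T"
        using Sx[of x] Tx[of x] unfolding l_coset_def by blast
    qed
    then show ?thesis
      unfolding union_of_def arbitrary_def using NM car
      by (intro exI[of _ "(\<lambda>x. x <#\<^bsub>G\<^esub> (N \<inter> M)) ` (S \<inter> T)"]) auto
  qed
  then have "istopology (arbitrary union_of ?P)"
    by (simp add: istopology_base_eq)
  then show ?thesis
    unfolding pro_topology_def by (rule topology_inverse')
qed

abbreviation separable_in :: "nat monoid set \<Rightarrow> ('a, 'm) monoid_scheme \<Rightarrow> 'a set \<Rightarrow> bool" where
  "separable_in \<C> G S \<equiv> closedin (pro_topology \<C> G) S"

definition residually :: "nat monoid set \<Rightarrow> ('a, 'm) monoid_scheme \<Rightarrow> bool" where
  "residually \<C> G \<longleftrightarrow> separable_in \<C> G {\<one>\<^bsub>G\<^esub>}"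

definition conjugacy_class :: "('a, 'm) monoid_scheme \<Rightarrow> 'a \<Rightarrow> 'a set" where
  "conjugacy_class G g = {h \<otimes>\<^bsub>G\<^esub> g \<otimes>\<^bsub>G\<^esub> inv\<^bsub>G\<^esub> h | h. h \<in> carrier G}"

definition conjugacy_separable :: "nat monoid set \<Rightarrow> ('a, 'm) monoid_scheme \<Rightarrow> bool" where
  "conjugacy_separable \<C> G \<longleftrightarrow> (\<forall>g\<in>carrier G. separable_in \<C> G (conjugacy_class G g))"

definition hereditarily_conjugacy_separable ::
    "nat monoid set \<Rightarrow> ('a, 'm) monoid_scheme \<Rightarrow> bool" where
  "hereditarily_conjugacy_separable \<C> G \<longleftrightarrow>
     conjugacy_separable \<C> G \<and>
     (\<forall>H. subgroup H G \<longrightarrow> openin (pro_topology \<C> G) H \<longrightarrow>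
        conjugacy_separable \<C> (G\<lparr>carrier := H\<rparr>))"


section \<open>Restricted wreath products\<close>

definition semidirect_product ::
    "('a, 'm) monoid_scheme \<Rightarrow> ('b, 'n) monoid_scheme \<Rightarrow> ('b \<Rightarrow> 'a \<Rightarrow> 'a) \<Rightarrow> ('a \<times> 'b) monoid" where
  "semidirect_product N H \<phi> =
     \<lparr>carrier = carrier N \<times> carrier H,
      monoid.mult = (\<lambda>(n, h) (n', h'). (n \<otimes>\<^bsub>N\<^esub> \<phi> h n', h \<otimes>\<^bsub>H\<^esub> h')),
      one = (\<one>\<^bsub>N\<^esub>, \<one>\<^bsub>H\<^esub>)\<rparr>"

definition left_translation ::
    "('b, 'n) monoid_scheme \<Rightarrow> 'b \<Rightarrow> ('b \<Rightarrow> 'a) \<Rightarrow> 'b \<Rightarrow> 'a" where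
  "left_translation B b f = (\<lambda>x\<in>carrier B. f (inv\<^bsub>B\<^esub> b \<otimes>\<^bsub>B\<^esub> x))"

text \<open>The carrier of \<open>sum_group\<close> consists of the finitely supported functions.\<close>

definition wreath_product ::
    "('a, 'm) monoid_scheme \<Rightarrow> ('b, 'n) monoid_scheme \<Rightarrow> (('b \<Rightarrow> 'a) \<times> 'b) monoid" where
  "wreath_product A B =
     semidirect_product (sum_group (carrier B) (\<lambda>_. A)) B (left_translation B)"

lemma group_wreath_product:
  assumes A: "group A" and B: "group B"
  shows "group (wreath_product A B)"
proof -
  interpret A: group A by (rule A)
  interpret B: group B by (rule B)
  let ?S = "sum_group (carrier B) (\<lambda>_. A)"
  let ?t = "left_translation B"
  interpret S: group ?S by (simp add: A)
  have cS: "carrier ?S = {x \<in> carrier B \<rightarrow>\<^sub>E carrier A. finite {i \<in> carrier B. x i \<noteq> \<one>\<^bsub>A\<^esub>}}"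
    by (simp add: carrier_sum_group A)
  have t_closed: "?t b f \<in> carrier ?S" if b: "b \<in> carrier B" and f: "f \<in> carrier ?S" for b f
  proof -
    have "{x \<in> carrier B. ?t b f x \<noteq> \<one>\<^bsub>A\<^esub>} \<subseteq> (\<lambda>x. b \<otimes>\<^bsub>B\<^esub> x) ` {x \<in> carrier B. f x \<noteq> \<one>\<^bsub>A\<^esub>}"
    proof
      fix x assume "x \<in> {x \<in> carrier B. ?t b f x \<noteq> \<one>\<^bsub>A\<^esub>}"
      then show "x \<in> (\<lambda>x. b \<otimes>\<^bsub>B\<^esub> x) ` {x \<in> carrier B. f x \<noteq> \<one>\<^bsub>A\<^esub>}"
        using b by (intro image_eqI[of _ _ "inv\<^bsub>B\<^esub> b \<otimes>\<^bsub>B\<^esub> x"])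
          (auto simp: left_translation_def B.m_assoc[symmetric])
    qed
    moreover have "finite {x \<in> carrier B. f x \<noteq> \<one>\<^bsub>A\<^esub>}" using f by (simp add: cS)
    ultimately have "finite {x \<in> carrier B. ?t b f x \<noteq> \<one>\<^bsub>A\<^esub>}"
      by (meson finite_imageI finite_subset)
    then show ?thesis
      using b f unfolding cS by (auto simp: left_translation_def PiE_iff)
  qed
  have t_mult: "?t b (f \<otimes>\<^bsub>?S\<^esub> g) = ?t b f \<otimes>\<^bsub>?S\<^esub> ?t b g" if "b \<in> carrier B" for b f g
    using that by (auto simp: left_translation_def fun_eq_iff)
  have t_comp: "?t b (?t c f) = ?t (b \<otimes>\<^bsub>B\<^esub> c) f" if "b \<in> carrier B" "c \<in> carrier B" for b c f
    using that by (auto simp: left_translation_def fun_eq_iff B.inv_mult_group B.m_assoc)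
  have t_one: "?t \<one>\<^bsub>B\<^esub> f = f" if "f \<in> carrier ?S" for f
    using that by (auto simp: left_translation_def cS PiE_iff extensional_def fun_eq_iff)
  have t_1: "?t b \<one>\<^bsub>?S\<^esub> = \<one>\<^bsub>?S\<^esub>" if "b \<in> carrier B" for b
    using that by (auto simp: left_translation_def fun_eq_iff)
  note [simp del] = mult_sum_group one_sum_group inv_sum_group
  show ?thesis
  proof (rule groupI)
    fix x assume "x \<in> carrier (wreath_product A B)"
    then obtain f b where x: "x = (f, b)" "f \<in> carrier ?S" "b \<in> carrier B"
      by (auto simp: wreath_product_def semidirect_product_def)
    show "\<exists>y\<in>carrier (wreath_product A B). y \<otimes>\<^bsub>wreath_product A B\<^esub> x = \<one>\<^bsub>wreath_product A B\<^esub>"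
      using x t_closed t_mult[symmetric] t_1
      by (intro bexI[of _ "(inv\<^bsub>?S\<^esub> (?t (inv\<^bsub>B\<^esub> b) f), inv\<^bsub>B\<^esub> b)"])
        (auto simp: wreath_product_def semidirect_product_def)
  qed (auto simp: wreath_product_def semidirect_product_def t_closed t_mult t_comp t_one
        S.m_assoc B.m_assoc)
qed

end

theory Submission
  imports Defs
begin

text \<open>
  A group \<open>G\<close> is hereditarily conjugacy separable iff for every \<open>g\<close> and arbitrarily small \<open>N\<close> the
  class \<open>{n g n\<^sup>-\<^sup>1 | n \<in> N}\<close> is closed in \<open>G\<close>, because the class of \<open>g\<close> under the open
  subgroup \<open>N \<langle>g\<rangle>\<close> is the class under \<open>N\<close>, and the class under any open subgroup is a finite union of
  conjugates of such classes.

  If \<open>a\<close>, \<open>a'\<close> do not commute and \<open>N\<close> avoids their commutator in the coordinate 1 of the base, then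
  \<open>B\<close> meets \<open>N\<close> trivially, since \<open>b \<in> N\<close> moves \<open>a'\<close> modulo \<open>N\<close> to the coordinate \<open>b\<close>, where it
  commutes with \<open>a\<close>; so \<open>B\<close> lies in the class. If \<open>A\<close> is abelian, \<open>a \<noteq> 1\<close> and \<open>x\<close> is not a power of \<open>b\<close>, then
  \<open>b\<close> is not conjugate to \<open>f b\<close>, where \<open>f\<close> is \<open>a\<close> at 1 and \<open>a\<^sup>-\<^sup>1\<close> at \<open>x\<close>, but becomes so modulo every
  \<open>N\<close> for which \<open>x\<close> is a power of \<open>b\<close> modulo \<open>B \<inter> N\<close>.

  Conversely, for \<open>B\<close> in the class, elements \<open>f b\<close> and \<open>f' b\<close> are conjugate by the base iff on each
  cycle of \<open>b\<close> the cyclically ordered products of \<open>f\<close> and \<open>f'\<close> are conjugate in \<open>A\<close>.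
  For \<open>A\<close> abelian the base group \<open>V\<close> is a module, and conjugacy of \<open>f b\<close> and \<open>f' b\<close> means
  \<open>f' - c f \<in> (1 - b) V\<close> for some \<open>c\<close> centralizing \<open>b\<close>. The centralizer condition in \<open>B\<close> lifts approximate
  centralizers to true ones, the support of \<open>f\<close> leaves only finitely many \<open>c\<close>, and the image of
  \<open>1 - b\<close> is closed by the vanishing of the homology and Tate cohomology of cyclic groups with coefficients
  in permutation modules.
\<close>

section \<open>Classes of finite groups and the pro-\<open>\<C>\<close> topology\<close>

text \<open>Heredity demands conjugating elements inside a prescribed \<open>N\<close>, and this
  shapes the abelian case. If \<open>h\<close> is a limit of values of \<open>diff b\<close> on
  \<open>base N\<close>, vanishing sums over cycles give \<open>h = diff b u\<close> only with
  \<open>u\<close> in \<open>V\<close>. Subtracting an approximate solution in \<open>base N\<close>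
  from \<open>u\<close> leaves a \<open>w\<close> with \<open>diff b w\<close> small, and modulo
  \<open>base N\<close> such a \<open>w\<close> is a norm \<open>power_base w' b q\<close>, where
  \<open>q\<close> is the least positive exponent with \<open>b [^] q\<close> in a small
  \<open>K\<close>. The norm is harmless in two cases: \<open>diff b\<close> kills it if
  \<open>b [^] q\<close> is trivial, and it lies in \<open>base N\<close> if \<open>q\<close> is a
  multiple of the order \<open>m\<close> of \<open>W Mod N\<close>. \<open>powers_avoiding\<close>
  makes \<open>K\<close> so small that one of these occurs; for \<open>b\<close> of infinite order
  this rests on separability of the subgroup generated by \<open>b [^] m\<close>, not by
  \<open>b\<close>. The same \<open>m\<close> bounds the powers of \<open>b\<close> that matter for
  a centralizing element. A second obstacle is that an open subgroup carries its own pro-\<C>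
  topology. Closure under extensions, through \<open>co_normal_trans\<close>, lets all arguments be
  run with normal subgroups of the whole group.\<close>

lemma r_coset_eq_iff_mem:
  assumes "N \<lhd> G" "g \<in> carrier G"
  shows "N #>\<^bsub>G\<^esub> g = N \<longleftrightarrow> g \<in> N"
proof -
  interpret normal N G by fact
  show ?thesis
    using assms(2) by (metis coset_join1 coset_join2 is_subgroup subset)
qed

locale pseudovariety =
  fixes \<C> :: "nat monoid set"
  assumes pseudovariety: "extension_closed_pseudovariety \<C>"
begin

lemmas axioms_split = pseudovariety[unfolded extension_closed_pseudovariety_def]

lemma mem_group: "K \<in> \<C> \<Longrightarrow> group K"
  and mem_finite: "K \<in> \<C> \<Longrightarrow> finite (carrier K)"
  using axioms_split[THEN conjunct2, THEN conjunct1] by simp_all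

lemma mem_iso: "K \<in> \<C> \<Longrightarrow> group L \<Longrightarrow> K \<cong> L \<Longrightarrow> L \<in> \<C>"
  using axioms_split[THEN conjunct2, THEN conjunct2, THEN conjunct1] by simp

lemma mem_subgroup: "K \<in> \<C> \<Longrightarrow> subgroup H K \<Longrightarrow> K\<lparr>carrier := H\<rparr> \<in> \<C>"
  using axioms_split[THEN conjunct2, THEN conjunct2, THEN conjunct2, THEN conjunct1] by simp

lemma mem_quotient: "K \<in> \<C> \<Longrightarrow> N \<lhd> K \<Longrightarrow> in_class \<C> (K Mod N)"
  using axioms_split[THEN conjunct2, THEN conjunct2, THEN conjunct2, THEN conjunct2,
      THEN conjunct2, THEN conjunct1] by simp

lemma mem_extension:
  "group K \<Longrightarrow> N \<lhd> K \<Longrightarrow> K\<lparr>carrier := N\<rparr> \<in> \<C> \<Longrightarrow> in_class \<C> (K Mod N) \<Longrightarrow> K \<in> \<C>"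
  using axioms_split[THEN conjunct2, THEN conjunct2, THEN conjunct2, THEN conjunct2,
      THEN conjunct2, THEN conjunct2] by simp

lemma in_class_group: "in_class \<C> G \<Longrightarrow> group G"
  by (simp add: in_class_def)

lemma in_class_finite: "in_class \<C> G \<Longrightarrow> finite (carrier G)"
  unfolding in_class_def is_iso_def iso_def
  using mem_finite bij_betw_finite by blast

text \<open>The subgroup axiom holds for representatives on natural numbers, so the image of
  \<open>G\<close> is taken inside a representative \<open>L\<close> of \<open>K\<close>.\<close>

lemma in_class_mono:
  assumes K: "in_class \<C> K" and G: "group G" and f: "f \<in> hom G K" "inj_on f (carrier G)"
  shows "in_class \<C> G"
proof -
  obtain L \<phi> where L: "L \<in> \<C>" and \<phi>: "\<phi> \<in> iso K L"
    using K by (auto simp: in_class_def is_iso_def)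
  have gL: "group L" using L by (rule mem_group)
  have h: "\<phi> \<circ> f \<in> hom G L"
    using f(1) \<phi> by (auto simp: iso_def intro: Group.hom_compose)
  have inj: "inj_on (\<phi> \<circ> f) (carrier G)"
    using f \<phi> by (intro comp_inj_on) (auto simp: iso_def bij_betw_def hom_def intro: inj_on_subset)
  define I where "I = (\<phi> \<circ> f) ` carrier G"
  have I: "subgroup I L"
    unfolding I_def using group_hom.img_is_subgroup[of G L "\<phi> \<circ> f"] h G gL
    by (simp add: group_hom_def group_hom_axioms_def)
  have "\<phi> \<circ> f \<in> iso G (L\<lparr>carrier := I\<rparr>)"
    using h inj by (auto simp: iso_def hom_def bij_betw_def I_def)
  then show ?thesis
    using G mem_subgroup[OF L I] by (auto simp: in_class_def is_iso_def)
qed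

lemma in_class_iso:
  assumes "in_class \<C> G" "group H" "G \<cong> H"
  shows "in_class \<C> H"
proof -
  obtain f where "f \<in> iso H G"
    using group.iso_sym[OF in_class_group[OF assms(1)] assms(3)] by (auto simp: is_iso_def)
  then show ?thesis
    using in_class_mono[OF assms(1,2)] by (auto simp: iso_def bij_betw_def)
qed

lemma in_class_epi:
  assumes G: "in_class \<C> G" and K: "group K" and f: "f \<in> hom G K" "f ` carrier G = carrier K"
  shows "in_class \<C> K"
proof -
  obtain L where L: "L \<in> \<C>" "G \<cong> L"
    using G by (auto simp: in_class_def)
  obtain \<psi> where \<psi>: "\<psi> \<in> iso L G"
    using group.iso_sym[OF in_class_group[OF G] L(2)] by (auto simp: is_iso_def)
  have gL: "group L" using L by (simp add: mem_group)
  have h: "f \<circ> \<psi> \<in> hom L K"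
    using f \<psi> by (auto simp: iso_def intro: Group.hom_compose)
  have im: "(f \<circ> \<psi>) ` carrier L = carrier K"
    using f \<psi> by (simp add: iso_def bij_betw_def image_comp[symmetric] del: o_apply)
  interpret gh: group_hom L K "f \<circ> \<psi>"
    using h gL K by (simp add: group_hom_def group_hom_axioms_def)
  have "in_class \<C> (L Mod kernel L K (f \<circ> \<psi>))"
    by (rule mem_quotient[OF L(1) gh.normal_kernel])
  then show ?thesis
    using gh.FactGroup_iso[OF im] K in_class_iso by blast
qed

text \<open>The extension axiom speaks only of groups on natural numbers. Kernel and image are
  finite, hence so is \<open>G\<close>; an injection \<open>e\<close> into the naturals carries the
  structure of \<open>G\<close> over to \<open>L\<close>, where the axiom applies.\<close>

lemma in_class_extension:
  assumes G: "group G" and Q: "in_class \<C> Q" and f: "f \<in> hom G Q"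
    and N: "in_class \<C> (G\<lparr>carrier := kernel G Q f\<rparr>)"
  shows "in_class \<C> G"
proof -
  interpret G: group G by fact
  have gQ: "group Q" using Q by (rule in_class_group)
  interpret f: group_hom G Q f
    using f gQ G by (simp add: group_hom_def group_hom_axioms_def)
  have finN: "finite (kernel G Q f)" using in_class_finite[OF N] by simp
  have "finite {x \<in> carrier G. f x = q}" if "q \<in> f ` carrier G" for q
  proof -
    from that obtain g where g: "g \<in> carrier G" "q = f g" by blast
    have "{x \<in> carrier G. f x = q} \<subseteq> (\<lambda>n. n \<otimes>\<^bsub>G\<^esub> g) ` kernel G Q f"
    proof
      fix x assume x: "x \<in> {x \<in> carrier G. f x = q}"
      then have "x \<otimes>\<^bsub>G\<^esub> inv\<^bsub>G\<^esub> g \<in> kernel G Q f" using g by (simp add: kernel_def)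
      moreover have "x = (x \<otimes>\<^bsub>G\<^esub> inv\<^bsub>G\<^esub> g) \<otimes>\<^bsub>G\<^esub> g" using x g by (simp add: G.m_assoc)
      ultimately show "x \<in> (\<lambda>n. n \<otimes>\<^bsub>G\<^esub> g) ` kernel G Q f" by blast
    qed
    then show ?thesis using finN finite_surj by blast
  qed
  moreover have "finite (f ` carrier G)"
    using in_class_finite[OF Q] f.homh by (metis f.hom_closed finite_subset image_subsetI)
  ultimately have "finite (\<Union>q\<in>f ` carrier G. {x \<in> carrier G. f x = q})" by (rule finite_UN_I[rotated])
  moreover have "(\<Union>q\<in>f ` carrier G. {x \<in> carrier G. f x = q}) = carrier G" by blast
  ultimately have fin: "finite (carrier G)" by simp
  obtain e :: "'a \<Rightarrow> nat" where e: "inj_on e (carrier G)"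
    using fin finite_imp_inj_to_nat_seg by blast
  define i where "i = inv_into (carrier G) e"
  have ie [simp]: "i (e x) = x" if "x \<in> carrier G" for x
    using that e by (simp add: i_def)
  define L where "L = \<lparr>carrier = e ` carrier G, monoid.mult = (\<lambda>x y. e (i x \<otimes>\<^bsub>G\<^esub> i y)), one = e \<one>\<^bsub>G\<^esub>\<rparr>"
  have L: "group L"
    by (rule groupI) (auto simp: L_def G.m_assoc intro!: bexI[of _ "inv\<^bsub>G\<^esub> _"])
  have eiso: "e \<in> iso G L"
    using e by (auto simp: iso_def hom_def bij_betw_def L_def)
  have ihom: "i \<in> hom L G" and iim: "i ` carrier L = carrier G"
    by (auto simp: hom_def L_def image_comp)
  have fi: "f \<circ> i \<in> hom L Q"
    using ihom f by (rule Group.hom_compose)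
  interpret fi: group_hom L Q "f \<circ> i"
    using fi L gQ by (simp add: group_hom_def group_hom_axioms_def)
  define M where "M = kernel L Q (f \<circ> i)"
  have "in_class \<C> (L Mod M)"
    unfolding M_def
    by (rule in_class_mono[OF Q _ fi.FactGroup_hom fi.FactGroup_inj_on])
       (rule normal.factorgroup_is_group[OF fi.normal_kernel])
  moreover have "L\<lparr>carrier := M\<rparr> \<in> \<C>"
  proof -
    have gM: "group (L\<lparr>carrier := M\<rparr>)"
      unfolding M_def using group.subgroup_imp_group[OF L fi.subgroup_kernel] .
    have "i \<in> hom (L\<lparr>carrier := M\<rparr>) (G\<lparr>carrier := kernel G Q f\<rparr>)"
      using ihom by (auto simp: hom_def M_def kernel_def Pi_iff)
    moreover have "inj_on i (carrier (L\<lparr>carrier := M\<rparr>))"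
      by (auto simp: inj_on_def M_def kernel_def L_def)
    ultimately have "in_class \<C> (L\<lparr>carrier := M\<rparr>)"
      using in_class_mono[OF N gM] by blast
    then show ?thesis
      using mem_iso gM group.iso_sym[OF gM] by (auto simp: in_class_def)
  qed
  ultimately have "L \<in> \<C>"
    using mem_extension[OF L] fi.normal_kernel M_def by blast
  then show ?thesis
    using G eiso by (auto simp: in_class_def is_iso_def)
qed

lemma co_normalD:
  assumes "N \<in> co_normal_subgroups \<C> G"
  shows "N \<lhd> G" "in_class \<C> (G Mod N)" "subgroup N G" "N \<subseteq> carrier G" "\<one>\<^bsub>G\<^esub> \<in> N" "group G"
proof -
  show N: "N \<lhd> G" "in_class \<C> (G Mod N)"
    using assms by (auto simp: co_normal_subgroups_def)
  interpret normal N G by fact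
  show "subgroup N G" "N \<subseteq> carrier G" "\<one>\<^bsub>G\<^esub> \<in> N" "group G"
    using is_subgroup subset one_closed is_group by auto
qed

lemma co_normal_kernel:
  assumes G: "group G" and Q: "in_class \<C> Q" and f: "f \<in> hom G Q"
  shows "kernel G Q f \<in> co_normal_subgroups \<C> G"
proof -
  interpret f: group_hom G Q f
    using f in_class_group[OF Q] G by (simp add: group_hom_def group_hom_axioms_def)
  show ?thesis
    unfolding co_normal_subgroups_def
    using in_class_mono[OF Q normal.factorgroup_is_group[OF f.normal_kernel] f.FactGroup_hom
        f.FactGroup_inj_on] f.normal_kernel by blast
qed

text \<open>The preimage is the kernel of \<open>f\<close> followed by the quotient map. As
  \<open>f\<close> need not be onto, this serves inclusions of subgroups, the embeddings of
  \<open>A\<close>, \<open>B\<close> and \<open>V\<close> into \<open>W\<close>, and the projection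
  of \<open>W\<close> to \<open>B\<close>.\<close>

lemma co_normal_vimage:
  assumes G: "group G" and f: "f \<in> hom G K" and N: "N \<in> co_normal_subgroups \<C> K"
  shows "{g \<in> carrier G. f g \<in> N} \<in> co_normal_subgroups \<C> G"
proof -
  note N' = co_normalD[OF N]
  have "(\<lambda>a. N #>\<^bsub>K\<^esub> a) \<circ> f \<in> hom G (K Mod N)"
    using f normal.r_coset_hom_Mod[OF N'(1)] by (rule Group.hom_compose)
  from co_normal_kernel[OF G N'(2) this]
  show ?thesis
    using r_coset_eq_iff_mem[OF N'(1)] hom_in_carrier[OF f] by (simp add: kernel_def cong: conj_cong)
qed

lemma co_normal_restrict:
  assumes "N \<in> co_normal_subgroups \<C> G" "subgroup H G"
  shows "N \<inter> H \<in> co_normal_subgroups \<C> (G\<lparr>carrier := H\<rparr>)"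
proof -
  have "group (G\<lparr>carrier := H\<rparr>)"
    using co_normalD(6)[OF assms(1)] assms(2) by (simp add: group.subgroup_imp_group)
  moreover have "(\<lambda>x. x) \<in> hom (G\<lparr>carrier := H\<rparr>) G"
    using assms(2) subgroup.mem_carrier by (fastforce simp: hom_def)
  ultimately have "{g \<in> carrier (G\<lparr>carrier := H\<rparr>). g \<in> N} \<in> co_normal_subgroups \<C> (G\<lparr>carrier := H\<rparr>)"
    using co_normal_vimage[OF _ _ assms(1)] by blast
  then show ?thesis
    by (simp add: Int_def conj_commute)
qed

lemma co_normal_superset:
  assumes N: "N \<in> co_normal_subgroups \<C> G" and M: "M \<lhd> G" "N \<subseteq> M"
  shows "M \<in> co_normal_subgroups \<C> G"
proof -
  note N' = co_normalD[OF N]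
  interpret normal M G by fact
  have "M #>\<^bsub>G\<^esub> x = M #>\<^bsub>G\<^esub> y"
    if "x \<in> carrier G" "y \<in> carrier G" "N #>\<^bsub>G\<^esub> x = N #>\<^bsub>G\<^esub> y" for x y
  proof -
    have "x \<in> N #>\<^bsub>G\<^esub> y"
      using that rcos_self[OF that(1) N'(3)] by simp
    then have "x \<in> M #>\<^bsub>G\<^esub> y"
      using M(2) by (auto simp: r_coset_def)
    then show ?thesis
      using that is_subgroup repr_independence by metis
  qed
  then obtain h where h: "h \<in> hom (G Mod N) (G Mod M)"
    "\<And>x. x \<in> carrier G \<Longrightarrow> h (N #>\<^bsub>G\<^esub> x) = M #>\<^bsub>G\<^esub> x"
    using FactGroup_universal[OF normal.r_coset_hom_Mod[OF M(1)] N'(1)] by metis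
  have "h ` carrier (G Mod N) = carrier (G Mod M)"
    using h(2) by (auto simp: carrier_FactGroup image_iff)
  then show ?thesis
    using in_class_epi[OF N'(2) normal.factorgroup_is_group[OF M(1)] h(1)] M(1)
    by (simp add: co_normal_subgroups_def)
qed

lemma co_normal_Int:
  assumes "N \<in> co_normal_subgroups \<C> G" "M \<in> co_normal_subgroups \<C> G"
  shows "N \<inter> M \<in> co_normal_subgroups \<C> G"
  using co_normal_subgroups_Int[OF pseudovariety co_normalD(6)[OF assms(1)] assms] .

lemma co_normal_carrier:
  assumes "group G"
  shows "carrier G \<in> co_normal_subgroups \<C> G"
proof -
  obtain K where K: "K \<in> \<C>"
    using axioms_split[THEN conjunct1] by blast
  then have "in_class \<C> K" unfolding in_class_def using mem_group iso_refl by blast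
  moreover have "(\<lambda>x. \<one>\<^bsub>K\<^esub>) \<in> hom G K"
    using trivial_hom[OF mem_group[OF K]] .
  ultimately show ?thesis
    using co_normal_kernel[OF assms, of K "\<lambda>x. \<one>\<^bsub>K\<^esub>"] by (simp add: kernel_def)
qed

text \<open>Intersections of two members are members, so finitely many requirements that survive
  shrinking are met at once. This is why requirements below are phrased to be antitone in
  \<open>N\<close>, mostly as the avoidance of some element.\<close>

lemma co_normal_choice:
  assumes "finite I" and G: "group G"
    and ex: "\<And>i. i \<in> I \<Longrightarrow> \<exists>N\<in>co_normal_subgroups \<C> G. P i N"
    and anti: "\<And>i N M. i \<in> I \<Longrightarrow> P i N \<Longrightarrow> M \<subseteq> N \<Longrightarrow> P i M"
  shows "\<exists>N\<in>co_normal_subgroups \<C> G. \<forall>i\<in>I. P i N"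
  using assms(1) ex anti
proof (induction I rule: finite_induct)
  case empty
  then show ?case using co_normal_carrier[OF G] by auto
next
  case (insert j I)
  have "\<exists>N\<in>co_normal_subgroups \<C> G. \<forall>i\<in>I. P i N"
    by (rule insert.IH) (use insert.prems in blast)+
  then obtain N where N: "N \<in> co_normal_subgroups \<C> G" "\<forall>i\<in>I. P i N" by blast
  obtain M where M: "M \<in> co_normal_subgroups \<C> G" "P j M"
    using insert.prems(1) by blast
  show ?case
    using insert.prems(2) N M by (intro bexI[OF _ co_normal_Int[OF N(1) M(1)]]) blast
qed

text \<open>Finite index turns a condition on all of \<open>G\<close> into finitely many, on which
  \<open>co_normal_choice\<close> can act.\<close>

lemma co_normal_transversal:
  fixes G (structure)
  assumes N: "N \<in> co_normal_subgroups \<C> G"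
  obtains F where "finite F" "F \<subseteq> carrier G"
    "\<And>g. g \<in> carrier G \<Longrightarrow> \<exists>t\<in>F. \<exists>n\<in>N. g = t \<otimes>\<^bsub>G\<^esub> n"
proof -
  note N' = co_normalD[OF N]
  interpret group G by fact
  interpret normal N G by fact
  have fin: "finite (rcosets N)"
    using in_class_finite[OF N'(2)] by (simp add: FactGroup_def)
  define F where "F = image (\<lambda>Y. SOME x. x \<in> Y) (rcosets N)"
  have some: "(SOME x. x \<in> Y) \<in> Y" if "Y \<in> rcosets N" for Y
    using rcosets_non_empty[OF that] by (simp add: some_in_eq)
  have "F \<subseteq> carrier G"
    unfolding F_def using some rcosets_carrier[OF N'(6)] by blast
  moreover have "\<exists>t\<in>F. \<exists>n\<in>N. g = t \<otimes> n" if g: "g \<in> carrier G" for g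
  proof -
    define t where "t = (SOME x. x \<in> N #> g)"
    have Y: "N #> g \<in> rcosets N" using g by (auto simp: RCOSETS_def)
    then have t: "t \<in> F" "t \<in> N #> g" by (auto simp: F_def t_def some)
    then have "t \<in> g <# N" using coset_eq g by simp
    then obtain n where n: "n \<in> N" "t = g \<otimes> n" by (auto simp: l_coset_def)
    then have "g = t \<otimes> inv n" using g N'(4) by (auto simp: m_assoc)
    then show ?thesis using t n by blast
  qed
  moreover have "finite F" using fin by (simp add: F_def)
  ultimately show thesis using that by blast
qed

lemma openin_pro_topology_iff:
  fixes G (structure)
  assumes G: "group G"
  shows "openin (pro_topology \<C> G) U \<longleftrightarrow>
    U \<subseteq> carrier G \<and> (\<forall>x\<in>U. \<exists>N\<in>co_normal_subgroups \<C> G. x <#\<^bsub>G\<^esub> N \<subseteq> U)"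
proof -
  interpret group G by fact
  show ?thesis
    unfolding openin_pro_topology[OF pseudovariety G]
  proof (intro iffI conjI ballI)
    assume "(arbitrary union_of (\<lambda>U. \<exists>g\<in>carrier G. \<exists>N\<in>co_normal_subgroups \<C> G. U = g <# N)) U"
    then obtain \<U> where \<U>: "U = \<Union>\<U>"
      "\<And>V. V \<in> \<U> \<Longrightarrow> \<exists>g\<in>carrier G. \<exists>N\<in>co_normal_subgroups \<C> G. V = g <# N"
      unfolding union_of_def by blast
    show "U \<subseteq> carrier G"
      using \<U> co_normalD(4) l_coset_subset_G by blast
    fix x assume "x \<in> U"
    then obtain g N where gN: "g \<in> carrier G" "N \<in> co_normal_subgroups \<C> G" "g <# N \<in> \<U>" "x \<in> g <# N"
      using \<U> by blast
    then have "x <# N \<subseteq> U"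
      using l_repr_independence[of x g N] co_normalD(3)[OF gN(2)] \<U>(1) by auto
    then show "\<exists>N\<in>co_normal_subgroups \<C> G. x <# N \<subseteq> U" using gN by blast
  next
    assume U: "U \<subseteq> carrier G \<and> (\<forall>x\<in>U. \<exists>N\<in>co_normal_subgroups \<C> G. x <# N \<subseteq> U)"
    then obtain N where N: "\<And>x. x \<in> U \<Longrightarrow> N x \<in> co_normal_subgroups \<C> G \<and> x <# N x \<subseteq> U" by metis
    have "x \<in> x <# N x" if "x \<in> U" for x
      using N[OF that] U that co_normalD(5) by (force simp: l_coset_def)
    then have "U = (\<Union>x\<in>U. x <# N x)" using N by blast
    then show "(arbitrary union_of (\<lambda>U. \<exists>g\<in>carrier G. \<exists>N\<in>co_normal_subgroups \<C> G. U = g <# N)) U"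
      unfolding union_of_def arbitrary_def using N U
      by (intro exI[of _ "(\<lambda>x. x <# N x) ` U"]) blast
  qed
qed

lemma separable_in_iff:
  fixes G (structure)
  assumes G: "group G"
  shows "separable_in \<C> G S \<longleftrightarrow> S \<subseteq> carrier G \<and>
    (\<forall>x\<in>carrier G. (\<forall>N\<in>co_normal_subgroups \<C> G. \<exists>n\<in>N. x \<otimes>\<^bsub>G\<^esub> n \<in> S) \<longrightarrow> x \<in> S)"
proof -
  interpret group G by fact
  have "openin (pro_topology \<C> G) (carrier G)"
    using co_normal_carrier[OF G] l_coset_subset_G[OF subset_refl]
    unfolding openin_pro_topology_iff[OF G] by blast
  moreover have "openin (pro_topology \<C> G) U \<Longrightarrow> U \<subseteq> carrier G" for U
    by (simp add: openin_pro_topology_iff[OF G])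
  ultimately have top: "topspace (pro_topology \<C> G) = carrier G"
    by (metis openin_subset openin_topspace subset_antisym)
  have "(x <# N \<subseteq> carrier G - S) \<longleftrightarrow> \<not> (\<exists>n\<in>N. x \<otimes> n \<in> S)"
    if "x \<in> carrier G" "N \<in> co_normal_subgroups \<C> G" for x N
    using that co_normalD(4)[OF that(2)] by (auto simp: l_coset_def)
  then show ?thesis
    unfolding closedin_def top openin_pro_topology_iff[OF G] by (auto 0 4)
qed

end

section \<open>Hereditary conjugacy separability\<close>

context group
begin

lemma mult_inv_cancel_left: "x \<in> carrier G \<Longrightarrow> y \<in> carrier G \<Longrightarrow> x \<otimes> (inv x \<otimes> y) = y"
  and inv_mult_cancel_left: "x \<in> carrier G \<Longrightarrow> y \<in> carrier G \<Longrightarrow> inv x \<otimes> (x \<otimes> y) = y"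
  by (simp_all add: m_assoc[symmetric])

lemmas group_simps = m_assoc inv_mult_group mult_inv_cancel_left inv_mult_cancel_left

lemma pow_conj:
  assumes "m \<in> carrier G" "g \<in> carrier G"
  shows "(m \<otimes> g \<otimes> inv m) [^] (q::nat) = m \<otimes> g [^] q \<otimes> inv m"
  by (induction q) (use assms in \<open>simp_all add: group_simps\<close>)

end

definition class_under :: "('a, 'm) monoid_scheme \<Rightarrow> 'a set \<Rightarrow> 'a \<Rightarrow> 'a set" where
  "class_under G H g = (\<lambda>h. h \<otimes>\<^bsub>G\<^esub> g \<otimes>\<^bsub>G\<^esub> inv\<^bsub>G\<^esub> h) ` H"

lemma class_underI: "h \<in> H \<Longrightarrow> h \<otimes>\<^bsub>G\<^esub> g \<otimes>\<^bsub>G\<^esub> inv\<^bsub>G\<^esub> h \<in> class_under G H g"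
  unfolding class_under_def by (rule imageI)

lemma class_underE:
  assumes "y \<in> class_under G H g"
  obtains h where "h \<in> H" "y = h \<otimes>\<^bsub>G\<^esub> g \<otimes>\<^bsub>G\<^esub> inv\<^bsub>G\<^esub> h"
  using assms unfolding class_under_def by (rule imageE)

lemma conjugacy_class_restrict:
  assumes "group G" "subgroup H G"
  shows "conjugacy_class (G\<lparr>carrier := H\<rparr>) g = class_under G H g"
  using group.m_inv_consistent[OF assms]
  by (auto simp: conjugacy_class_def class_under_def image_def cong: conj_cong) metis

context pseudovariety
begin

text \<open>Membership in the closure of \<open>S\<close> in the pro-\<C> topology, expressed by
  cosets. Only normal subgroups of \<open>G\<close> itself enter, so adherence in a subgroup is a
  priori a different notion.\<close>

definition adherent :: "('a, 'm) monoid_scheme \<Rightarrow> 'a set \<Rightarrow> 'a \<Rightarrow> bool" where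
  "adherent G S x \<longleftrightarrow> (\<forall>N\<in>co_normal_subgroups \<C> G. \<exists>n\<in>N. x \<otimes>\<^bsub>G\<^esub> n \<in> S)"

lemma separable_in_iff_adherent:
  "group G \<Longrightarrow> separable_in \<C> G S \<longleftrightarrow>
    S \<subseteq> carrier G \<and> (\<forall>x\<in>carrier G. adherent G S x \<longrightarrow> x \<in> S)"
  by (simp add: separable_in_iff adherent_def)

text \<open>Conjugation by an element of \<open>M\<close> permutes the class under \<open>M\<close>
  and maps every \<open>N\<close> to itself. It serves to normalize a limit point before it is
  studied.\<close>

lemma adherent_conj:
  fixes G (structure)
  assumes G: "group G" and M: "subgroup M G" and k: "k \<in> M" and g: "g \<in> carrier G" and x: "x \<in> carrier G"
    and adh: "adherent G (class_under G M g) x"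
  shows "adherent G (class_under G M g) (inv k \<otimes> x \<otimes> k)"
  unfolding adherent_def
proof
  interpret group G by fact
  fix N assume N: "N \<in> co_normal_subgroups \<C> G"
  note N' = co_normalD[OF N]
  obtain n h where nh: "n \<in> N" "h \<in> M" "x \<otimes> n = h \<otimes> g \<otimes> inv h"
    using adh N by (force simp: adherent_def class_under_def)
  have c: "n \<in> carrier G" "h \<in> carrier G" "k \<in> carrier G"
    using nh k N'(4) subgroup.subset[OF M] by auto
  have "(inv k \<otimes> x \<otimes> k) \<otimes> (inv k \<otimes> n \<otimes> k) = inv k \<otimes> (x \<otimes> n) \<otimes> k"
    using c x by (simp add: group_simps)
  also have "\<dots> = (inv k \<otimes> h) \<otimes> g \<otimes> inv (inv k \<otimes> h)"
    using c g by (simp add: nh group_simps)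
  finally have "(inv k \<otimes> x \<otimes> k) \<otimes> (inv k \<otimes> n \<otimes> k) \<in> class_under G M g"
    unfolding class_under_def
    by (rule image_eqI) (simp add: subgroup.m_closed[OF M] subgroup.m_inv_closed[OF M] k nh)
  moreover have "inv k \<otimes> n \<otimes> k \<in> N"
    using normal.inv_op_closed1[OF N'(1) c(3) nh(1)] .
  ultimately show "\<exists>n\<in>N. inv k \<otimes> x \<otimes> k \<otimes> n \<in> class_under G M g" by blast
qed

text \<open>The normal core of \<open>Q\<close> is an intersection of finitely many conjugates because \<open>Q\<close> is normal
  in the subgroup \<open>P\<close> of finite index; closure under extensions does the rest.\<close>

lemma co_normal_trans:
  fixes G (structure)
  assumes P: "P \<in> co_normal_subgroups \<C> G"
    and Q: "Q \<in> co_normal_subgroups \<C> (G\<lparr>carrier := P\<rparr>)"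
  shows "\<exists>R\<in>co_normal_subgroups \<C> G. R \<subseteq> Q"
proof -
  note P' = co_normalD[OF P]
  note Q' = co_normalD[OF Q]
  interpret group G by fact
  interpret P: normal P G by fact
  interpret Q: normal Q "G\<lparr>carrier := P\<rparr>" by fact
  have PG: "p \<in> carrier G" if "p \<in> P" for p using that P'(4) by blast
  have QP: "Q \<subseteq> P" using Q'(4) by simp
  have invP: "inv\<^bsub>G\<lparr>carrier := P\<rparr>\<^esub> p = inv p" if "p \<in> P" for p
    using m_inv_consistent[OF P'(3) that] .
  obtain F where F: "finite F" "F \<subseteq> carrier G"
    "\<And>g. g \<in> carrier G \<Longrightarrow> \<exists>t\<in>F. \<exists>n\<in>P. g = t \<otimes> n"
    using co_normal_transversal[OF P] by blast
  have Pconj: "inv g \<otimes> p \<otimes> g \<in> P" if "g \<in> carrier G" "p \<in> P" for g p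
    using that by (rule P.inv_op_closed1)
  \<comment> \<open>The conjugate of \<open>Q\<close> by \<open>t\<close>, written as a preimage
    under a map of \<open>P\<close> to itself; \<open>t\<close> need not lie in
    \<open>P\<close>.\<close>
  have vim: "{p \<in> P. inv t \<otimes> p \<otimes> t \<in> Q} \<in> co_normal_subgroups \<C> (G\<lparr>carrier := P\<rparr>)"
    if t: "t \<in> carrier G" for t
  proof -
    have "(\<lambda>p. inv t \<otimes> p \<otimes> t) \<in> hom (G\<lparr>carrier := P\<rparr>) (G\<lparr>carrier := P\<rparr>)"
      using t Pconj by (auto simp: hom_def group_simps PG)
    from co_normal_vimage[OF Q'(6) this Q] show ?thesis by simp
  qed
  have "\<exists>R0\<in>co_normal_subgroups \<C> (G\<lparr>carrier := P\<rparr>). \<forall>t\<in>F. R0 \<subseteq> {p \<in> P. inv t \<otimes> p \<otimes> t \<in> Q}"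
    using F(1) Q'(6) vim F(2) by (intro co_normal_choice) blast+
  then obtain R0 where R0: "R0 \<in> co_normal_subgroups \<C> (G\<lparr>carrier := P\<rparr>)"
    "\<And>t. t \<in> F \<Longrightarrow> R0 \<subseteq> {p \<in> P. inv t \<otimes> p \<otimes> t \<in> Q}" by blast
  \<comment> \<open>Intersecting over all \<open>g\<close> makes normality in \<open>G\<close>
    immediate, while the finite intersection \<open>R0\<close> below it shows that the core is still
    open in \<open>P\<close>.\<close>
  define R where "R = {p \<in> P. \<forall>g\<in>carrier G. inv g \<otimes> p \<otimes> g \<in> Q}"
  have R0R: "R0 \<subseteq> R"
  proof
    fix p assume p: "p \<in> R0"
    have pP: "p \<in> P" using co_normalD(4)[OF R0(1)] p by auto
    have "inv g \<otimes> p \<otimes> g \<in> Q" if g: "g \<in> carrier G" for g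
    proof -
      obtain t n where tn: "t \<in> F" "n \<in> P" "g = t \<otimes> n" using F(3)[OF g] by blast
      have q: "inv t \<otimes> p \<otimes> t \<in> Q" using R0(2) tn(1) p by blast
      have "inv n \<otimes> (inv t \<otimes> p \<otimes> t) \<otimes> n \<in> Q"
        using Q.inv_op_closed1[of n, OF _ q] tn(2) by (simp add: invP)
      moreover have "inv n \<otimes> (inv t \<otimes> p \<otimes> t) \<otimes> n = inv g \<otimes> p \<otimes> g"
        using tn pP PG F(2) by (simp add: group_simps subset_iff)
      ultimately show ?thesis by simp
    qed
    then show "p \<in> R" using pP by (simp add: R_def)
  qed
  have RQ: "R \<subseteq> Q"
  proof
    fix p assume p: "p \<in> R"
    then have "inv \<one> \<otimes> p \<otimes> \<one> \<in> Q" unfolding R_def by blast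
    then show "p \<in> Q" using p PG by (simp add: R_def)
  qed
  have Rsub: "subgroup R G"
  proof (rule subgroupI)
    show "R \<subseteq> carrier G" using PG by (auto simp: R_def)
    show "R \<noteq> {}" using R0R co_normalD(5)[OF R0(1)] by auto
    show "inv a \<in> R" if "a \<in> R" for a
    proof -
      have "inv g \<otimes> inv a \<otimes> g \<in> Q" if "g \<in> carrier G" for g
      proof -
        have q: "inv g \<otimes> a \<otimes> g \<in> Q" using that \<open>a \<in> R\<close> by (simp add: R_def)
        then have "inv (inv g \<otimes> a \<otimes> g) \<in> Q"
          using Q.m_inv_closed[OF q] invP[OF subsetD[OF QP q]] by simp
        then show ?thesis using that \<open>a \<in> R\<close> PG by (simp add: R_def group_simps)
      qed
      then show ?thesis using that by (simp add: R_def)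
    qed
    show "a \<otimes> b \<in> R" if "a \<in> R" "b \<in> R" for a b
    proof -
      have "inv g \<otimes> (a \<otimes> b) \<otimes> g \<in> Q" if g: "g \<in> carrier G" for g
      proof -
        have "(inv g \<otimes> a \<otimes> g) \<otimes> (inv g \<otimes> b \<otimes> g) \<in> Q"
        proof -
          have "inv g \<otimes> a \<otimes> g \<in> Q" "inv g \<otimes> b \<otimes> g \<in> Q"
            using g \<open>a \<in> R\<close> \<open>b \<in> R\<close> by (simp_all add: R_def)
          from subgroup.m_closed[OF Q.is_subgroup this] show ?thesis by simp
        qed
        then show ?thesis using g \<open>a \<in> R\<close> \<open>b \<in> R\<close> PG by (simp add: R_def group_simps)
      qed
      then show ?thesis using that by (simp add: R_def)
    qed
  qed
  have Rnorm: "R \<lhd> G"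
  proof (rule normal_invI[OF Rsub])
    fix x r assume x: "x \<in> carrier G" and r: "r \<in> R"
    have "x \<otimes> r \<otimes> inv x \<in> P" using x r P.inv_op_closed2 by (simp add: R_def)
    moreover have "inv g \<otimes> (x \<otimes> r \<otimes> inv x) \<otimes> g \<in> Q" if g: "g \<in> carrier G" for g
    proof -
      have "inv (inv x \<otimes> g) \<otimes> r \<otimes> (inv x \<otimes> g) \<in> Q" using r g x by (simp add: R_def)
      then show ?thesis using x g r PG by (simp add: R_def group_simps)
    qed
    ultimately show "x \<otimes> r \<otimes> inv x \<in> R" by (simp add: R_def)
  qed
  have RP: "R \<subseteq> P" by (auto simp: R_def)
  have "R \<lhd> G\<lparr>carrier := P\<rparr>"
    using normal_restrict_supergroup[OF P'(3) Rnorm RP] .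
  then have RcoP: "R \<in> co_normal_subgroups \<C> (G\<lparr>carrier := P\<rparr>)"
    using co_normal_superset[OF R0(1)] R0R by blast
  interpret R: normal R G by fact
  have "P #> x = P #> y" if "x \<in> carrier G" "y \<in> carrier G" "R #> x = R #> y" for x y
  proof -
    have "x \<in> R #> y" using that rcos_self[OF that(1) Rsub] by simp
    then have "x \<in> P #> y" using RP by (auto simp: r_coset_def)
    then show ?thesis using that P'(3) repr_independence by metis
  qed
  then obtain h where h: "h \<in> hom (G Mod R) (G Mod P)" "\<And>x. x \<in> carrier G \<Longrightarrow> h (R #> x) = P #> x"
    using FactGroup_universal[OF P.r_coset_hom_Mod Rnorm] by metis
  \<comment> \<open>The kernel of \<open>G Mod R\<close> onto \<open>G Mod P\<close> is the quotient
    of \<open>P\<close> by \<open>R\<close>, which exhibits \<open>G Mod R\<close> as an extension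
    of two groups in the class.\<close>
  have ker: "kernel (G Mod R) (G Mod P) h = carrier (G\<lparr>carrier := P\<rparr> Mod R)"
  proof -
    have res: "R #>\<^bsub>G\<lparr>carrier := P\<rparr>\<^esub> x = R #> x" for x by (simp add: r_coset_def)
    have "h (R #> x) = P \<longleftrightarrow> x \<in> P" if "x \<in> carrier G" for x
      using h(2)[OF that] r_coset_eq_iff_mem[OF P'(1) that] by simp
    note hP = this
    have "kernel (G Mod R) (G Mod P) h = (\<lambda>x. R #> x) ` P"
    proof
      show "kernel (G Mod R) (G Mod P) h \<subseteq> (\<lambda>x. R #> x) ` P"
        using hP unfolding kernel_def carrier_FactGroup one_FactGroup by blast
      show "(\<lambda>x. R #> x) ` P \<subseteq> kernel (G Mod R) (G Mod P) h"
        using hP PG unfolding kernel_def carrier_FactGroup one_FactGroup by blast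
    qed
    then show ?thesis by (simp add: carrier_FactGroup res)
  qed
  have "(G Mod R)\<lparr>carrier := kernel (G Mod R) (G Mod P) h\<rparr> = G\<lparr>carrier := P\<rparr> Mod R"
    unfolding ker by (simp add: FactGroup_def fun_eq_iff set_mult_def)
  then have "in_class \<C> (G Mod R)"
    using in_class_extension[OF R.factorgroup_is_group P'(2) h(1)] co_normalD(2)[OF RcoP] by simp
  then show ?thesis
    using Rnorm RQ by (auto simp: co_normal_subgroups_def)
qed

text \<open>Turns heredity into a statement in which all elements and the topology are those of
  \<open>G\<close>. Since \<open>g\<close> need not lie in \<open>N\<close>, heredity is applied to
  the open subgroup \<open>H\<close>, whose additional elements are powers of \<open>g\<close> times
  elements of \<open>N\<close> and do not enlarge the class.\<close>

lemma adherent_class_under: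
  fixes G (structure)
  assumes G: "group G" and hcs: "hereditarily_conjugacy_separable \<C> G"
    and N: "N \<in> co_normal_subgroups \<C> G" and g: "g \<in> carrier G" and x: "x \<in> carrier G"
    and adh: "adherent G (class_under G N g) x"
  shows "x \<in> class_under G N g"
proof -
  note N' = co_normalD[OF N]
  interpret group G by fact
  interpret N: normal N G by fact
  have NG: "n \<in> carrier G" if "n \<in> N" for n using that N'(4) by blast
  define H where "H = N <#> generate G {g}"
  have gen: "subgroup (generate G {g}) G" using g by (simp add: generate_is_subgroup)
  have H: "subgroup H G"
    unfolding H_def by (rule mult_norm_subgroup[OF N'(1) gen])
  have HE: "\<exists>n\<in>N. \<exists>i::int. h = n \<otimes> g [^] i" if "h \<in> H" for h
    using that generate_pow[OF g] by (auto simp: H_def set_mult_def)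
  have NH: "N \<subseteq> H"
  proof
    fix n assume n: "n \<in> N"
    have "n \<otimes> \<one> \<in> H"
      unfolding H_def set_mult_def using n subgroup.one_closed[OF gen] by blast
    then show "n \<in> H" using NG[OF n] by simp
  qed
  have gH: "g \<in> H"
  proof -
    have "\<one> \<otimes> g \<in> H"
      unfolding H_def set_mult_def using generate.incl[of g "{g}" G] N'(5) by blast
    then show ?thesis using g by simp
  qed
  have HG: "h \<in> carrier G" if "h \<in> H" for h using that subgroup.subset[OF H] by blast
  have "openin (pro_topology \<C> G) H"
    unfolding openin_pro_topology_iff[OF G]
  proof (intro conjI ballI bexI[OF _ N])
    show "H \<subseteq> carrier G" using HG by blast
    show "x <# N \<subseteq> H" if "x \<in> H" for x
      using that NH subgroup.m_closed[OF H] by (auto simp: l_coset_def)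
  qed
  then have cs: "conjugacy_separable \<C> (G\<lparr>carrier := H\<rparr>)"
    using hcs H by (simp add: hereditarily_conjugacy_separable_def)
  have gGH: "group (G\<lparr>carrier := H\<rparr>)" by (rule subgroup_imp_group[OF H])
  have eq: "class_under G H g = class_under G N g"
  proof
    show "class_under G N g \<subseteq> class_under G H g" using NH by (auto simp: class_under_def)
    show "class_under G H g \<subseteq> class_under G N g"
    proof
      fix y assume "y \<in> class_under G H g"
      then obtain h where h: "h \<in> H" "y = h \<otimes> g \<otimes> inv h" by (auto simp: class_under_def)
      then obtain n and i :: int where n: "n \<in> N" "h = n \<otimes> g [^] i" using HE by blast
      have "g [^] i \<otimes> g = g \<otimes> g [^] i"
        using g int_pow_mult[of g i 1] int_pow_mult[of g 1 i] by (simp add: add.commute)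
      then have "g [^] i \<otimes> (g \<otimes> z) = g \<otimes> (g [^] i \<otimes> z)" if "z \<in> carrier G" for z
        using that g by (simp add: m_assoc[symmetric])
      then have "y = n \<otimes> g \<otimes> inv n"
        using h(2) n NG g by (simp add: group_simps)
      then show "y \<in> class_under G N g" using n by (auto simp: class_under_def)
    qed
  qed
  have "class_under G H g \<subseteq> H"
    using gH subgroup.m_closed[OF H] subgroup.m_inv_closed[OF H] by (auto simp: class_under_def)
  moreover obtain n where n: "n \<in> N" "x \<otimes> n \<in> class_under G N g"
    using adh N by (auto simp: adherent_def)
  ultimately have "x \<otimes> n \<in> H" using eq by blast
  moreover have "x = (x \<otimes> n) \<otimes> inv n" using x n NG by (simp add: group_simps)
  ultimately have xH: "x \<in> H"
    using n NH subgroup.m_closed[OF H] subgroup.m_inv_closed[OF H] by (metis subsetD)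
  \<comment> \<open>An open normal \<open>K\<close> of \<open>H\<close> meets \<open>N\<close> in an
    open normal subgroup of \<open>N\<close>, and that contains one of \<open>G\<close> by
    transitivity.\<close>
  have "adherent (G\<lparr>carrier := H\<rparr>) (class_under G N g) x"
    unfolding adherent_def
  proof
    fix K assume K: "K \<in> co_normal_subgroups \<C> (G\<lparr>carrier := H\<rparr>)"
    have "subgroup N (G\<lparr>carrier := H\<rparr>)"
      using N'(3) H NH subgroup_incl by blast
    from co_normal_restrict[OF K this]
    have "K \<inter> N \<in> co_normal_subgroups \<C> (G\<lparr>carrier := N\<rparr>)" by simp
    from co_normal_trans[OF N this] obtain R where "R \<in> co_normal_subgroups \<C> G" "R \<subseteq> K" by blast
    then show "\<exists>n\<in>K. x \<otimes>\<^bsub>G\<lparr>carrier := H\<rparr>\<^esub> n \<in> class_under G N g"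
      using adh unfolding adherent_def by fastforce
  qed
  moreover have "separable_in \<C> (G\<lparr>carrier := H\<rparr>) (class_under G N g)"
    using cs gH conjugacy_class_restrict[OF G H, of g] eq by (auto simp: conjugacy_separable_def)
  ultimately show ?thesis
    using xH separable_in_iff_adherent[OF gGH] by auto
qed

text \<open>A class under an open subgroup is a finite union of conjugates of classes under \<open>M\<close>; hence
  \<open>M\<close> need not be a subgroup.\<close>

lemma hereditarily_conjugacy_separableI:
  fixes G (structure)
  assumes G: "group G"
    and small: "\<And>N g. N \<in> co_normal_subgroups \<C> G \<Longrightarrow> g \<in> carrier G \<Longrightarrow>
      \<exists>R\<in>co_normal_subgroups \<C> G. \<exists>M. R \<subseteq> M \<and> M \<subseteq> N \<and>
        (\<forall>x\<in>carrier G. adherent G (class_under G M g) x \<longrightarrow> x \<in> class_under G M g)"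
  shows "hereditarily_conjugacy_separable \<C> G"
proof -
  interpret group G by fact
  have main: "conjugacy_separable \<C> (G\<lparr>carrier := H\<rparr>)"
    if H: "subgroup H G" and N: "N \<in> co_normal_subgroups \<C> G" "N \<subseteq> H" for H N
    unfolding conjugacy_separable_def
  proof
    fix g assume "g \<in> carrier (G\<lparr>carrier := H\<rparr>)"
    then have g: "g \<in> H" by simp
    have HG: "h \<in> carrier G" if "h \<in> H" for h using that subgroup.subset[OF H] by blast
    have cl: "class_under G H g \<subseteq> H"
      using g subgroup.m_closed[OF H] subgroup.m_inv_closed[OF H] by (auto simp: class_under_def)
    obtain R M where RM: "R \<in> co_normal_subgroups \<C> G" "R \<subseteq> M" "M \<subseteq> N"
      "\<And>x. x \<in> carrier G \<Longrightarrow> adherent G (class_under G M g) x \<Longrightarrow> x \<in> class_under G M g"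
      using small[OF N(1) HG[OF g]] by blast
    have MH: "M \<subseteq> H" using RM N by blast
    obtain F where F: "finite F" "F \<subseteq> carrier G"
      "\<And>g. g \<in> carrier G \<Longrightarrow> \<exists>t\<in>F. \<exists>n\<in>R. g = t \<otimes> n"
      using co_normal_transversal[OF RM(1)] by blast
    have "x \<in> class_under G H g"
      if x: "x \<in> H" and adh: "adherent (G\<lparr>carrier := H\<rparr>) (class_under G H g) x" for x
    proof (rule ccontr)
      assume nx: "x \<notin> class_under G H g"
      \<comment> \<open>Only representatives in \<open>H\<close> can be treated: \<open>x\<close>
        lies outside the class under \<open>H\<close>, but possibly inside the class under
        \<open>G\<close>.\<close>
      have "\<exists>L\<in>co_normal_subgroups \<C> G. \<forall>l\<in>L. inv t \<otimes> x \<otimes> t \<otimes> l \<notin> class_under G M g"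
        if t: "t \<in> F \<inter> H" for t
      proof -
        have "inv t \<otimes> x \<otimes> t \<notin> class_under G M g"
        proof
          assume "inv t \<otimes> x \<otimes> t \<in> class_under G M g"
          then obtain m where m: "m \<in> M" "inv t \<otimes> x \<otimes> t = m \<otimes> g \<otimes> inv m"
            by (auto simp: class_under_def)
          have c: "t \<in> carrier G" "x \<in> carrier G" "m \<in> carrier G" "g \<in> carrier G"
            using t x m MH g HG by auto
          have "x = t \<otimes> (inv t \<otimes> x \<otimes> t) \<otimes> inv t" using c by (simp add: group_simps)
          also have "\<dots> = (t \<otimes> m) \<otimes> g \<otimes> inv (t \<otimes> m)"
            unfolding m(2) using c by (simp add: group_simps)
          finally show False
            using nx t m MH subgroup.m_closed[OF H] unfolding class_under_def by blast
        qed
        then show ?thesis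
          using RM(4)[of "inv t \<otimes> x \<otimes> t"] t x HG by (auto simp: adherent_def)
      qed
      then have "\<exists>L\<in>co_normal_subgroups \<C> G. \<forall>t\<in>F \<inter> H. \<forall>l\<in>L. inv t \<otimes> x \<otimes> t \<otimes> l \<notin> class_under G M g"
        using F(1) G by (intro co_normal_choice) blast+
      then obtain L where L: "L \<in> co_normal_subgroups \<C> G"
        "\<And>t l. t \<in> F \<inter> H \<Longrightarrow> l \<in> L \<Longrightarrow> inv t \<otimes> x \<otimes> t \<otimes> l \<notin> class_under G M g" by blast
      note L' = co_normalD[OF L(1)]
      obtain l h where l: "l \<in> L" "h \<in> H" "x \<otimes> l = h \<otimes> g \<otimes> inv h"
        using adh co_normal_restrict[OF L(1) H] by (force simp: adherent_def class_under_def)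
      obtain t r where t: "t \<in> F" "r \<in> R" "h = t \<otimes> r" using F(3)[OF HG[OF l(2)]] by blast
      have c: "t \<in> carrier G" "x \<in> carrier G" "r \<in> carrier G" "l \<in> carrier G" "g \<in> carrier G"
        using t F(2) x HG RM(2) MH l L'(4) g by blast+
      have "t = h \<otimes> inv r" using c t by (simp add: group_simps)
      then have tH: "t \<in> H"
        using t l RM(2) MH subgroup.m_closed[OF H] subgroup.m_inv_closed[OF H] by blast
      \<comment> \<open>Conjugation by \<open>inv t\<close> turns the conjugator
        \<open>h = t r\<close> into \<open>r\<close>, while the error \<open>l\<close> stays in the
        normal subgroup \<open>L\<close>.\<close>
      have "inv t \<otimes> x \<otimes> t \<otimes> (inv t \<otimes> l \<otimes> t) = inv t \<otimes> (x \<otimes> l) \<otimes> t"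
        using c by (simp add: group_simps)
      also have "\<dots> = r \<otimes> g \<otimes> inv r"
        unfolding l(3) t(3) using c by (simp add: group_simps)
      finally have "inv t \<otimes> x \<otimes> t \<otimes> (inv t \<otimes> l \<otimes> t) \<in> class_under G M g"
        using t(2) RM(2) by (auto simp: class_under_def)
      moreover have "inv t \<otimes> l \<otimes> t \<in> L"
        using normal.inv_op_closed1[OF L'(1) c(1) l(1)] .
      ultimately show False using L(2) t(1) tH by blast
    qed
    then show "separable_in \<C> (G\<lparr>carrier := H\<rparr>) (conjugacy_class (G\<lparr>carrier := H\<rparr>) g)"
      unfolding conjugacy_class_restrict[OF G H] separable_in_iff_adherent[OF subgroup_imp_group[OF H]]
      using cl by auto
  qed
  have "conjugacy_separable \<C> G"
    using main[OF subgroup_self co_normal_carrier[OF G]] by simp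
  moreover have "conjugacy_separable \<C> (G\<lparr>carrier := H\<rparr>)"
    if H: "subgroup H G" and op: "openin (pro_topology \<C> G) H" for H
  proof -
    obtain N where N: "N \<in> co_normal_subgroups \<C> G" "\<one> <# N \<subseteq> H"
      using op subgroup.one_closed[OF H] by (auto simp: openin_pro_topology_iff[OF G])
    then have "N \<subseteq> H" using co_normalD(4)[OF N(1)] by (force simp: l_coset_def)
    then show ?thesis using main[OF H N(1)] by blast
  qed
  ultimately show ?thesis by (simp add: hereditarily_conjugacy_separable_def)
qed

text \<open>Minasyan's centralizer condition.\<close>

lemma centralizer_condition:
  fixes G (structure)
  assumes G: "group G" and hcs: "hereditarily_conjugacy_separable \<C> G"
    and N: "N \<in> co_normal_subgroups \<C> G" and b: "b \<in> carrier G"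
  shows "\<exists>L\<in>co_normal_subgroups \<C> G. \<forall>k\<in>carrier G. \<forall>l\<in>L. k \<otimes> b \<otimes> inv k = b \<otimes> l \<longrightarrow>
      (\<exists>c\<in>carrier G. c \<otimes> b = b \<otimes> c \<and> (\<exists>n\<in>N. k = c \<otimes> n))"
proof -
  interpret group G by fact
  note N' = co_normalD[OF N]
  obtain F where F: "finite F" "F \<subseteq> carrier G"
    "\<And>g. g \<in> carrier G \<Longrightarrow> \<exists>t\<in>F. \<exists>n\<in>N. g = t \<otimes> n"
    using co_normal_transversal[OF N] by blast
  \<comment> \<open>Either the conjugate of \<open>b\<close> by \<open>inv t\<close> is exactly in
    the class, or some \<open>L\<close> keeps it away. The disjunction is antitone in
    \<open>L\<close>, so all representatives \<open>t\<close> can share one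
    \<open>L\<close>.\<close>
  have "\<exists>L\<in>co_normal_subgroups \<C> G. inv t \<otimes> b \<otimes> t \<in> class_under G N b \<or>
      (\<forall>l\<in>L. inv t \<otimes> b \<otimes> t \<otimes> l \<notin> class_under G N b)" if "t \<in> F" for t
  proof -
    have "inv t \<otimes> b \<otimes> t \<in> carrier G" using that F(2) b by auto
    then show ?thesis
      using adherent_class_under[OF G hcs N b] N unfolding adherent_def by blast
  qed
  then have "\<exists>L\<in>co_normal_subgroups \<C> G. \<forall>t\<in>F. inv t \<otimes> b \<otimes> t \<in> class_under G N b \<or>
      (\<forall>l\<in>L. inv t \<otimes> b \<otimes> t \<otimes> l \<notin> class_under G N b)"
    using F(1) G by (intro co_normal_choice) blast+
  then obtain L where L: "L \<in> co_normal_subgroups \<C> G"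
    "\<And>t l. t \<in> F \<Longrightarrow> l \<in> L \<Longrightarrow> inv t \<otimes> b \<otimes> t \<otimes> l \<in> class_under G N b \<Longrightarrow>
      inv t \<otimes> b \<otimes> t \<in> class_under G N b" by blast
  note L' = co_normalD[OF L(1)]
  show ?thesis
  proof (intro bexI[OF _ L(1)] ballI impI)
    fix k l assume k: "k \<in> carrier G" "l \<in> L" "k \<otimes> b \<otimes> inv k = b \<otimes> l"
    obtain t n where t: "t \<in> F" "n \<in> N" "k = t \<otimes> n" using F(3)[OF k(1)] by blast
    have c: "t \<in> carrier G" "n \<in> carrier G" "l \<in> carrier G"
      using t F(2) N'(4) L'(4) k by auto
    have "inv t \<otimes> b \<otimes> t \<otimes> (inv t \<otimes> l \<otimes> t) = inv t \<otimes> (b \<otimes> l) \<otimes> t"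
      using c b by (simp add: group_simps)
    also have "\<dots> = n \<otimes> b \<otimes> inv n"
      unfolding k(3)[symmetric] t(3) using c b by (simp add: group_simps)
    finally have "inv t \<otimes> b \<otimes> t \<otimes> (inv t \<otimes> l \<otimes> t) \<in> class_under G N b"
      using t by (auto simp: class_under_def)
    then have "inv t \<otimes> b \<otimes> t \<in> class_under G N b"
      using L(2)[OF t(1)] normal.inv_op_closed1[OF L'(1) c(1) k(2)] by blast
    then obtain m where m: "m \<in> N" "inv t \<otimes> b \<otimes> t = m \<otimes> b \<otimes> inv m"
      by (auto simp: class_under_def)
    have mc: "m \<in> carrier G" using m N'(4) by auto
    \<comment> \<open>The exact relation for \<open>t\<close> makes \<open>t m\<close> a true
      centralizer of \<open>b\<close>, and \<open>k = t n\<close> differs from it by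
      \<open>inv m n\<close> in \<open>N\<close>.\<close>
    have "b \<otimes> (t \<otimes> m) = t \<otimes> (inv t \<otimes> b \<otimes> t) \<otimes> m" using c b mc by (simp add: group_simps)
    also have "\<dots> = (t \<otimes> m) \<otimes> b" unfolding m(2) using c b mc by (simp add: group_simps)
    finally have "(t \<otimes> m) \<otimes> b = b \<otimes> (t \<otimes> m)" by simp
    moreover have "k = (t \<otimes> m) \<otimes> (inv m \<otimes> n)" using t c mc by (simp add: group_simps)
    moreover have "inv m \<otimes> n \<in> N"
      using m t N'(3) by (simp add: subgroup.m_closed subgroup.m_inv_closed)
    ultimately show "\<exists>c\<in>carrier G. c \<otimes> b = b \<otimes> c \<and> (\<exists>n\<in>N. k = c \<otimes> n)"
      using c mc by blast
  qed
qed

end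

lemma r_coset_eq_iff:
  assumes N: "N \<lhd> G" and x: "x \<in> carrier G" and y: "y \<in> carrier G"
  shows "N #>\<^bsub>G\<^esub> x = N #>\<^bsub>G\<^esub> y \<longleftrightarrow> inv\<^bsub>G\<^esub> x \<otimes>\<^bsub>G\<^esub> y \<in> N"
proof -
  interpret normal N G by fact
  show ?thesis
  proof
    assume "N #>\<^bsub>G\<^esub> x = N #>\<^bsub>G\<^esub> y"
    then have "y \<in> x <#\<^bsub>G\<^esub> N" using rcos_self[OF y is_subgroup] coset_eq x by metis
    then obtain n where "n \<in> N" "y = x \<otimes>\<^bsub>G\<^esub> n" by (auto simp: l_coset_def)
    then show "inv\<^bsub>G\<^esub> x \<otimes>\<^bsub>G\<^esub> y \<in> N" using x by (simp add: inv_mult_cancel_left)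
  next
    assume "inv\<^bsub>G\<^esub> x \<otimes>\<^bsub>G\<^esub> y \<in> N"
    then have "x \<otimes>\<^bsub>G\<^esub> (inv\<^bsub>G\<^esub> x \<otimes>\<^bsub>G\<^esub> y) \<in> x <#\<^bsub>G\<^esub> N" by (auto simp: l_coset_def)
    then have "y \<in> N #>\<^bsub>G\<^esub> x" using x y coset_eq by (simp add: mult_inv_cancel_left)
    then show "N #>\<^bsub>G\<^esub> x = N #>\<^bsub>G\<^esub> y" using repr_independence[OF _ x is_subgroup] by blast
  qed
qed

section \<open>Powers modulo open normal subgroups, and avoidance of elements\<close>

context pseudovariety
begin

lemma pow_order_quotient_mem:
  assumes N: "N \<in> co_normal_subgroups \<C> G" and x: "x \<in> carrier G" and j: "order (G Mod N) dvd j"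
  shows "x [^]\<^bsub>G\<^esub> (j::nat) \<in> N"
proof -
  note N' = co_normalD[OF N]
  interpret N: normal N G by fact
  interpret Q: group "G Mod N" by (rule N.factorgroup_is_group)
  have "N #>\<^bsub>G\<^esub> x \<in> carrier (G Mod N)" using x by (auto simp: carrier_FactGroup)
  from Q.pow_order_eq_1[OF this]
  have "(N #>\<^bsub>G\<^esub> x) [^]\<^bsub>G Mod N\<^esub> j = N"
    using j \<open>N #>\<^bsub>G\<^esub> x \<in> carrier (G Mod N)\<close>
    by (metis Q.nat_pow_one Q.nat_pow_pow dvdE one_FactGroup)
  then have "N #>\<^bsub>G\<^esub> (x [^]\<^bsub>G\<^esub> j) = N" using N.FactGroup_pow[OF x] by simp
  then show ?thesis
    using r_coset_eq_iff_mem[OF N'(1)] x by simp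
qed

lemma order_quotient_pos: "N \<in> co_normal_subgroups \<C> G \<Longrightarrow> order (G Mod N) > 0"
  using in_class_finite[OF co_normalD(2)] monoid.order_gt_0_iff_finite group.is_monoid
    in_class_group[OF co_normalD(2)] by blast

text \<open>Exponents matter only modulo the order of the quotient, since that power of
  \<open>b\<close> lies in \<open>N\<close>. Natural exponents are wanted because norms below are
  products of a natural number of translates.\<close>

lemma int_pow_eq_nat_pow_mult:
  fixes i :: int
  assumes N: "N \<in> co_normal_subgroups \<C> G" and b: "b \<in> carrier G"
  shows "\<exists>j::nat. \<exists>n\<in>N. b [^]\<^bsub>G\<^esub> i = b [^]\<^bsub>G\<^esub> j \<otimes>\<^bsub>G\<^esub> n"
proof -
  interpret group G by (rule co_normalD(6)[OF N])
  define q where "q = order (G Mod N)"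
  have q: "q > 0" using order_quotient_pos[OF N] by (simp add: q_def)
  have bq: "b [^]\<^bsub>G\<^esub> q \<in> N" using pow_order_quotient_mem[OF N b] by (simp add: q_def)
  have "i = int (nat (i mod int q)) + int q * (i div int q)" using q by simp
  then have "b [^]\<^bsub>G\<^esub> i = b [^]\<^bsub>G\<^esub> int (nat (i mod int q)) \<otimes>\<^bsub>G\<^esub> (b [^]\<^bsub>G\<^esub> int q) [^]\<^bsub>G\<^esub> (i div int q)"
    using b by (metis int_pow_mult int_pow_pow)
  then have "b [^]\<^bsub>G\<^esub> i = b [^]\<^bsub>G\<^esub> nat (i mod int q) \<otimes>\<^bsub>G\<^esub> (b [^]\<^bsub>G\<^esub> q) [^]\<^bsub>G\<^esub> (i div int q)"
    by (simp only: int_pow_int)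
  moreover have "(b [^]\<^bsub>G\<^esub> q) [^]\<^bsub>G\<^esub> (i div int q) \<in> N"
    using bq co_normalD(3)[OF N] subgroup_int_pow_closed by blast
  ultimately show ?thesis by blast
qed

lemma separable_avoid:
  assumes "group G" "separable_in \<C> G S" "x \<in> carrier G" "x \<notin> S"
  obtains N where "N \<in> co_normal_subgroups \<C> G" "\<And>n. n \<in> N \<Longrightarrow> x \<otimes>\<^bsub>G\<^esub> n \<notin> S"
  using assms unfolding separable_in_iff[OF assms(1)] by blast

lemma residually_avoid:
  assumes "residually \<C> G" "group G" "x \<in> carrier G" "x \<noteq> \<one>\<^bsub>G\<^esub>"
  obtains N where "N \<in> co_normal_subgroups \<C> G" "x \<notin> N"
proof -
  interpret group G by fact
  obtain N where N: "N \<in> co_normal_subgroups \<C> G" "\<And>n. n \<in> N \<Longrightarrow> x \<otimes>\<^bsub>G\<^esub> n \<noteq> \<one>\<^bsub>G\<^esub>"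
    using separable_avoid[of G "{\<one>\<^bsub>G\<^esub>}" x] assms by (auto simp: residually_def)
  have "x \<notin> N"
    using N(2)[of "inv\<^bsub>G\<^esub> x"] subgroup.m_inv_closed[OF co_normalD(3)[OF N(1)]] assms(3) by auto
  then show thesis using N(1) that by blast
qed

lemma residually_of_conjugacy_separable:
  assumes "group G" "conjugacy_separable \<C> G"
  shows "residually \<C> G"
proof -
  interpret group G by fact
  have "conjugacy_class G \<one>\<^bsub>G\<^esub> = {\<one>\<^bsub>G\<^esub>}"
    by (auto simp: conjugacy_class_def intro: exI[of _ "\<one>\<^bsub>G\<^esub>"])
  then show ?thesis using assms(2) by (metis conjugacy_separable_def one_closed residually_def)
qed

end

section \<open>Wreath products\<close>

declare mult_sum_group [simp del] one_sum_group [simp del] inv_sum_group [simp del]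

text \<open>In the following locales the group operations without subscript are those of \<open>B\<close>.\<close>

locale wreath = A: group A + B: group B
  for A :: "('a, 'm) monoid_scheme" and B :: "('b, 'n) monoid_scheme" (structure)
begin

abbreviation V :: "('b \<Rightarrow> 'a) monoid"
  where "V \<equiv> sum_group (carrier B) (\<lambda>_. A)"

abbreviation W :: "(('b \<Rightarrow> 'a) \<times> 'b) monoid"
  where "W \<equiv> wreath_product A B"

abbreviation tr :: "'b \<Rightarrow> ('b \<Rightarrow> 'a) \<Rightarrow> 'b \<Rightarrow> 'a"
  where "tr \<equiv> left_translation B"

definition supp :: "('b \<Rightarrow> 'a) \<Rightarrow> 'b set"
  where "supp v = {z \<in> carrier B. v z \<noteq> \<one>\<^bsub>A\<^esub>}"

definition delta :: "'b \<Rightarrow> 'a \<Rightarrow> 'b \<Rightarrow> 'a"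
  where "delta z a = (\<lambda>x\<in>carrier B. if x = z then a else \<one>\<^bsub>A\<^esub>)"

sublocale V: group V
  by (simp add: A.group_axioms)

sublocale W: group W
  by (rule group_wreath_product[OF A.group_axioms B.group_axioms])

lemma carrier_V: "carrier V = {v \<in> carrier B \<rightarrow>\<^sub>E carrier A. finite (supp v)}"
  by (simp add: carrier_sum_group A.group_axioms supp_def)

lemma V_value [simp]: "v \<in> carrier V \<Longrightarrow> z \<in> carrier B \<Longrightarrow> v z \<in> carrier A"
  by (auto simp: carrier_V)

lemma finite_supp: "v \<in> carrier V \<Longrightarrow> finite (supp v)"
  by (simp add: carrier_V)

lemma V_eqI:
  assumes "u \<in> carrier V" "v \<in> carrier V" "\<And>z. z \<in> carrier B \<Longrightarrow> u z = v z"
  shows "u = v"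
  using assms by (auto simp: carrier_V intro: PiE_ext)

lemma V_mult [simp]: "z \<in> carrier B \<Longrightarrow> (u \<otimes>\<^bsub>V\<^esub> v) z = u z \<otimes>\<^bsub>A\<^esub> v z"
  by (simp add: mult_sum_group)

lemma V_one [simp]: "z \<in> carrier B \<Longrightarrow> \<one>\<^bsub>V\<^esub> z = \<one>\<^bsub>A\<^esub>"
  by (simp add: one_sum_group)

lemma V_inv [simp]: "v \<in> carrier V \<Longrightarrow> z \<in> carrier B \<Longrightarrow> (inv\<^bsub>V\<^esub> v) z = inv\<^bsub>A\<^esub> (v z)"
  by (simp add: inv_sum_group A.group_axioms)

lemma V_eq_one: "v \<in> carrier V \<Longrightarrow> supp v = {} \<Longrightarrow> v = \<one>\<^bsub>V\<^esub>"
  by (rule V_eqI) (auto simp: supp_def)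

lemma tr_apply [simp]: "z \<in> carrier B \<Longrightarrow> tr b v z = v (inv b \<otimes> z)"
  by (simp add: left_translation_def)

lemma supp_tr:
  assumes "b \<in> carrier B"
  shows "supp (tr b v) = (\<lambda>z. b \<otimes> z) ` supp v"
proof
  show "supp (tr b v) \<subseteq> (\<lambda>z. b \<otimes> z) ` supp v"
  proof
    fix z assume "z \<in> supp (tr b v)"
    then show "z \<in> (\<lambda>z. b \<otimes> z) ` supp v"
      using assms by (intro image_eqI[of _ _ "inv b \<otimes> z"]) (auto simp: supp_def B.group_simps)
  qed
  show "(\<lambda>z. b \<otimes> z) ` supp v \<subseteq> supp (tr b v)"
    using assms by (auto simp: supp_def B.group_simps)
qed

lemma tr_closed [simp]:
  assumes "b \<in> carrier B" "v \<in> carrier V"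
  shows "tr b v \<in> carrier V"
proof -
  have "finite (supp (tr b v))" using assms by (simp add: supp_tr finite_supp)
  then show ?thesis
    using assms unfolding carrier_V by (auto simp: PiE_iff left_translation_def)
qed

lemma tr_mult:
  "b \<in> carrier B \<Longrightarrow> u \<in> carrier V \<Longrightarrow> v \<in> carrier V \<Longrightarrow> tr b (u \<otimes>\<^bsub>V\<^esub> v) = tr b u \<otimes>\<^bsub>V\<^esub> tr b v"
  by (rule V_eqI) auto

lemma tr_V_one [simp]: "b \<in> carrier B \<Longrightarrow> tr b \<one>\<^bsub>V\<^esub> = \<one>\<^bsub>V\<^esub>"
  by (rule V_eqI) auto

lemma tr_inv: "b \<in> carrier B \<Longrightarrow> v \<in> carrier V \<Longrightarrow> tr b (inv\<^bsub>V\<^esub> v) = inv\<^bsub>V\<^esub> (tr b v)"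
  by (rule V_eqI) auto

lemma tr_one [simp]: "v \<in> carrier V \<Longrightarrow> tr \<one> v = v"
  by (rule V_eqI) auto

lemma tr_tr: "b \<in> carrier B \<Longrightarrow> c \<in> carrier B \<Longrightarrow> v \<in> carrier V \<Longrightarrow> tr b (tr c v) = tr (b \<otimes> c) v"
  by (rule V_eqI) (auto simp: B.group_simps)

lemma delta_apply [simp]: "x \<in> carrier B \<Longrightarrow> delta z a x = (if x = z then a else \<one>\<^bsub>A\<^esub>)"
  by (simp add: delta_def)

lemma supp_delta: "supp (delta z a) \<subseteq> {z}"
  by (auto simp: supp_def split: if_splits)

lemma delta_closed [simp]: "a \<in> carrier A \<Longrightarrow> delta z a \<in> carrier V"
  using finite_subset[OF supp_delta] unfolding carrier_V by (auto simp: delta_def)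

lemma delta_mult:
  "a \<in> carrier A \<Longrightarrow> a' \<in> carrier A \<Longrightarrow> delta z (a \<otimes>\<^bsub>A\<^esub> a') = delta z a \<otimes>\<^bsub>V\<^esub> delta z a'"
  by (rule V_eqI) auto

lemma delta_one [simp]: "delta z \<one>\<^bsub>A\<^esub> = \<one>\<^bsub>V\<^esub>"
  by (rule V_eqI) auto

lemma delta_inv: "a \<in> carrier A \<Longrightarrow> delta z (inv\<^bsub>A\<^esub> a) = inv\<^bsub>V\<^esub> (delta z a)"
  by (rule V_eqI) auto

lemma tr_delta:
  assumes "b \<in> carrier B" "z \<in> carrier B" "a \<in> carrier A"
  shows "tr b (delta z a) = delta (b \<otimes> z) a"
proof (rule V_eqI)
  fix x assume x: "x \<in> carrier B"
  then have "inv b \<otimes> x = z \<longleftrightarrow> x = b \<otimes> z"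
    using assms by (auto simp: B.group_simps)
  then show "tr b (delta z a) x = delta (b \<otimes> z) a x" using assms x by simp
qed (use assms in auto)

lemma carrier_W: "carrier W = carrier V \<times> carrier B"
  by (simp add: wreath_product_def semidirect_product_def)

lemma W_mult [simp]: "(u, b) \<otimes>\<^bsub>W\<^esub> (v, c) = (u \<otimes>\<^bsub>V\<^esub> tr b v, b \<otimes> c)"
  by (simp add: wreath_product_def semidirect_product_def)

lemma W_one: "\<one>\<^bsub>W\<^esub> = (\<one>\<^bsub>V\<^esub>, \<one>)"
  by (simp add: wreath_product_def semidirect_product_def)

lemma W_inv:
  "u \<in> carrier V \<Longrightarrow> b \<in> carrier B \<Longrightarrow>
    inv\<^bsub>W\<^esub> (u, b) = (inv\<^bsub>V\<^esub> (tr (inv b) u), inv b)"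
  by (rule W.inv_equality) (auto simp: carrier_W W_one)

lemma base_hom: "(\<lambda>v. (v, \<one>)) \<in> hom V W"
  by (auto simp: hom_def carrier_W)

lemma top_hom: "(\<lambda>b. (\<one>\<^bsub>V\<^esub>, b)) \<in> hom B W"
  by (auto simp: hom_def carrier_W)

lemma snd_hom: "snd \<in> hom W B"
  by (auto simp: hom_def carrier_W)

lemma delta_hom: "(\<lambda>a. (delta z a, \<one>)) \<in> hom A W"
  by (auto simp: hom_def carrier_W delta_mult)

lemma W_conj_base:
  "v \<in> carrier V \<Longrightarrow> b \<in> carrier B \<Longrightarrow>
    (\<one>\<^bsub>V\<^esub>, b) \<otimes>\<^bsub>W\<^esub> (v, \<one>) \<otimes>\<^bsub>W\<^esub> inv\<^bsub>W\<^esub> (\<one>\<^bsub>V\<^esub>, b) = (tr b v, \<one>)"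
  by (simp add: W_inv)

lemma W_conj:
  assumes "n \<in> carrier V" "f \<in> carrier V" "k \<in> carrier B" "b \<in> carrier B"
  shows "(n, k) \<otimes>\<^bsub>W\<^esub> (f, b) \<otimes>\<^bsub>W\<^esub> inv\<^bsub>W\<^esub> (n, k) =
    (n \<otimes>\<^bsub>V\<^esub> tr k f \<otimes>\<^bsub>V\<^esub> inv\<^bsub>V\<^esub> (tr (k \<otimes> b \<otimes> inv k) n), k \<otimes> b \<otimes> inv k)"
  using assms by (simp add: W_inv tr_inv tr_tr V.m_assoc B.m_assoc)

end

section \<open>Wreath products with top group in the class\<close>

context wreath
begin

definition pointwise :: "'a set \<Rightarrow> (('b \<Rightarrow> 'a) \<times> 'b) set" where
  "pointwise M = {v \<in> carrier V. \<forall>z\<in>carrier B. v z \<in> M} \<times> {\<one>}"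

text \<open>Conjugation by \<open>B\<close> permutes the coordinates, so \<open>N\<close> contains a
  copy of \<open>M\<close> at each of them, and a finitely supported function is a product of its
  values. The induction runs over a finite superset \<open>S\<close> of the support.\<close>

lemma pointwise_subset:
  assumes N: "N \<lhd> W" and M: "\<And>a. a \<in> M \<Longrightarrow> a \<in> carrier A \<and> (delta \<one> a, \<one>) \<in> N"
  shows "pointwise M \<subseteq> N"
proof -
  interpret N: normal N W by fact
  have single: "(delta z a, \<one>) \<in> N" if "a \<in> M" "z \<in> carrier B" for z a
    using N.inv_op_closed2[of "(\<one>\<^bsub>V\<^esub>, z)" "(delta \<one> a, \<one>)"] M[OF that(1)] that(2)
      W_conj_base[of "delta \<one> a" z] tr_delta[of z "\<one>" a] by (simp add: carrier_W)
  have "(v, \<one>) \<in> N"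
    if "finite S" "v \<in> carrier V" "\<And>z. z \<in> supp v \<Longrightarrow> v z \<in> M" "supp v \<subseteq> S" for S v
    using that
  proof (induction S arbitrary: v rule: finite_induct)
    case empty
    then show ?case using V_eq_one[of v] N.one_closed by (simp add: W_one)
  next
    case (insert z S)
    show ?case
    proof (cases "z \<in> supp v")
      case False
      then show ?thesis using insert by blast
    next
      case True
      then have z: "z \<in> carrier B" "v z \<in> M" "v z \<in> carrier A"
        using insert.prems by (auto simp: supp_def)
      define u where "u = inv\<^bsub>V\<^esub> (delta z (v z)) \<otimes>\<^bsub>V\<^esub> v"
      have u: "u \<in> carrier V" using insert.prems z by (simp add: u_def)
      have uz: "u x = (if x = z then \<one>\<^bsub>A\<^esub> else v x)" if "x \<in> carrier B" for x
        using that insert.prems(1) z by (simp add: u_def)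
      have "(u, \<one>) \<in> N"
        using insert.prems u uz by (intro insert.IH) (auto simp: supp_def split: if_splits)
      moreover have "(v, \<one>) = (delta z (v z), \<one>) \<otimes>\<^bsub>W\<^esub> (u, \<one>)"
        using insert.prems z by (simp add: u_def V.group_simps)
      ultimately show ?thesis using subgroup.m_closed[OF N.is_subgroup single[OF z(2,1)]] by presburger
    qed
  qed
  from this[OF finite_supp] show ?thesis by (auto simp: pointwise_def supp_def)
qed

text \<open>At \<open>z\<close> this is the product of \<open>f z\<close>,
  \<open>f (inv b z)\<close> and so on, with \<open>i\<close> factors. For \<open>i = ord b\<close>
  it is the ordered product along the cycle of \<open>z\<close>; for abelian \<open>A\<close> it is
  the norm 1 + b + ... + b^(i-1) applied to \<open>f\<close>.\<close>

definition power_base :: "('b \<Rightarrow> 'a) \<Rightarrow> 'b \<Rightarrow> nat \<Rightarrow> 'b \<Rightarrow> 'a" where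
  "power_base f b i = fst ((f, b) [^]\<^bsub>W\<^esub> i)"

lemma W_pow:
  assumes "f \<in> carrier V" "b \<in> carrier B"
  shows "(f, b) [^]\<^bsub>W\<^esub> i = (power_base f b i, b [^] i)"
proof -
  have "(f, b) \<in> carrier W" using assms by (simp add: carrier_W)
  then have "snd ((f, b) [^]\<^bsub>W\<^esub> i) = b [^] i"
    using hom_nat_pow[OF snd_hom _ W.group_axioms B.group_axioms, of "(f, b)" i] by simp
  then show ?thesis by (simp add: power_base_def prod_eq_iff)
qed

lemma power_base_closed [simp]:
  "f \<in> carrier V \<Longrightarrow> b \<in> carrier B \<Longrightarrow> power_base f b i \<in> carrier V"
  using W.nat_pow_closed[of "(f, b)" i] by (simp add: W_pow carrier_W)

lemma power_base_0 [simp]: "power_base f b 0 = \<one>\<^bsub>V\<^esub>"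
  by (simp add: power_base_def W_one)

lemma power_base_Suc:
  assumes "f \<in> carrier V" "b \<in> carrier B"
  shows "power_base f b (Suc i) = power_base f b i \<otimes>\<^bsub>V\<^esub> tr (b [^] i) f"
  using assms W_pow[of f b "Suc i"] W_pow[of f b i] by simp

lemma power_base_Suc2:
  assumes "f \<in> carrier V" "b \<in> carrier B"
  shows "power_base f b (Suc i) = f \<otimes>\<^bsub>V\<^esub> tr b (power_base f b i)"
proof -
  have "(f, b) [^]\<^bsub>W\<^esub> Suc i = (f, b) \<otimes>\<^bsub>W\<^esub> (f, b) [^]\<^bsub>W\<^esub> i"
    using assms W.nat_pow_Suc2[of "(f, b)" i] by (simp add: carrier_W del: W.nat_pow_Suc)
  then show ?thesis
    using assms W_pow[of f b "Suc i"] W_pow[of f b i] by simp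
qed

text \<open>A conjugating function is determined on a cycle of \<open>b\<close> by its value \<open>m y\<close> at one point \<open>y\<close>; the
  hypothesis on the powers is what makes it return to that value.\<close>

lemma conj_of_cycle_products:
  assumes fin: "finite (carrier B)" and M: "M \<lhd> A"
    and f: "f \<in> carrier V" and f': "f' \<in> carrier V" and b: "b \<in> carrier B"
    and cong: "\<And>z. z \<in> carrier B \<Longrightarrow> f' z \<otimes>\<^bsub>A\<^esub> inv\<^bsub>A\<^esub> (f z) \<in> M"
    and prod: "\<And>y. y \<in> carrier B \<Longrightarrow> power_base f' b (B.ord b) y \<in> class_under A M (power_base f b (B.ord b) y)"
  shows "(f', b) \<in> class_under W (pointwise M) (f, b)"
proof -
  interpret M: normal M A by fact
  define q where "q = B.ord b"
  have bq: "b [^] q = \<one>" using b by (simp add: q_def)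
  have "\<exists>m\<in>M. power_base f' b q y = m \<otimes>\<^bsub>A\<^esub> power_base f b q y \<otimes>\<^bsub>A\<^esub> inv\<^bsub>A\<^esub> m" if "y \<in> carrier B" for y
    using prod[OF that] by (auto simp: class_under_def q_def)
  then obtain m where m: "\<And>y. y \<in> carrier B \<Longrightarrow> m y \<in> M"
    "\<And>y. y \<in> carrier B \<Longrightarrow> power_base f' b q y = m y \<otimes>\<^bsub>A\<^esub> power_base f b q y \<otimes>\<^bsub>A\<^esub> inv\<^bsub>A\<^esub> (m y)"
    by metis
  have mA: "m y \<in> carrier A" if "y \<in> carrier B" for y using m(1)[OF that] by simp
  \<comment> \<open>The forced value of the conjugating function at
    \<open>b [^] i \<otimes> y\<close> once its value at \<open>y\<close> is \<open>m y\<close>: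
    solve \<open>n (b z) f (b z) = f' (b z) n z\<close> for \<open>n (b z)\<close> along the
    cycle.\<close>
  define T where "T y i = power_base f' b i (b [^] i \<otimes> y) \<otimes>\<^bsub>A\<^esub> m y \<otimes>\<^bsub>A\<^esub>
      inv\<^bsub>A\<^esub> (power_base f b i (b [^] i \<otimes> y))" for y i
  have T0: "T y 0 = m y" if "y \<in> carrier B" for y
    using that mA by (simp add: T_def)
  have Tq: "T y q = m y" if y: "y \<in> carrier B" for y
    using y mA[OF y] f b by (simp add: T_def bq m(2) A.group_simps)
  have step: "power_base h b (Suc i) (b [^] Suc i \<otimes> y) =
      h (b [^] Suc i \<otimes> y) \<otimes>\<^bsub>A\<^esub> power_base h b i (b [^] i \<otimes> y)"
    if "h \<in> carrier V" "y \<in> carrier B" for h y i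
  proof -
    have "inv b \<otimes> (b [^] Suc i \<otimes> y) = b [^] i \<otimes> y"
      unfolding B.nat_pow_Suc2[OF b] using b that by (simp add: B.group_simps)
    then show ?thesis
      using that b power_base_Suc2[OF that(1) b, of i] by (simp del: B.nat_pow_Suc)
  qed
  have TSuc: "T y (Suc i) = f' (b [^] Suc i \<otimes> y) \<otimes>\<^bsub>A\<^esub> T y i \<otimes>\<^bsub>A\<^esub> inv\<^bsub>A\<^esub> (f (b [^] Suc i \<otimes> y))"
    if y: "y \<in> carrier B" for y i
    unfolding T_def step[OF f y] step[OF f' y]
    using mA[OF y] f f' y b by (simp add: A.group_simps del: B.nat_pow_Suc)
  have Tadd: "T y (i + q) = T y i" if y: "y \<in> carrier B" for y i
  proof (induction i)
    case 0
    then show ?case using T0 Tq y by simp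
  next
    case (Suc i)
    have "b [^] Suc (i + q) = b [^] Suc i"
      using b bq B.nat_pow_mult[of b "Suc i" q, symmetric] by simp
    then show ?case
      using TSuc[OF y, of "i + q"] TSuc[OF y, of i] Suc by simp
  qed
  have Tmult: "T y (i + q * j) = T y i" if y: "y \<in> carrier B" for y i j
  proof (induction j)
    case (Suc j)
    then show ?case using Tadd[OF y, of "i + q * j"] by (simp add: algebra_simps)
  qed simp
  have Teq: "T y i = T y j" if y: "y \<in> carrier B" and ij: "b [^] i = b [^] j" for y i j
  proof -
    have "i mod q = j mod q"
    proof -
      have "b [^] int i = b [^] int j" using ij by (simp add: int_pow_int)
      then have "int q dvd int j - int i" using B.int_pow_eq[OF b] by (simp add: q_def)
      then have "int j mod int q = int i mod int q" by (simp add: mod_eq_dvd_iff)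
      then show ?thesis by (metis of_nat_eq_iff of_nat_mod)
    qed
    then show ?thesis
      using Tmult[OF y, of "i mod q" "i div q"] Tmult[OF y, of "j mod q" "j div q"]
      by (metis mod_mult_div_eq)
  qed
  \<comment> \<open>As \<open>f'\<close> and \<open>f\<close> agree modulo \<open>M\<close>, one
    step of the recursion is a conjugation by a value of \<open>f\<close> followed by multiplication
    by an element of \<open>M\<close>.\<close>
  have TM: "T y i \<in> M" if y: "y \<in> carrier B" for y i
  proof (induction i)
    case 0
    then show ?case using T0 m y by simp
  next
    case (Suc i)
    define w where "w = b [^] Suc i \<otimes> y"
    have w: "w \<in> carrier B" using b y by (simp add: w_def)
    have "T y (Suc i) = (f' w \<otimes>\<^bsub>A\<^esub> inv\<^bsub>A\<^esub> (f w)) \<otimes>\<^bsub>A\<^esub> (f w \<otimes>\<^bsub>A\<^esub> T y i \<otimes>\<^bsub>A\<^esub> inv\<^bsub>A\<^esub> (f w))"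
      using TSuc[OF y, of i] w f f' Suc unfolding w_def[symmetric] by (simp add: A.group_simps)
    also have "\<dots> \<in> M" using cong[OF w] M.inv_op_closed2[OF V_value[OF f w] Suc] by (rule M.m_closed)
    finally show ?case .
  qed
  define C where "C z = generate B {b} #> z" for z
  have sub: "subgroup (generate B {b}) B" using b by (simp add: B.generate_is_subgroup)
  \<comment> \<open>Choosing from the coset \<open>C z\<close>, not from \<open>z\<close>, gives all
    points of a cycle the same representative. The index \<open>idx\<close> is not unique, which
    \<open>Teq\<close> absorbs.\<close>
  define rep where "rep z = (SOME y. y \<in> C z)" for z
  have rep: "rep z \<in> C z" if "z \<in> carrier B" for z
    unfolding rep_def C_def by (rule someI[of _ z]) (use B.rcos_self[OF that sub] in simp)
  have CB: "C z \<subseteq> carrier B" if "z \<in> carrier B" for z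
    unfolding C_def using B.r_coset_subset_G[OF subgroup.subset[OF sub] that] .
  have repB: "rep z \<in> carrier B" if "z \<in> carrier B" for z
    using rep[OF that] CB[OF that] by blast
  have "\<exists>i::nat. z = b [^] i \<otimes> rep z" if z: "z \<in> carrier B" for z
  proof -
    have "C z = C (rep z)"
      using B.repr_independence[OF _ z sub, of "rep z"] rep[OF z] by (simp add: C_def)
    then have "z \<in> generate B {b} #> rep z"
      using B.rcos_self[OF z sub] by (simp add: C_def)
    then show ?thesis
      using B.generate_pow_on_finite_carrier[OF fin b] by (auto simp: r_coset_def)
  qed
  then obtain idx :: "'b \<Rightarrow> nat" where idx: "\<And>z. z \<in> carrier B \<Longrightarrow> z = b [^] idx z \<otimes> rep z"
    by metis
  have repb: "rep (b \<otimes> z) = rep z" if z: "z \<in> carrier B" for z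
  proof -
    have "b \<otimes> z \<in> C z"
      unfolding C_def r_coset_def using generate.incl[of b "{b}" B] by blast
    then have "C z = C (b \<otimes> z)"
      unfolding C_def using B.repr_independence[OF _ z sub] by blast
    then show ?thesis by (simp add: rep_def)
  qed
  define n where "n = (\<lambda>z\<in>carrier B. T (rep z) (idx z))"
  have nM: "n z \<in> M" if "z \<in> carrier B" for z using that TM repB by (simp add: n_def)
  have nV: "n \<in> carrier V"
    using nM fin by (auto simp: carrier_V n_def supp_def)
  have nb: "n (b \<otimes> z) = f' (b \<otimes> z) \<otimes>\<^bsub>A\<^esub> n z \<otimes>\<^bsub>A\<^esub> inv\<^bsub>A\<^esub> (f (b \<otimes> z))"
    if z: "z \<in> carrier B" for z
  proof -
    have bz: "b \<otimes> z = b [^] Suc (idx z) \<otimes> rep z"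
      unfolding B.nat_pow_Suc2[OF b] using idx[OF z] b repB[OF z] z by (metis B.m_assoc B.nat_pow_closed)
    have "b [^] idx (b \<otimes> z) \<otimes> rep z = b [^] Suc (idx z) \<otimes> rep z"
      using idx[OF B.m_closed[OF b z]] unfolding repb[OF z] bz[symmetric] by (rule sym)
    then have "b [^] idx (b \<otimes> z) = b [^] Suc (idx z)"
      using b repB[OF z] by (simp del: B.nat_pow_Suc)
    from Teq[OF repB[OF z] this] have "n (b \<otimes> z) = T (rep z) (Suc (idx z))"
      using z b by (simp add: n_def repb[OF z])
    then show ?thesis
      unfolding TSuc[OF repB[OF z]] bz[symmetric] using z by (simp add: n_def)
  qed
  have "(n, \<one>) \<otimes>\<^bsub>W\<^esub> (f, b) \<otimes>\<^bsub>W\<^esub> inv\<^bsub>W\<^esub> (n, \<one>) = (n \<otimes>\<^bsub>V\<^esub> f \<otimes>\<^bsub>V\<^esub> inv\<^bsub>V\<^esub> (tr b n), b)"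
    using W_conj[OF nV f B.one_closed b] f b by simp
  also have "n \<otimes>\<^bsub>V\<^esub> f \<otimes>\<^bsub>V\<^esub> inv\<^bsub>V\<^esub> (tr b n) = f'"
  proof (rule V_eqI)
    fix z assume z: "z \<in> carrier B"
    define y where "y = inv b \<otimes> z"
    have y: "y \<in> carrier B" "z = b \<otimes> y" using z b by (simp_all add: y_def B.group_simps)
    show "(n \<otimes>\<^bsub>V\<^esub> f \<otimes>\<^bsub>V\<^esub> inv\<^bsub>V\<^esub> (tr b n)) z = f' z"
      using nb[OF y(1)] y(2)[symmetric] z b nV f f' y(1)
      by (simp add: y_def[symmetric] A.group_simps)
  qed (use nV f f' b in simp_all)
  finally have "(n, \<one>) \<otimes>\<^bsub>W\<^esub> (f, b) \<otimes>\<^bsub>W\<^esub> inv\<^bsub>W\<^esub> (n, \<one>) = (f', b)" .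
  moreover have "(n, \<one>) \<in> pointwise M"
    using nV nM by (simp add: pointwise_def)
  ultimately show ?thesis
    using class_underI[of "(n, \<one>)" "pointwise M" W "(f, b)"] by presburger
qed

end

section \<open>Open subgroups of the wreath product when the top group is in the class\<close>

locale pro_wreath = wreath A B + pseudovariety \<C>
  for A :: "('a, 'm) monoid_scheme" and B :: "('b, 'n) monoid_scheme" (structure) and \<C>
begin

lemma in_class_top:
  assumes N: "N \<in> co_normal_subgroups \<C> W" and a: "a \<in> carrier A" "a' \<in> carrier A"
    and nN: "(delta \<one> (a \<otimes>\<^bsub>A\<^esub> a' \<otimes>\<^bsub>A\<^esub> inv\<^bsub>A\<^esub> a \<otimes>\<^bsub>A\<^esub> inv\<^bsub>A\<^esub> a'), \<one>) \<notin> N"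
  shows "in_class \<C> B"
proof -
  note N' = co_normalD[OF N]
  interpret N: normal N W by fact
  interpret Q: group "W Mod N" by (rule N.factorgroup_is_group)
  interpret \<rho>: group_hom W "W Mod N" "\<lambda>x. N #>\<^bsub>W\<^esub> x"
    using N.r_coset_hom_Mod by unfold_locales
  have hom: "(\<lambda>x. N #>\<^bsub>W\<^esub> x) \<circ> (\<lambda>b. (\<one>\<^bsub>V\<^esub>, b)) \<in> hom B (W Mod N)"
    by (rule Group.hom_compose[OF top_hom N.r_coset_hom_Mod])
  interpret h: group_hom B "W Mod N" "(\<lambda>x. N #>\<^bsub>W\<^esub> x) \<circ> (\<lambda>b. (\<one>\<^bsub>V\<^esub>, b))"
    using hom by unfold_locales
  have trivial: "k = \<one>" if k: "k \<in> carrier B" "(\<one>\<^bsub>V\<^esub>, k) \<in> N" for k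
  proof (rule ccontr)
    assume k1: "k \<noteq> \<one>"
    define p where "p = (delta \<one> a, \<one>)"
    define q where "q = (delta \<one> a', \<one>)"
    define q' where "q' = (delta k a', \<one>)"
    have c: "p \<in> carrier W" "q \<in> carrier W" "q' \<in> carrier W" "(\<one>\<^bsub>V\<^esub>, k) \<in> carrier W"
      using a k by (auto simp: p_def q_def q'_def carrier_W)
    have q'_eq: "q' = (\<one>\<^bsub>V\<^esub>, k) \<otimes>\<^bsub>W\<^esub> q \<otimes>\<^bsub>W\<^esub> inv\<^bsub>W\<^esub> (\<one>\<^bsub>V\<^esub>, k)"
      using W_conj_base[of "delta \<one> a'" k] a k tr_delta[of k "\<one>" a'] by (simp add: q_def q'_def)
    have one: "N #>\<^bsub>W\<^esub> (\<one>\<^bsub>V\<^esub>, k) = \<one>\<^bsub>W Mod N\<^esub>"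
      using r_coset_eq_iff_mem[OF N'(1) c(4)] k by simp
    have "N #>\<^bsub>W\<^esub> q' = N #>\<^bsub>W\<^esub> q"
      unfolding q'_eq using c one by (simp del: one_FactGroup mult_FactGroup)
    then have "N #>\<^bsub>W\<^esub> (p \<otimes>\<^bsub>W\<^esub> q \<otimes>\<^bsub>W\<^esub> inv\<^bsub>W\<^esub> p \<otimes>\<^bsub>W\<^esub> inv\<^bsub>W\<^esub> q) =
        N #>\<^bsub>W\<^esub> (p \<otimes>\<^bsub>W\<^esub> q' \<otimes>\<^bsub>W\<^esub> inv\<^bsub>W\<^esub> p \<otimes>\<^bsub>W\<^esub> inv\<^bsub>W\<^esub> q')"
      using c by (simp del: one_FactGroup mult_FactGroup)
    also have "p \<otimes>\<^bsub>W\<^esub> q' = q' \<otimes>\<^bsub>W\<^esub> p"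
      unfolding p_def q'_def W_mult using a k k1 by (auto intro!: V_eqI)
    then have "p \<otimes>\<^bsub>W\<^esub> q' \<otimes>\<^bsub>W\<^esub> inv\<^bsub>W\<^esub> p \<otimes>\<^bsub>W\<^esub> inv\<^bsub>W\<^esub> q' = \<one>\<^bsub>W\<^esub>"
      using c by (simp add: W.group_simps)
    finally have "N #>\<^bsub>W\<^esub> (p \<otimes>\<^bsub>W\<^esub> q \<otimes>\<^bsub>W\<^esub> inv\<^bsub>W\<^esub> p \<otimes>\<^bsub>W\<^esub> inv\<^bsub>W\<^esub> q) = N"
      using N'(4) by (simp add: N.subset)
    then have "p \<otimes>\<^bsub>W\<^esub> q \<otimes>\<^bsub>W\<^esub> inv\<^bsub>W\<^esub> p \<otimes>\<^bsub>W\<^esub> inv\<^bsub>W\<^esub> q \<in> N"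
      by (rule r_coset_eq_iff_mem[OF N'(1), THEN iffD1, rotated]) (use c in simp)
    moreover have "p \<otimes>\<^bsub>W\<^esub> q \<otimes>\<^bsub>W\<^esub> inv\<^bsub>W\<^esub> p \<otimes>\<^bsub>W\<^esub> inv\<^bsub>W\<^esub> q =
        (delta \<one> (a \<otimes>\<^bsub>A\<^esub> a' \<otimes>\<^bsub>A\<^esub> inv\<^bsub>A\<^esub> a \<otimes>\<^bsub>A\<^esub> inv\<^bsub>A\<^esub> a'), \<one>)"
      using a by (simp add: p_def q_def W_inv delta_mult delta_inv)
    ultimately show False using nN by simp
  qed
  have "kernel B (W Mod N) ((\<lambda>x. N #>\<^bsub>W\<^esub> x) \<circ> (\<lambda>b. (\<one>\<^bsub>V\<^esub>, b))) = {\<one>}"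
    using trivial r_coset_eq_iff_mem[OF N'(1)] N'(5) by (auto simp: kernel_def carrier_W W_one)
  then show ?thesis
    using in_class_mono[OF N'(2) B.group_axioms hom] h.inj_iff_trivial_ker by blast
qed

lemma vimage_snd_co_normal:
  assumes "K \<in> co_normal_subgroups \<C> B"
  shows "{x \<in> carrier W. snd x \<in> K} \<in> co_normal_subgroups \<C> W"
  by (rule co_normal_vimage[OF W.group_axioms snd_hom assms])

text \<open>For \<open>B\<close> in the class, triviality of the top component is an open condition.
  On the subgroup it defines, evaluation at each of the finitely many coordinates is a homomorphism
  to \<open>A\<close>; transitivity brings the result back to \<open>W\<close>.\<close>

lemma pointwise_open:
  assumes B: "in_class \<C> B" and M: "M \<in> co_normal_subgroups \<C> A"
  shows "\<exists>R\<in>co_normal_subgroups \<C> W. R \<subseteq> pointwise M"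
proof -
  have "kernel B B (\<lambda>x. x) \<in> co_normal_subgroups \<C> B"
    by (rule co_normal_kernel[OF B.group_axioms B]) (simp add: hom_def)
  then have "{\<one>} \<in> co_normal_subgroups \<C> B"
    by (simp add: kernel_def conj_commute cong: conj_cong)
  from vimage_snd_co_normal[OF this]
  have P: "{x \<in> carrier W. snd x \<in> {\<one>}} \<in> co_normal_subgroups \<C> W" .
  define P where "P = {x \<in> carrier W. snd x \<in> {\<one>}}"
  have P': "P \<in> co_normal_subgroups \<C> W" using P by (simp add: P_def)
  have gP: "group (W\<lparr>carrier := P\<rparr>)"
    using W.subgroup_imp_group[OF co_normalD(3)[OF P']] .
  have "{p \<in> P. fst p z \<in> M} \<in> co_normal_subgroups \<C> (W\<lparr>carrier := P\<rparr>)" if z: "z \<in> carrier B" for z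
  proof -
    have "(\<lambda>p. fst p z) \<in> hom (W\<lparr>carrier := P\<rparr>) A"
      using z by (auto simp: hom_def P_def carrier_W)
    from co_normal_vimage[OF gP this M] show ?thesis by simp
  qed
  then have "\<exists>Q\<in>co_normal_subgroups \<C> (W\<lparr>carrier := P\<rparr>). \<forall>z\<in>carrier B. Q \<subseteq> {p \<in> P. fst p z \<in> M}"
    using in_class_finite[OF B] gP by (intro co_normal_choice) blast+
  then obtain Q where Q: "Q \<in> co_normal_subgroups \<C> (W\<lparr>carrier := P\<rparr>)"
    "\<forall>z\<in>carrier B. Q \<subseteq> {p \<in> P. fst p z \<in> M}" by blast
  have "Q \<subseteq> P" using co_normalD(4)[OF Q(1)] by simp
  then have "Q \<subseteq> pointwise M"
    using Q(2) unfolding pointwise_def P_def carrier_W by fastforce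
  then show ?thesis using co_normal_trans[OF P' Q(1)] by blast
qed

lemma hereditarily_conjugacy_separable_finite_top:
  assumes B: "in_class \<C> B" and hA: "hereditarily_conjugacy_separable \<C> A"
  shows "hereditarily_conjugacy_separable \<C> W"
proof (rule hereditarily_conjugacy_separableI[OF W.group_axioms])
  fix N g assume N: "N \<in> co_normal_subgroups \<C> W" and g: "g \<in> carrier W"
  obtain f b where fb: "g = (f, b)" "f \<in> carrier V" "b \<in> carrier B" using g by (auto simp: carrier_W)
  \<comment> \<open>The trace of \<open>N\<close> at the coordinate of the identity; by normality of
    \<open>N\<close> it does not depend on the coordinate.\<close>
  define M where "M = {a \<in> carrier A. (delta \<one> a, \<one>) \<in> N}"
  have M: "M \<in> co_normal_subgroups \<C> A"
    unfolding M_def by (rule co_normal_vimage[OF A.group_axioms delta_hom N])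
  note M' = co_normalD[OF M]
  interpret M: normal M A by fact
  have MN: "pointwise M \<subseteq> N"
  proof (rule pointwise_subset[OF co_normalD(1)[OF N]])
    show "a \<in> carrier A \<and> (delta \<one> a, \<one>) \<in> N" if "a \<in> M" for a
      using that unfolding M_def by (rule CollectD)
  qed
  have "x \<in> class_under W (pointwise M) g"
    if x: "x \<in> carrier W" and adh: "adherent W (class_under W (pointwise M) g) x" for x
  proof -
    obtain f' b' where fb': "x = (f', b')" "f' \<in> carrier V" "b' \<in> carrier B" using x by (auto simp: carrier_W)
    have ex: "\<exists>n r. n \<in> carrier V \<and> (\<forall>z\<in>carrier B. n z \<in> M) \<and> r \<in> R \<and>
        x \<otimes>\<^bsub>W\<^esub> r = (n, \<one>) \<otimes>\<^bsub>W\<^esub> g \<otimes>\<^bsub>W\<^esub> inv\<^bsub>W\<^esub> (n, \<one>)"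
      if RN: "R \<in> co_normal_subgroups \<C> W" for R
    proof -
      obtain r where r: "r \<in> R" "x \<otimes>\<^bsub>W\<^esub> r \<in> class_under W (pointwise M) g"
        using adh RN unfolding adherent_def by blast
      from r(2) obtain m where m: "m \<in> pointwise M" "x \<otimes>\<^bsub>W\<^esub> r = m \<otimes>\<^bsub>W\<^esub> g \<otimes>\<^bsub>W\<^esub> inv\<^bsub>W\<^esub> m"
        by (rule class_underE)
      from m(1) obtain n where "m = (n, \<one>)" "n \<in> carrier V" "\<forall>z\<in>carrier B. n z \<in> M"
        unfolding pointwise_def by (elim SigmaE) simp
      then show ?thesis using m(2) r(1) by meson
    qed
    \<comment> \<open>A first approximation, with error in \<open>pointwise M\<close>, yields equal
      top components and the congruence of \<open>f'\<close> and \<open>f\<close> modulo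
      \<open>M\<close>. Finer ones are used only for the products along cycles.\<close>
    obtain R where R: "R \<in> co_normal_subgroups \<C> W" "R \<subseteq> pointwise M"
      using pointwise_open[OF B M] by blast
    obtain n r where n: "n \<in> carrier V" "\<And>z. z \<in> carrier B \<Longrightarrow> n z \<in> M"
      and r: "r \<in> R" and xr: "x \<otimes>\<^bsub>W\<^esub> r = (n, \<one>) \<otimes>\<^bsub>W\<^esub> g \<otimes>\<^bsub>W\<^esub> inv\<^bsub>W\<^esub> (n, \<one>)"
      using ex[OF R(1)] by blast
    obtain l where l: "r = (l, \<one>)" "l \<in> carrier V" "\<And>z. z \<in> carrier B \<Longrightarrow> l z \<in> M"
      using r R(2) by (auto simp: pointwise_def)
    have eq: "f' \<otimes>\<^bsub>V\<^esub> tr b' l = n \<otimes>\<^bsub>V\<^esub> f \<otimes>\<^bsub>V\<^esub> inv\<^bsub>V\<^esub> (tr b n)" and bb: "b' = b"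
      using xr W_conj[OF n(1) fb(2) B.one_closed fb(3)] fb fb' by (auto simp: l(1))
    have cong: "f' z \<otimes>\<^bsub>A\<^esub> inv\<^bsub>A\<^esub> (f z) \<in> M" if z: "z \<in> carrier B" for z
    proof -
      define y where "y = inv b \<otimes> z"
      have y: "y \<in> carrier B" using z fb by (simp add: y_def)
      have "f' z \<otimes>\<^bsub>A\<^esub> l y = n z \<otimes>\<^bsub>A\<^esub> f z \<otimes>\<^bsub>A\<^esub> inv\<^bsub>A\<^esub> (n y)"
        using fun_cong[OF eq, of z] z fb fb' l n y by (simp add: bb y_def)
      then have "f' z = n z \<otimes>\<^bsub>A\<^esub> f z \<otimes>\<^bsub>A\<^esub> inv\<^bsub>A\<^esub> (n y) \<otimes>\<^bsub>A\<^esub> inv\<^bsub>A\<^esub> (l y)"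
        using z y fb fb' l n by (metis A.inv_solve_right A.m_closed A.inv_closed V_value)
      then have "f' z \<otimes>\<^bsub>A\<^esub> inv\<^bsub>A\<^esub> (f z) =
          n z \<otimes>\<^bsub>A\<^esub> (f z \<otimes>\<^bsub>A\<^esub> (inv\<^bsub>A\<^esub> (n y) \<otimes>\<^bsub>A\<^esub> inv\<^bsub>A\<^esub> (l y)) \<otimes>\<^bsub>A\<^esub> inv\<^bsub>A\<^esub> (f z))"
        using z y fb l n by (simp add: A.group_simps)
      also have "\<dots> \<in> M"
        by (intro M.m_closed M.inv_op_closed2 M.m_inv_closed n l y z V_value[OF fb(2)])
      finally show ?thesis .
    qed
    define q where "q = B.ord b"
    have bq: "b [^] q = \<one>" using fb by (simp add: q_def)
    have "power_base f' b q y \<in> class_under A M (power_base f b q y)" if y: "y \<in> carrier B" for y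
    proof (rule adherent_class_under[OF A.group_axioms hA M])
      show "adherent A (class_under A M (power_base f b q y)) (power_base f' b q y)"
        unfolding adherent_def
      proof
        fix L assume L: "L \<in> co_normal_subgroups \<C> A"
        obtain R where R: "R \<in> co_normal_subgroups \<C> W" "R \<subseteq> pointwise L"
          using pointwise_open[OF B L] by blast
        note R' = co_normalD[OF R(1)]
        interpret R: normal R W by fact
        obtain n r where n: "n \<in> carrier V" "\<And>z. z \<in> carrier B \<Longrightarrow> n z \<in> M"
          and r: "r \<in> R" and xr: "x \<otimes>\<^bsub>W\<^esub> r = (n, \<one>) \<otimes>\<^bsub>W\<^esub> g \<otimes>\<^bsub>W\<^esub> inv\<^bsub>W\<^esub> (n, \<one>)"
          using ex[OF R(1)] by blast
        \<comment> \<open>Taking the \<open>q\<close>-th power keeps the error in \<open>R\<close>.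
          On \<open>q\<close>-th powers the top component is trivial, so conjugation by
          \<open>(n, \<one>)\<close> acts coordinate by coordinate and becomes a statement about
          \<open>A\<close>.\<close>
        have rW: "r \<in> carrier W" using r by simp
        have "x \<otimes>\<^bsub>W\<^esub> r \<in> x <#\<^bsub>W\<^esub> R" using r by (auto simp: l_coset_def)
        then have "x \<otimes>\<^bsub>W\<^esub> r \<in> R #>\<^bsub>W\<^esub> x" using R.coset_eq x by blast
        then have "R #>\<^bsub>W\<^esub> x = R #>\<^bsub>W\<^esub> (x \<otimes>\<^bsub>W\<^esub> r)"
          using W.repr_independence[OF _ x R'(3)] by blast
        then have "R #>\<^bsub>W\<^esub> x [^]\<^bsub>W\<^esub> q = R #>\<^bsub>W\<^esub> (x \<otimes>\<^bsub>W\<^esub> r) [^]\<^bsub>W\<^esub> q"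
          using R.FactGroup_pow[of x q] R.FactGroup_pow[of "x \<otimes>\<^bsub>W\<^esub> r" q] x rW by simp
        then have "(x \<otimes>\<^bsub>W\<^esub> r) [^]\<^bsub>W\<^esub> q \<in> R #>\<^bsub>W\<^esub> x [^]\<^bsub>W\<^esub> q"
          using W.rcos_self[OF _ R'(3)] x rW by simp
        then have "(x \<otimes>\<^bsub>W\<^esub> r) [^]\<^bsub>W\<^esub> q \<in> x [^]\<^bsub>W\<^esub> q <#\<^bsub>W\<^esub> R"
          using R.coset_eq x by simp
        then obtain s where s: "s \<in> R" "(x \<otimes>\<^bsub>W\<^esub> r) [^]\<^bsub>W\<^esub> q = x [^]\<^bsub>W\<^esub> q \<otimes>\<^bsub>W\<^esub> s"
          by (auto simp: l_coset_def)
        obtain l where l: "s = (l, \<one>)" "l \<in> carrier V" "\<And>z. z \<in> carrier B \<Longrightarrow> l z \<in> L"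
          using s R(2) by (auto simp: pointwise_def)
        have nW: "(n, \<one>) \<in> carrier W" using n by (simp add: carrier_W)
        have "x [^]\<^bsub>W\<^esub> q \<otimes>\<^bsub>W\<^esub> s = (n, \<one>) \<otimes>\<^bsub>W\<^esub> g [^]\<^bsub>W\<^esub> q \<otimes>\<^bsub>W\<^esub> inv\<^bsub>W\<^esub> (n, \<one>)"
          using s(2) xr W.pow_conj[OF nW g] by simp
        then have "power_base f' b q \<otimes>\<^bsub>V\<^esub> l = n \<otimes>\<^bsub>V\<^esub> power_base f b q \<otimes>\<^bsub>V\<^esub> inv\<^bsub>V\<^esub> n"
          using fb fb' bb n l bq by (simp add: W_pow W_inv)
        from fun_cong[OF this, of y]
        have "power_base f' b q y \<otimes>\<^bsub>A\<^esub> l y = n y \<otimes>\<^bsub>A\<^esub> power_base f b q y \<otimes>\<^bsub>A\<^esub> inv\<^bsub>A\<^esub> (n y)"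
          using y n by simp
        then have "power_base f' b q y \<otimes>\<^bsub>A\<^esub> l y \<in> class_under A M (power_base f b q y)"
          using n(2)[OF y] by (auto simp: class_under_def)
        then show "\<exists>n\<in>L. power_base f' b q y \<otimes>\<^bsub>A\<^esub> n \<in> class_under A M (power_base f b q y)"
          using l(3)[OF y] by blast
      qed
    qed (use y fb fb' in simp_all)
    then show ?thesis
      using conj_of_cycle_products[OF in_class_finite[OF B] M'(1) fb(2) fb'(2) fb(3) cong]
      by (simp add: fb fb' bb q_def)
  qed
  then show "\<exists>R\<in>co_normal_subgroups \<C> W. \<exists>M. R \<subseteq> M \<and> M \<subseteq> N \<and>
      (\<forall>x\<in>carrier W. adherent W (class_under W M g) x \<longrightarrow> x \<in> class_under W M g)"
    using pointwise_open[OF B M] MN by meson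
qed

end

section \<open>Wreath products with abelian base\<close>

locale comm_wreath = wreath A B + A: comm_group A
  for A :: "('a, 'm) monoid_scheme" and B :: "('b, 'n) monoid_scheme" (structure)
begin

sublocale V: comm_group V
  by (rule V.group_comm_groupI) (auto intro!: V_eqI simp: A.m_comm)

text \<open>Cutting down to the support keeps the product finite for infinite \<open>S\<close>. The
  abelian group \<open>A\<close> is thought of additively.\<close>

definition sum_over :: "'b set \<Rightarrow> ('b \<Rightarrow> 'a) \<Rightarrow> 'a" where
  "sum_over S v = finprod A v (S \<inter> supp v)"

text \<open>The operator 1 - b. By \<open>W_conj_centralizer\<close> its values are the changes of
  the base component under conjugation by the base.\<close>

definition diff :: "'b \<Rightarrow> ('b \<Rightarrow> 'a) \<Rightarrow> 'b \<Rightarrow> 'a" where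
  "diff b v = v \<otimes>\<^bsub>V\<^esub> inv\<^bsub>V\<^esub> (tr b v)"

lemma sum_over_closed [simp]: "v \<in> carrier V \<Longrightarrow> sum_over S v \<in> carrier A"
  unfolding sum_over_def by (rule A.finprod_closed) (auto simp: supp_def)

lemma sum_over_eq_finprod:
  assumes "v \<in> carrier V" "finite F" "S \<inter> supp v \<subseteq> F" "F \<subseteq> S \<inter> carrier B"
  shows "sum_over S v = finprod A v F"
  unfolding sum_over_def
  by (rule A.finprod_mono_neutral_cong_left) (use assms in \<open>auto simp: supp_def\<close>)

lemma sum_over_cong: "S \<inter> supp v = T \<inter> supp v \<Longrightarrow> sum_over S v = sum_over T v"
  by (simp add: sum_over_def)

lemma sum_over_mult [simp]:
  assumes "u \<in> carrier V" "v \<in> carrier V"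
  shows "sum_over S (u \<otimes>\<^bsub>V\<^esub> v) = sum_over S u \<otimes>\<^bsub>A\<^esub> sum_over S v"
proof -
  define F where "F = S \<inter> (supp u \<union> supp v)"
  have F: "finite F" using assms by (simp add: F_def finite_supp)
  have FB: "F \<subseteq> carrier B" by (auto simp: F_def supp_def)
  have "sum_over S (u \<otimes>\<^bsub>V\<^esub> v) = finprod A (u \<otimes>\<^bsub>V\<^esub> v) F"
    by (rule sum_over_eq_finprod) (use assms F in \<open>auto simp: F_def supp_def\<close>)
  also have "\<dots> = finprod A (\<lambda>z. u z \<otimes>\<^bsub>A\<^esub> v z) F"
    by (rule A.finprod_cong') (use FB assms in \<open>auto simp: subset_iff\<close>)
  also have "\<dots> = finprod A u F \<otimes>\<^bsub>A\<^esub> finprod A v F"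
    by (rule A.finprod_multf) (use FB assms in \<open>auto simp: subset_iff\<close>)
  also have "finprod A u F = sum_over S u"
    by (rule sum_over_eq_finprod[symmetric]) (use assms F in \<open>auto simp: F_def supp_def\<close>)
  also have "finprod A v F = sum_over S v"
    by (rule sum_over_eq_finprod[symmetric]) (use assms F in \<open>auto simp: F_def supp_def\<close>)
  finally show ?thesis .
qed

lemma sum_over_group_hom: "group_hom V A (sum_over S)"
  by unfold_locales (simp add: hom_def)

lemma sum_over_one [simp]: "sum_over S \<one>\<^bsub>V\<^esub> = \<one>\<^bsub>A\<^esub>"
  by (rule group_hom.hom_one[OF sum_over_group_hom])

lemma sum_over_inv [simp]: "v \<in> carrier V \<Longrightarrow> sum_over S (inv\<^bsub>V\<^esub> v) = inv\<^bsub>A\<^esub> (sum_over S v)"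
  by (rule group_hom.hom_inv[OF sum_over_group_hom])

lemma sum_over_singleton:
  assumes "v \<in> carrier V" "S \<inter> supp v \<subseteq> {z}" "z \<in> S" "z \<in> carrier B"
  shows "sum_over S v = v z"
  using sum_over_eq_finprod[OF assms(1), of "{z}" S] assms by (simp add: A.finprod_insert)

lemma sum_over_delta:
  assumes "a \<in> carrier A" "z \<in> carrier B"
  shows "sum_over S (delta z a) = (if z \<in> S then a else \<one>\<^bsub>A\<^esub>)"
proof (cases "z \<in> S")
  case True
  then show ?thesis
    using sum_over_singleton[of "delta z a" S z] supp_delta[of z a] assms by auto
next
  case False
  then have "S \<inter> supp (delta z a) = {}" using supp_delta[of z a] by auto
  then show ?thesis using False by (simp add: sum_over_def)
qed

lemma sum_over_tr:
  assumes b: "b \<in> carrier B" and v: "v \<in> carrier V"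
  shows "sum_over S (tr b v) = sum_over {z \<in> carrier B. b \<otimes> z \<in> S} v"
proof -
  define T where "T = {z \<in> carrier B. b \<otimes> z \<in> S} \<inter> supp v"
  have TB: "T \<subseteq> carrier B" by (auto simp: T_def)
  have "S \<inter> supp (tr b v) = (\<lambda>z. b \<otimes> z) ` T"
    unfolding supp_tr[OF b] T_def by (auto simp: supp_def)
  moreover have "finprod A (tr b v) ((\<lambda>z. b \<otimes> z) ` T) = finprod A (\<lambda>z. tr b v (b \<otimes> z)) T"
    by (rule A.finprod_reindex) (use TB b v in \<open>auto simp: inj_on_def subset_iff\<close>)
  moreover have "\<dots> = finprod A v T"
    by (rule A.finprod_cong') (use TB b v in \<open>auto simp: subset_iff B.group_simps\<close>)
  ultimately show ?thesis by (simp add: sum_over_def T_def)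
qed

text \<open>Modulo \<open>Y\<close> a value may slide within its block, and values in
  \<open>M\<close> vanish. Sliding onto another support point of the block shrinks the support; a
  support point alone in its block carries the whole block sum, which is in \<open>M\<close>. The
  blocks will be the cycles of \<open>b\<close> with trivial \<open>M\<close>, and the cosets of a
  normal subgroup of \<open>B\<close>.\<close>

lemma block_sums_imp_mem:
  assumes Y: "subgroup Y V" and M: "subgroup M A"
    and blk: "\<And>z. z \<in> carrier B \<Longrightarrow> z \<in> blk z"
      "\<And>z z'. z \<in> carrier B \<Longrightarrow> z' \<in> blk z \<Longrightarrow> z' \<in> carrier B \<and> blk z' = blk z"
    and move: "\<And>z z' a. z \<in> carrier B \<Longrightarrow> z' \<in> blk z \<Longrightarrow> a \<in> carrier A \<Longrightarrow>
      delta z a \<otimes>\<^bsub>V\<^esub> inv\<^bsub>V\<^esub> (delta z' a) \<in> Y"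
    and drop: "\<And>z a. z \<in> carrier B \<Longrightarrow> a \<in> M \<Longrightarrow> delta z a \<in> Y"
    and v: "v \<in> carrier V" and sums: "\<And>z. z \<in> carrier B \<Longrightarrow> sum_over (blk z) v \<in> M"
  shows "v \<in> Y"
  using v sums
proof (induction "card (supp v)" arbitrary: v rule: less_induct)
  case less
  note v = less.prems(1)
  have MA: "m \<in> carrier A" if "m \<in> M" for m using that subgroup.subset[OF M] by blast
  have YV: "y \<in> carrier V" if "y \<in> Y" for y using that subgroup.subset[OF Y] by blast
  show ?case
  proof (cases "supp v = {}")
    case True
    then show ?thesis using V_eq_one[OF v] subgroup.one_closed[OF Y] by simp
  next
    case False
    then obtain z where z: "z \<in> supp v" by blast
    then have zB: "z \<in> carrier B" by (simp add: supp_def)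
    define a where "a = v z"
    have a: "a \<in> carrier A" using v zB by (simp add: a_def)
    have reduce: "v \<in> Y"
      if y: "y \<in> Y" and sy: "supp (v \<otimes>\<^bsub>V\<^esub> inv\<^bsub>V\<^esub> y) \<subseteq> supp v - {z}"
        and su: "\<And>x. x \<in> carrier B \<Longrightarrow> sum_over (blk x) y \<in> M" for y
    proof -
      have yV: "y \<in> carrier V" using YV[OF y] .
      have "card (supp (v \<otimes>\<^bsub>V\<^esub> inv\<^bsub>V\<^esub> y)) < card (supp v)"
        using sy z finite_supp[OF v] by (intro psubset_card_mono) auto
      moreover have "sum_over (blk x) (v \<otimes>\<^bsub>V\<^esub> inv\<^bsub>V\<^esub> y) \<in> M" if "x \<in> carrier B" for x
        using su[OF that] less.prems(2)[OF that] v yV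
        by (simp add: subgroup.m_closed[OF M] subgroup.m_inv_closed[OF M])
      ultimately have "v \<otimes>\<^bsub>V\<^esub> inv\<^bsub>V\<^esub> y \<in> Y" using less.hyps v yV by simp
      then have "(v \<otimes>\<^bsub>V\<^esub> inv\<^bsub>V\<^esub> y) \<otimes>\<^bsub>V\<^esub> y \<in> Y" using y subgroup.m_closed[OF Y] by blast
      then show ?thesis using v yV by (simp add: V.m_assoc)
    qed
    show ?thesis
    proof (cases "\<exists>z'\<in>blk z \<inter> supp v. z' \<noteq> z")
      case True
      then obtain z' where z': "z' \<in> blk z" "z' \<in> supp v" "z' \<noteq> z" by blast
      have z'B: "z' \<in> carrier B" using z' by (simp add: supp_def)
      have same: "z \<in> blk x \<longleftrightarrow> z' \<in> blk x" if "x \<in> carrier B" for x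
        using blk that zB z'(1) z'B by metis
      show ?thesis
      proof (rule reduce[OF move[OF zB z'(1) a]])
        show "supp (v \<otimes>\<^bsub>V\<^esub> inv\<^bsub>V\<^esub> (delta z a \<otimes>\<^bsub>V\<^esub> inv\<^bsub>V\<^esub> (delta z' a))) \<subseteq> supp v - {z}"
          using v a z z' zB by (auto simp: supp_def a_def split: if_splits)
        show "sum_over (blk x) (delta z a \<otimes>\<^bsub>V\<^esub> inv\<^bsub>V\<^esub> (delta z' a)) \<in> M" if "x \<in> carrier B" for x
          using same[OF that] a zB z'B subgroup.one_closed[OF M] by (simp add: sum_over_delta)
      qed
    next
      case False
      then have "sum_over (blk z) v = a"
        unfolding a_def using v zB blk(1)[OF zB] by (intro sum_over_singleton) auto
      then have aM: "a \<in> M" using less.prems(2)[OF zB] by simp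
      show ?thesis
      proof (rule reduce[OF drop[OF zB aM]])
        show "supp (v \<otimes>\<^bsub>V\<^esub> inv\<^bsub>V\<^esub> (delta z a)) \<subseteq> supp v - {z}"
          using v a z zB by (auto simp: supp_def a_def split: if_splits)
        show "sum_over (blk x) (delta z a) \<in> M" for x
          using a aM zB subgroup.one_closed[OF M] by (simp add: sum_over_delta)
      qed
    qed
  qed
qed

lemma diff_group_hom: "b \<in> carrier B \<Longrightarrow> group_hom V V (diff b)"
  by unfold_locales (auto simp: hom_def diff_def tr_mult V.inv_mult V.m_ac)

lemma diff_closed [simp]: "b \<in> carrier B \<Longrightarrow> v \<in> carrier V \<Longrightarrow> diff b v \<in> carrier V"
  by (simp add: diff_def)

lemma diff_mult:
  "b \<in> carrier B \<Longrightarrow> u \<in> carrier V \<Longrightarrow> v \<in> carrier V \<Longrightarrow> diff b (u \<otimes>\<^bsub>V\<^esub> v) = diff b u \<otimes>\<^bsub>V\<^esub> diff b v"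
  by (rule group_hom.hom_mult[OF diff_group_hom])

lemma diff_inv:
  "b \<in> carrier B \<Longrightarrow> v \<in> carrier V \<Longrightarrow> diff b (inv\<^bsub>V\<^esub> v) = inv\<^bsub>V\<^esub> (diff b v)"
  by (rule group_hom.hom_inv[OF diff_group_hom])

lemma tr_diff:
  "b \<in> carrier B \<Longrightarrow> c \<in> carrier B \<Longrightarrow> c \<otimes> b = b \<otimes> c \<Longrightarrow> v \<in> carrier V \<Longrightarrow>
    tr c (diff b v) = diff b (tr c v)"
  by (simp add: diff_def tr_mult tr_inv tr_tr)

lemma sum_over_diff:
  assumes "b \<in> carrier B" "v \<in> carrier V" "{z \<in> carrier B. b \<otimes> z \<in> S} = S \<inter> carrier B"
  shows "sum_over S (diff b v) = \<one>\<^bsub>A\<^esub>"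
proof -
  have "sum_over S (tr b v) = sum_over S v"
    unfolding sum_over_tr[OF assms(1,2)] assms(3)
    by (rule sum_over_cong) (auto simp: supp_def)
  then show ?thesis using assms by (simp add: diff_def)
qed

lemma power_base_mult:
  assumes "b \<in> carrier B" "u \<in> carrier V" "v \<in> carrier V"
  shows "power_base (u \<otimes>\<^bsub>V\<^esub> v) b i = power_base u b i \<otimes>\<^bsub>V\<^esub> power_base v b i"
  by (induction i) (use assms in \<open>simp_all add: power_base_Suc tr_mult V.m_ac\<close>)

text \<open>Telescoping: 1 - b times 1 + b + ... + b^(i-1) is 1 - b^i.\<close>

lemma diff_power_base:
  assumes "b \<in> carrier B" "v \<in> carrier V"
  shows "diff b (power_base v b i) = v \<otimes>\<^bsub>V\<^esub> inv\<^bsub>V\<^esub> (tr (b [^] i) v)"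
proof (induction i)
  case 0
  then show ?case using assms by (simp add: diff_def)
next
  case (Suc i)
  define u where "u = tr (b [^] i) v"
  have u: "u \<in> carrier V" using assms by (simp add: u_def)
  have "tr (b [^] Suc i) v = tr b u"
    unfolding u_def B.nat_pow_Suc2[OF assms(1)] using assms by (simp add: tr_tr)
  then have "diff b u = u \<otimes>\<^bsub>V\<^esub> inv\<^bsub>V\<^esub> (tr (b [^] Suc i) v)" by (simp add: diff_def)
  then have "diff b (power_base v b (Suc i)) =
      v \<otimes>\<^bsub>V\<^esub> inv\<^bsub>V\<^esub> u \<otimes>\<^bsub>V\<^esub> (u \<otimes>\<^bsub>V\<^esub> inv\<^bsub>V\<^esub> (tr (b [^] Suc i) v))"
    using assms Suc u by (simp add: power_base_Suc diff_mult u_def[symmetric] del: B.nat_pow_Suc)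
  then show ?case
    using assms u by (simp add: V.group_simps del: B.nat_pow_Suc)
qed

text \<open>Two points of one cycle are joined by a telescoping norm. Norms have natural length, so
  for negative \<open>i\<close> the norm starts at the other point and is inverted.\<close>

lemma delta_quotient_in_diff:
  fixes i :: int
  assumes b: "b \<in> carrier B" and z: "z \<in> carrier B" and a: "a \<in> carrier A"
  shows "delta z a \<otimes>\<^bsub>V\<^esub> inv\<^bsub>V\<^esub> (delta (b [^] i \<otimes> z) a) \<in> diff b ` carrier V"
proof (cases i rule: int_cases2)
  case (nonneg n)
  then have "delta z a \<otimes>\<^bsub>V\<^esub> inv\<^bsub>V\<^esub> (delta (b [^] i \<otimes> z) a) = diff b (power_base (delta z a) b n)"
    using assms by (simp add: diff_power_base tr_delta int_pow_int)
  then show ?thesis using assms by simp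
next
  case (nonpos n)
  define y where "y = b [^] i \<otimes> z"
  have y: "y \<in> carrier B" using b z by (simp add: y_def)
  have "b [^] n \<otimes> y = z"
    unfolding y_def nonpos using b z by (simp add: B.int_pow_neg_int B.group_simps)
  then have "diff b (power_base (delta y a) b n) = delta y a \<otimes>\<^bsub>V\<^esub> inv\<^bsub>V\<^esub> (delta z a)"
    using b y a by (simp add: diff_power_base tr_delta)
  then have "delta z a \<otimes>\<^bsub>V\<^esub> inv\<^bsub>V\<^esub> (delta y a) = diff b (inv\<^bsub>V\<^esub> (power_base (delta y a) b n))"
    using b y a by (simp add: diff_inv V.inv_mult V.m_comm)
  then show ?thesis using b y a by (simp add: y_def[symmetric])
qed

text \<open>As \<open>b\<close> acts by left multiplication, its cycles are right cosets of the
  subgroup it generates.\<close>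

abbreviation cyc :: "'b \<Rightarrow> 'b \<Rightarrow> 'b set" where
  "cyc b z \<equiv> generate B {b} #> z"

lemma subgroup_cyclic: "b \<in> carrier B \<Longrightarrow> subgroup (generate B {b}) B"
  by (simp add: B.generate_is_subgroup)

lemma cyc_subset: "b \<in> carrier B \<Longrightarrow> z \<in> carrier B \<Longrightarrow> cyc b z \<subseteq> carrier B"
  by (meson B.r_coset_subset_G subgroup.subset subgroup_cyclic)

lemma mem_cyc: "b \<in> carrier B \<Longrightarrow> y \<in> cyc b z \<longleftrightarrow> (\<exists>i::int. y = b [^] i \<otimes> z)"
  by (auto simp: r_coset_def B.generate_pow)

text \<open>The coinvariants of a permutation module: \<open>V\<close> modulo the image of 1 - b is
  a direct sum of copies of \<open>A\<close>, one for each cycle, and the sums over cycles are its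
  coordinates.\<close>

lemma sums_over_cycles_imp_diff:
  assumes b: "b \<in> carrier B" and v: "v \<in> carrier V"
    and sums: "\<And>z. z \<in> carrier B \<Longrightarrow> sum_over (cyc b z) v = \<one>\<^bsub>A\<^esub>"
  shows "v \<in> diff b ` carrier V"
proof (rule block_sums_imp_mem[of _ "{\<one>\<^bsub>A\<^esub>}" "cyc b"])
  interpret h: group_hom V V "diff b" by (rule diff_group_hom[OF b])
  show Y: "subgroup (diff b ` carrier V) V" by (rule h.img_is_subgroup)
  show "subgroup {\<one>\<^bsub>A\<^esub>} A" by (rule A.triv_subgroup)
  show "z \<in> cyc b z" if "z \<in> carrier B" for z
    by (rule B.rcos_self[OF that subgroup_cyclic[OF b]])
  show "z' \<in> carrier B \<and> cyc b z' = cyc b z" if "z \<in> carrier B" "z' \<in> cyc b z" for z z'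
    using cyc_subset[OF b that(1)] that B.repr_independence[OF that(2,1) subgroup_cyclic[OF b]] by auto
  show "delta z a \<otimes>\<^bsub>V\<^esub> inv\<^bsub>V\<^esub> (delta z' a) \<in> diff b ` carrier V"
    if "z \<in> carrier B" "z' \<in> cyc b z" "a \<in> carrier A" for z z' a
    using that delta_quotient_in_diff[OF b] by (auto simp: mem_cyc[OF b])
  show "delta z a \<in> diff b ` carrier V" if "a \<in> {\<one>\<^bsub>A\<^esub>}" for z a
    using that subgroup.one_closed[OF Y] by simp
qed (use v sums in simp_all)

lemma coset_translate:
  assumes K: "K \<lhd> B" and b: "b \<in> carrier B" and u: "u \<in> carrier B"
  shows "{z \<in> carrier B. b \<otimes> z \<in> K #> (b \<otimes> u)} = K #> u"
proof -
  interpret K: normal K B by fact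
  show ?thesis
  proof
    show "{z \<in> carrier B. b \<otimes> z \<in> K #> (b \<otimes> u)} \<subseteq> K #> u"
    proof
      fix z assume z: "z \<in> {z \<in> carrier B. b \<otimes> z \<in> K #> (b \<otimes> u)}"
      then obtain k where k: "k \<in> K" "b \<otimes> z = k \<otimes> (b \<otimes> u)" by (auto simp: r_coset_def)
      have "z = inv b \<otimes> (b \<otimes> z)" using z b by (simp add: B.group_simps)
      also have "\<dots> = (inv b \<otimes> k \<otimes> b) \<otimes> u" unfolding k(2) using k(1) b u by (simp add: B.group_simps)
      finally show "z \<in> K #> u"
        using K.inv_op_closed1[OF b k(1)] by (auto simp: r_coset_def)
    qed
    show "K #> u \<subseteq> {z \<in> carrier B. b \<otimes> z \<in> K #> (b \<otimes> u)}"
    proof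
      fix z assume "z \<in> K #> u"
      then obtain k where k: "k \<in> K" "z = k \<otimes> u" by (auto simp: r_coset_def)
      have "b \<otimes> z = (b \<otimes> k \<otimes> inv b) \<otimes> (b \<otimes> u)"
        using k b u by (simp add: B.group_simps)
      then show "z \<in> {z \<in> carrier B. b \<otimes> z \<in> K #> (b \<otimes> u)}"
        using K.inv_op_closed2[OF b k(1)] k b u by (auto simp: r_coset_def)
    qed
  qed
qed

text \<open>Shows that the first \<open>q\<close> translates of a point lie in distinct cosets of
  \<open>K\<close> when \<open>q\<close> is the least positive exponent with \<open>b [^] q\<close>
  in \<open>K\<close>.\<close>

lemma coset_power_unique:
  fixes i j :: nat
  assumes K: "K \<lhd> B" and b: "b \<in> carrier B" and y: "y \<in> carrier B" and z: "z \<in> carrier B"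
    and ij: "i \<le> j" and mem: "b [^] i \<otimes> y \<in> K #> z" "b [^] j \<otimes> y \<in> K #> z"
  shows "b [^] (j - i) \<in> K"
proof -
  interpret K: normal K B by fact
  obtain k k' where k: "k \<in> K" "k' \<in> K" "b [^] i \<otimes> y = k \<otimes> z" "b [^] j \<otimes> y = k' \<otimes> z"
    using mem by (auto simp: r_coset_def)
  have bj: "b [^] j = b [^] (j - i) \<otimes> b [^] i" using ij b by (simp add: B.nat_pow_mult)
  have "b [^] (j - i) = (b [^] j \<otimes> y) \<otimes> inv (b [^] i \<otimes> y)"
    unfolding bj using b y by (simp add: B.group_simps)
  also have "\<dots> = k' \<otimes> inv k"
    unfolding k using k(1,2) z by (simp add: B.group_simps)
  also have "\<dots> \<in> K" using k by simp
  finally show ?thesis .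
qed

text \<open>Modulo \<open>K\<close> and \<open>M\<close> this says that the Tate cohomology group in degree 0 of the cyclic group
  generated by \<open>b\<close> with coefficients in the base group vanishes.\<close>

lemma invariant_imp_norm:
  fixes q :: nat
  assumes K: "K \<lhd> B" and M: "subgroup M A" and b: "b \<in> carrier B"
    and q: "q > 0" "b [^] q \<in> K" "\<And>j. 0 < j \<Longrightarrow> j < q \<Longrightarrow> b [^] j \<notin> K"
    and w: "w \<in> carrier V"
    and inv: "\<And>y. y \<in> carrier B \<Longrightarrow> sum_over (K #> y) (diff b w) \<in> M"
  shows "\<exists>w'\<in>carrier V. \<forall>y\<in>carrier B. sum_over (K #> y) (w \<otimes>\<^bsub>V\<^esub> inv\<^bsub>V\<^esub> (power_base w' b q)) \<in> M"
  using w inv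
proof (induction "card {Y \<in> (\<lambda>y. K #> y) ` carrier B. sum_over Y w \<notin> M}" arbitrary: w rule: less_induct)
  case less
  note w = less.prems(1) and inv = less.prems(2)
  interpret K: normal K B by fact
  have MA: "m \<in> carrier A" if "m \<in> M" for m using that subgroup.subset[OF M] by blast
  \<comment> \<open>The measure of the induction. Only cosets meeting the support can be bad, since
    an empty sum lies in \<open>M\<close>.\<close>
  define Bad where "Bad v = {Y \<in> (\<lambda>y. K #> y) ` carrier B. sum_over Y v \<notin> M}" for v
  have finBad: "finite (Bad w)"
  proof (rule finite_subset)
    show "finite ((\<lambda>y. K #> y) ` supp w)" using finite_supp[OF w] by simp
    show "Bad w \<subseteq> (\<lambda>y. K #> y) ` supp w"
    proof
      fix Y assume "Y \<in> Bad w"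
      then obtain y where y: "y \<in> carrier B" "Y = K #> y" "sum_over Y w \<notin> M" by (auto simp: Bad_def)
      have "Y \<inter> supp w \<noteq> {}"
        using y(3) subgroup.one_closed[OF M] by (auto simp: sum_over_def)
      then obtain x where x: "x \<in> Y" "x \<in> supp w" by blast
      then have "Y = K #> x" using B.repr_independence[OF _ y(1) K.is_subgroup] y(2) by blast
      then show "Y \<in> (\<lambda>y. K #> y) ` supp w" using x by blast
    qed
  qed
  show ?case
  proof (cases "Bad w = {}")
    case True
    then have "\<forall>y\<in>carrier B. sum_over (K #> y) (w \<otimes>\<^bsub>V\<^esub> inv\<^bsub>V\<^esub> (power_base \<one>\<^bsub>V\<^esub> b q)) \<in> M"
    proof -
      have "power_base \<one>\<^bsub>V\<^esub> b i = \<one>\<^bsub>V\<^esub>" for i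
        by (induction i) (use b in \<open>simp_all add: power_base_Suc\<close>)
      then show ?thesis using True w by (auto simp: Bad_def)
    qed
    then show ?thesis by blast
  next
    case False
    then obtain y where y: "y \<in> carrier B" "sum_over (K #> y) w \<notin> M" by (auto simp: Bad_def)
    define a where "a = sum_over (K #> y) w"
    have a: "a \<in> carrier A" using w by (simp add: a_def)
    have bi: "b [^] i \<otimes> y \<in> carrier B" for i :: nat using b y by simp
    define p where "p i = power_base (delta y a) b i" for i
    have p: "p i \<in> carrier V" for i using a b by (simp add: p_def)
    \<comment> \<open>The norm of \<open>delta y a\<close> puts \<open>a\<close> on the cosets
      through the first \<open>q\<close> translates of \<open>y\<close>; minimality of
      \<open>q\<close> prevents a coset from receiving \<open>a\<close> twice.\<close>
    have sp: "sum_over (K #> z) (p j) = (if \<exists>i<j. b [^] i \<otimes> y \<in> K #> z then a else \<one>\<^bsub>A\<^esub>)"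
      if z: "z \<in> carrier B" and j: "j \<le> q" for z j
      using j
    proof (induction j)
      case 0
      then show ?case by (simp add: p_def)
    next
      case (Suc j)
      have *: "sum_over (K #> z) (p (Suc j)) = sum_over (K #> z) (p j) \<otimes>\<^bsub>A\<^esub>
          (if b [^] j \<otimes> y \<in> K #> z then a else \<one>\<^bsub>A\<^esub>)"
        using a b y p[of j] by (simp add: p_def power_base_Suc tr_delta sum_over_delta)
      have "\<not> (b [^] i \<otimes> y \<in> K #> z \<and> b [^] j \<otimes> y \<in> K #> z)" if "i < j" for i
        using coset_power_unique[OF K b y(1) z, of i j] q(3)[of "j - i"] that Suc.prems by auto
      then show ?case
        using * Suc a by (auto simp: less_Suc_eq)
    qed
    define w1 where "w1 = w \<otimes>\<^bsub>V\<^esub> inv\<^bsub>V\<^esub> (p q)"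
    have w1: "w1 \<in> carrier V" using w p by (simp add: w1_def)
    \<comment> \<open>Invariance modulo \<open>M\<close> makes the sums of \<open>w\<close> on
      neighbouring cosets congruent, so subtracting a single norm repairs all cosets of the cycle
      together.\<close>
    have cong: "sum_over (K #> (b [^] i \<otimes> y)) w \<otimes>\<^bsub>A\<^esub> inv\<^bsub>A\<^esub> a \<in> M" for i :: nat
    proof (induction i)
      case 0
      then show ?case using y a subgroup.one_closed[OF M] by (simp add: a_def)
    next
      case (Suc i)
      define u where "u = b [^] i \<otimes> y"
      have u: "u \<in> carrier B" using bi by (simp add: u_def)
      have bu: "b [^] Suc i \<otimes> y = b \<otimes> u"
        unfolding u_def B.nat_pow_Suc2[OF b] using b y by (simp add: B.m_assoc)
      have "sum_over (K #> (b \<otimes> u)) (diff b w) =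
          sum_over (K #> (b \<otimes> u)) w \<otimes>\<^bsub>A\<^esub> inv\<^bsub>A\<^esub> (sum_over (K #> u) w)"
        using b w by (simp add: diff_def sum_over_tr coset_translate[OF K b u])
      then have "sum_over (K #> (b \<otimes> u)) w \<otimes>\<^bsub>A\<^esub> inv\<^bsub>A\<^esub> (sum_over (K #> u) w) \<in> M"
        using inv[of "b \<otimes> u"] b u by simp
      from subgroup.m_closed[OF M this Suc[folded u_def]]
      show ?case unfolding bu using a w by (simp add: A.group_simps)
    qed
    have good: "sum_over (K #> z) w1 \<in> M"
      if z: "z \<in> carrier B" and i: "i < q" "b [^] i \<otimes> y \<in> K #> z" for z i
    proof -
      have "K #> z = K #> (b [^] i \<otimes> y)"
        by (rule B.repr_independence[OF i(2) z K.is_subgroup])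
      moreover have "sum_over (K #> z) (p q) = a" using sp[OF z, of q] i by auto
      ultimately show ?thesis using cong[of i] w p by (simp add: w1_def)
    qed
    have "Bad w1 \<subseteq> Bad w - {K #> y}"
    proof
      fix Y assume "Y \<in> Bad w1"
      then obtain z where z: "z \<in> carrier B" "Y = K #> z" "sum_over Y w1 \<notin> M" by (auto simp: Bad_def)
      have no: "\<not> (\<exists>i<q. b [^] i \<otimes> y \<in> K #> z)" using good z by blast
      have "sum_over Y (p q) = \<one>\<^bsub>A\<^esub>"
        using sp[OF z(1) order_refl] unfolding if_not_P[OF no] z(2) .
      then have "sum_over Y w1 = sum_over Y w"
        using w p by (simp add: w1_def)
      moreover have "Y \<noteq> K #> y"
        using no q(1) B.rcos_self[OF y(1) K.is_subgroup] z(2) y(1) by (metis B.nat_pow_0 B.l_one)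
      ultimately show "Y \<in> Bad w - {K #> y}" using z by (auto simp: Bad_def)
    qed
    moreover have "K #> y \<in> Bad w" using y by (simp add: Bad_def)
    ultimately have "card (Bad w1) < card (Bad w)"
      using finBad by (intro psubset_card_mono) auto
    \<comment> \<open>\<open>diff b (p q)\<close> is \<open>delta y a\<close> minus its translate by
      \<open>b [^] q\<close>. Both points lie in the same coset because \<open>b [^] q\<close> is in
      \<open>K\<close>, so \<open>w1\<close> is again invariant modulo \<open>M\<close>.\<close>
    moreover have "sum_over (K #> z) (diff b w1) \<in> M" if z: "z \<in> carrier B" for z
    proof -
      have "b [^] q \<otimes> y \<in> K #> y" using q(2) by (auto simp: r_coset_def)
      then have "K #> y = K #> (b [^] q \<otimes> y)"
        by (rule B.repr_independence[OF _ y(1) K.is_subgroup])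
      then have "y \<in> K #> z \<longleftrightarrow> b [^] q \<otimes> y \<in> K #> z"
        using B.repr_independence[OF _ z K.is_subgroup] B.rcos_self[OF _ K.is_subgroup] y(1) bi by metis
      then have "sum_over (K #> z) (diff b (p q)) = \<one>\<^bsub>A\<^esub>"
        using a b y bi by (simp add: p_def diff_power_base tr_delta sum_over_delta)
      then show ?thesis
        using inv[OF z] w p b by (simp add: w1_def diff_mult diff_inv)
    qed
    ultimately obtain w' where w': "w' \<in> carrier V"
      "\<forall>y\<in>carrier B. sum_over (K #> y) (w1 \<otimes>\<^bsub>V\<^esub> inv\<^bsub>V\<^esub> (power_base w' b q)) \<in> M"
      using less.hyps[OF _ w1] unfolding Bad_def by blast
    have "w1 \<otimes>\<^bsub>V\<^esub> inv\<^bsub>V\<^esub> (power_base w' b q) =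
        w \<otimes>\<^bsub>V\<^esub> inv\<^bsub>V\<^esub> (power_base (delta y a \<otimes>\<^bsub>V\<^esub> w') b q)"
      using w w' a b by (simp add: w1_def p_def power_base_mult V.inv_mult V.m_ac)
    then show ?thesis
      using w' a by (intro bexI[of _ "delta y a \<otimes>\<^bsub>V\<^esub> w'"]) simp_all
  qed
qed

end


section \<open>Open subgroups over an abelian base, and necessity of separable cyclic
  subgroups\<close>

locale comm_pro_wreath = pro_wreath A B \<C> + comm_wreath A B
  for A :: "('a, 'm) monoid_scheme" and B :: "('b, 'n) monoid_scheme" (structure) and \<C>
begin

definition base :: "(('b \<Rightarrow> 'a) \<times> 'b) set \<Rightarrow> ('b \<Rightarrow> 'a) set" where
  "base L = {v \<in> carrier V. (v, \<one>) \<in> L}"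

definition top_part :: "(('b \<Rightarrow> 'a) \<times> 'b) set \<Rightarrow> 'b set" where
  "top_part L = {k \<in> carrier B. (\<one>\<^bsub>V\<^esub>, k) \<in> L}"

lemma base_subgroup: "L \<in> co_normal_subgroups \<C> W \<Longrightarrow> subgroup (base L) V"
  unfolding base_def by (rule co_normalD(3)[OF co_normal_vimage[OF V.group_axioms base_hom]])

lemma base_closed: "v \<in> base L \<Longrightarrow> v \<in> carrier V"
  by (simp add: base_def)

lemma base_mult: "L \<in> co_normal_subgroups \<C> W \<Longrightarrow> u \<in> base L \<Longrightarrow> v \<in> base L \<Longrightarrow> u \<otimes>\<^bsub>V\<^esub> v \<in> base L"
  by (rule subgroup.m_closed[OF base_subgroup])

lemma base_inv: "L \<in> co_normal_subgroups \<C> W \<Longrightarrow> v \<in> base L \<Longrightarrow> inv\<^bsub>V\<^esub> v \<in> base L"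
  by (rule subgroup.m_inv_closed[OF base_subgroup])

lemma base_mono: "L \<subseteq> L' \<Longrightarrow> base L \<subseteq> base L'"
  by (auto simp: base_def)

lemma top_part_co_normal: "L \<in> co_normal_subgroups \<C> W \<Longrightarrow> top_part L \<in> co_normal_subgroups \<C> B"
  unfolding top_part_def by (rule co_normal_vimage[OF B.group_axioms top_hom])

lemma base_tr:
  assumes L: "L \<in> co_normal_subgroups \<C> W" and v: "v \<in> base L" and b: "b \<in> carrier B"
  shows "tr b v \<in> base L"
proof -
  have "(\<one>\<^bsub>V\<^esub>, b) \<otimes>\<^bsub>W\<^esub> (v, \<one>) \<otimes>\<^bsub>W\<^esub> inv\<^bsub>W\<^esub> (\<one>\<^bsub>V\<^esub>, b) \<in> L"
    by (rule normal.inv_op_closed2[OF co_normalD(1)[OF L]]) (use v b in \<open>simp_all add: base_def carrier_W\<close>)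
  then show ?thesis
    unfolding W_conj_base[OF base_closed[OF v] b] using base_closed[OF v] b by (simp add: base_def)
qed

text \<open>This is the commutator of \<open>k\<close> and \<open>v\<close>, and \<open>L\<close> is
  normal. Hence \<open>top_part L\<close> acts trivially on \<open>V\<close> modulo
  \<open>base L\<close>.\<close>

lemma base_top:
  assumes L: "L \<in> co_normal_subgroups \<C> W" and k: "k \<in> top_part L" and v: "v \<in> carrier V"
  shows "tr k v \<otimes>\<^bsub>V\<^esub> inv\<^bsub>V\<^esub> v \<in> base L"
proof -
  note L' = co_normalD[OF L]
  have kB: "k \<in> carrier B" "(\<one>\<^bsub>V\<^esub>, k) \<in> L" using k by (auto simp: top_part_def)
  have vW: "(v, \<one>) \<in> carrier W" using v by (simp add: carrier_W)
  have "(v, \<one>) \<otimes>\<^bsub>W\<^esub> inv\<^bsub>W\<^esub> (\<one>\<^bsub>V\<^esub>, k) \<otimes>\<^bsub>W\<^esub> inv\<^bsub>W\<^esub> (v, \<one>) \<in> L"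
    by (rule normal.inv_op_closed2[OF L'(1) vW subgroup.m_inv_closed[OF L'(3) kB(2)]])
  from subgroup.m_closed[OF L'(3) kB(2) this]
  show ?thesis
    using v kB by (simp add: base_def W_inv tr_mult tr_tr tr_inv)
qed

lemma W_mult_base: "f \<in> carrier V \<Longrightarrow> b \<in> carrier B \<Longrightarrow> v \<in> carrier V \<Longrightarrow>
    (f, b) \<otimes>\<^bsub>W\<^esub> (tr (inv b) v, \<one>) = (f \<otimes>\<^bsub>V\<^esub> v, b)"
  by (simp add: tr_tr)

lemma W_conj_centralizer:
  assumes "n \<in> carrier V" "c \<in> carrier B" "f \<in> carrier V" "b \<in> carrier B" "c \<otimes> b = b \<otimes> c"
  shows "(n, c) \<otimes>\<^bsub>W\<^esub> (f, b) \<otimes>\<^bsub>W\<^esub> inv\<^bsub>W\<^esub> (n, c) = (tr c f \<otimes>\<^bsub>V\<^esub> diff b n, b)"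
proof -
  have "c \<otimes> b \<otimes> inv c = b" using assms by (simp add: B.m_assoc)
  then show ?thesis
    unfolding W_conj[OF assms(1,3,2,4)] using assms by (simp add: diff_def V.m_ac)
qed

lemma power_base_mem:
  assumes N: "N \<in> co_normal_subgroups \<C> W" and v: "v \<in> carrier V" and b: "b \<in> carrier B"
    and j: "order (W Mod N) dvd j"
  shows "b [^] j \<in> top_part N" "power_base v b j \<in> base N"
proof -
  note N' = co_normalD[OF N]
  have one: "power_base \<one>\<^bsub>V\<^esub> b i = \<one>\<^bsub>V\<^esub>" for i
    by (induction i) (use b in \<open>simp_all add: power_base_Suc\<close>)
  have vb: "(power_base v b j, b [^] j) \<in> N"
    using pow_order_quotient_mem[OF N _ j, of "(v, b)"] v b by (simp add: carrier_W W_pow)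
  have ob: "(\<one>\<^bsub>V\<^esub>, b [^] j) \<in> N"
    using pow_order_quotient_mem[OF N _ j, of "(\<one>\<^bsub>V\<^esub>, b)"] b by (simp add: carrier_W W_pow one)
  then show "b [^] j \<in> top_part N" using b by (simp add: top_part_def)
  from subgroup.m_closed[OF N'(3) vb subgroup.m_inv_closed[OF N'(3) ob]]
  show "power_base v b j \<in> base N"
    using v b by (simp add: base_def W_inv)
qed

text \<open>Summation over \<open>S\<close> becomes a homomorphism on the open subgroup
  \<open>P\<close> of elements with top component in \<open>K\<close>, because \<open>K\<close>
  permutes \<open>S\<close>. Its preimage of \<open>M\<close> is open in \<open>P\<close>, and
  transitivity yields an \<open>L\<close> in \<open>W\<close>.\<close>

lemma sum_over_open:
  assumes K: "K \<in> co_normal_subgroups \<C> B" and M: "M \<in> co_normal_subgroups \<C> A"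
    and S: "S \<subseteq> carrier B" "\<forall>k\<in>K. \<forall>y\<in>S. k \<otimes> y \<in> S"
  shows "\<exists>L\<in>co_normal_subgroups \<C> W. top_part L \<subseteq> K \<and> (\<forall>v\<in>base L. sum_over S v \<in> M)"
proof -
  note K' = co_normalD[OF K]
  define P where "P = {x \<in> carrier W. snd x \<in> K}"
  have P: "P \<in> co_normal_subgroups \<C> W" unfolding P_def by (rule vimage_snd_co_normal[OF K])
  have gP: "group (W\<lparr>carrier := P\<rparr>)"
    using W.subgroup_imp_group[OF co_normalD(3)[OF P]] .
  have S_eq: "{z \<in> carrier B. k \<otimes> z \<in> S} = S" if k: "k \<in> K" for k
  proof -
    have kB: "k \<in> carrier B" using k K'(4) by blast
    have "z \<in> S" if "z \<in> carrier B" "k \<otimes> z \<in> S" for z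
      using bspec[OF bspec[OF S(2) subgroup.m_inv_closed[OF K'(3) k]] that(2)] kB that(1)
      by (simp add: B.group_simps)
    then show ?thesis using S k by blast
  qed
  have "(\<lambda>p. sum_over S (fst p)) \<in> hom (W\<lparr>carrier := P\<rparr>) A"
    using K'(4) by (auto simp: hom_def P_def carrier_W sum_over_tr S_eq)
  from co_normal_vimage[OF gP this M]
  have "{p \<in> P. sum_over S (fst p) \<in> M} \<in> co_normal_subgroups \<C> (W\<lparr>carrier := P\<rparr>)" by simp
  from co_normal_trans[OF P this] obtain L where L: "L \<in> co_normal_subgroups \<C> W"
    "L \<subseteq> {p \<in> P. sum_over S (fst p) \<in> M}" by blast
  show ?thesis
    by (rule bexI[OF _ L(1)]) (use L(2) in \<open>auto simp: top_part_def base_def P_def\<close>)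
qed

lemma separable_cyclic:
  assumes cs: "conjugacy_separable \<C> W" and A: "carrier A \<noteq> {\<one>\<^bsub>A\<^esub>}" and b: "b \<in> carrier B"
  shows "separable_in \<C> B (generate B {b})"
  unfolding separable_in_iff_adherent[OF B.group_axioms]
proof (intro conjI ballI impI)
  let ?G = "generate B {b}"
  have sub: "subgroup ?G B" by (rule subgroup_cyclic[OF b])
  show "?G \<subseteq> carrier B" by (rule subgroup.subset[OF sub])
  have bG: "b \<in> ?G" by (rule generate.incl) simp
  fix x assume x: "x \<in> carrier B" and adh: "adherent B ?G x"
  show "x \<in> ?G"
  proof (rule ccontr)
    assume nx: "x \<notin> ?G"
    obtain a where a: "a \<in> carrier A" "a \<noteq> \<one>\<^bsub>A\<^esub>" using A A.one_closed by blast
    define d where "d = delta \<one> a"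
    have d: "d \<in> carrier V" using a by (simp add: d_def)
    define f where "f = d \<otimes>\<^bsub>V\<^esub> inv\<^bsub>V\<^esub> (delta x a)"
    have f: "f \<in> carrier V" using a d by (simp add: f_def)
    have nclass: "(f, b) \<notin> conjugacy_class W (\<one>\<^bsub>V\<^esub>, b)"
    proof
      assume "(f, b) \<in> conjugacy_class W (\<one>\<^bsub>V\<^esub>, b)"
      then obtain g c where gc: "g \<in> carrier V" "c \<in> carrier B"
        "(f, b) = (g, c) \<otimes>\<^bsub>W\<^esub> (\<one>\<^bsub>V\<^esub>, b) \<otimes>\<^bsub>W\<^esub> inv\<^bsub>W\<^esub> (g, c)"
        unfolding conjugacy_class_def carrier_W by blast
      have "(f, b) = (g \<otimes>\<^bsub>V\<^esub> inv\<^bsub>V\<^esub> (tr (c \<otimes> b \<otimes> inv c) g), c \<otimes> b \<otimes> inv c)"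
        using gc(3) W_conj[OF gc(1) V.one_closed gc(2) b] gc b by simp
      then have "f = diff b g" by (auto simp: diff_def)
      \<comment> \<open>Sums over the subgroup generated by \<open>b\<close> vanish on the image of
        \<open>diff b\<close> by invariance, whereas only one of the two support points of
        \<open>f\<close> lies in that subgroup.\<close>
      moreover have "{z \<in> carrier B. b \<otimes> z \<in> ?G} = ?G \<inter> carrier B"
      proof -
        have "z \<in> ?G" if "z \<in> carrier B" "b \<otimes> z \<in> ?G" for z
          using subgroup.m_closed[OF sub subgroup.m_inv_closed[OF sub bG] that(2)] that(1) b
          by (simp add: B.group_simps)
        then show ?thesis using subgroup.m_closed[OF sub bG] by blast
      qed
      ultimately have "sum_over ?G f = \<one>\<^bsub>A\<^esub>" using sum_over_diff[OF b gc(1)] by simp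
      moreover have "sum_over ?G f = a"
        using a x nx d subgroup.one_closed[OF sub] by (simp add: f_def d_def sum_over_delta)
      ultimately show False using a by simp
    qed
    have ob: "(\<one>\<^bsub>V\<^esub>, b) \<in> carrier W" "(f, b) \<in> carrier W" using b f by (simp_all add: carrier_W)
    have "separable_in \<C> W (conjugacy_class W (\<one>\<^bsub>V\<^esub>, b))"
      using cs ob by (simp add: conjugacy_separable_def)
    then obtain N where N: "N \<in> co_normal_subgroups \<C> W"
      "\<And>n. n \<in> N \<Longrightarrow> (f, b) \<otimes>\<^bsub>W\<^esub> n \<notin> conjugacy_class W (\<one>\<^bsub>V\<^esub>, b)"
      using separable_avoid[OF W.group_axioms _ ob(2) nclass] by blast
    have top: "top_part N \<in> co_normal_subgroups \<C> B" by (rule top_part_co_normal[OF N(1)])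
    obtain k where k: "k \<in> top_part N" "x \<otimes> k \<in> ?G"
      using adh top by (auto simp: adherent_def)
    then obtain i :: int where i: "x \<otimes> k = b [^] i" using B.generate_pow[OF b] by auto
    have kB: "k \<in> carrier B" using k by (simp add: top_part_def)
    have k': "inv k \<in> top_part N"
      using subgroup.m_inv_closed[OF co_normalD(3)[OF top] k(1)] .
    \<comment> \<open>A correction in \<open>base N\<close> that replaces the support point
      \<open>x\<close> by \<open>b [^] i\<close>, which is close to it. What remains is a difference
      of two points of one cycle, hence in the image of \<open>diff b\<close>.\<close>
    define l where "l = tr (b [^] i) (tr (inv k) d \<otimes>\<^bsub>V\<^esub> inv\<^bsub>V\<^esub> d)"
    have l: "l \<in> base N"
      unfolding l_def using base_tr[OF N(1) base_top[OF N(1) k' d]] b by simp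
    have "b [^] i \<otimes> inv k = x" using i[symmetric] x kB by (simp add: B.group_simps)
    then have "l = delta x a \<otimes>\<^bsub>V\<^esub> inv\<^bsub>V\<^esub> (delta (b [^] i \<otimes> \<one>) a)"
      unfolding l_def d_def using a b kB by (simp add: tr_mult tr_inv tr_delta)
    then have "f \<otimes>\<^bsub>V\<^esub> l = d \<otimes>\<^bsub>V\<^esub> inv\<^bsub>V\<^esub> (delta (b [^] i \<otimes> \<one>) a)"
      using a d by (simp add: f_def V.group_simps)
    then obtain u where u: "u \<in> carrier V" "f \<otimes>\<^bsub>V\<^esub> l = diff b u"
      using delta_quotient_in_diff[OF b B.one_closed a(1), of i] by (auto simp: d_def)
    have "(f, b) \<otimes>\<^bsub>W\<^esub> (tr (inv b) l, \<one>) = (u, \<one>) \<otimes>\<^bsub>W\<^esub> (\<one>\<^bsub>V\<^esub>, b) \<otimes>\<^bsub>W\<^esub> inv\<^bsub>W\<^esub> (u, \<one>)"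
      unfolding W_mult_base[OF f b base_closed[OF l]] u(2)
      using W_conj_centralizer[OF u(1) B.one_closed V.one_closed b] u(1) b by simp
    moreover have "(u, \<one>) \<in> carrier W" using u by (simp add: carrier_W)
    ultimately have "(f, b) \<otimes>\<^bsub>W\<^esub> (tr (inv b) l, \<one>) \<in> conjugacy_class W (\<one>\<^bsub>V\<^esub>, b)"
      unfolding conjugacy_class_def by blast
    moreover have "(tr (inv b) l, \<one>) \<in> N"
      using base_tr[OF N(1) l B.inv_closed[OF b]] by (simp add: base_def)
    ultimately show False using N(2) by blast
  qed
qed

end


section \<open>Closedness of the image of \<open>diff b\<close>\<close>

locale separating_wreath = comm_pro_wreath A B \<C>
  for A :: "('a, 'm) monoid_scheme" and B :: "('b, 'n) monoid_scheme" (structure) and \<C> +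
  assumes residually: "residually \<C> A"
    and cyclic: "\<And>b. b \<in> carrier B \<Longrightarrow> separable_in \<C> B (generate B {b})"
begin

lemma residually_top: "residually \<C> B"
  using cyclic[OF B.one_closed] by (simp add: residually_def B.generate_one)

text \<open>For \<open>b\<close> of infinite order, the powers with exponent strictly between 0 and
  \<open>m\<close> lie outside the closed subgroup generated by \<open>b [^] m\<close>, and one
  \<open>K'\<close> keeps all of them away from it. For finite order, \<open>K'\<close> avoids the
  finitely many nontrivial powers.\<close>

lemma powers_avoiding:
  assumes b: "b \<in> carrier B" and m: "m > 0" and K: "K \<in> co_normal_subgroups \<C> B"
  obtains K' where "K' \<in> co_normal_subgroups \<C> B" "K' \<subseteq> K"
    "\<And>i::nat. b [^] i \<in> K' \<Longrightarrow> b [^] i = \<one> \<or> m dvd i"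
proof (cases "B.ord b = 0")
  case True
  let ?G = "generate B {b [^] m}"
  have bm: "b [^] m \<in> carrier B" using b by simp
  have "\<exists>L\<in>co_normal_subgroups \<C> B. \<forall>k\<in>L. b [^] r \<otimes> k \<notin> ?G" if r: "r \<in> {0<..<m}" for r
  proof -
    have "b [^] r \<notin> ?G"
    proof
      assume "b [^] r \<in> ?G"
      then obtain j :: int where "b [^] r = (b [^] m) [^] j" using B.generate_pow[OF bm] by auto
      then have "b [^] int r = b [^] (int m * j)"
        using B.int_pow_pow[OF b, of "int m" j] by (simp add: int_pow_int)
      then have "int r = int m * j" using B.int_pow_eq[OF b, of "int r"] True by simp
      then have "m dvd r" by (metis dvd_triv_left int_dvd_int_iff)
      then show False using r by (auto dest: dvd_imp_le)
    qed
    then obtain L where "L \<in> co_normal_subgroups \<C> B" "\<And>k. k \<in> L \<Longrightarrow> b [^] r \<otimes> k \<notin> ?G"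
      using separable_avoid[OF B.group_axioms cyclic[OF bm] B.nat_pow_closed[OF b]] by blast
    then show ?thesis by blast
  qed
  then have "\<exists>L\<in>co_normal_subgroups \<C> B. \<forall>r\<in>{0<..<m}. \<forall>k\<in>L. b [^] r \<otimes> k \<notin> ?G"
    using B.group_axioms by (intro co_normal_choice) blast+
  then obtain L where L: "L \<in> co_normal_subgroups \<C> B"
    "\<And>r k. r \<in> {0<..<m} \<Longrightarrow> k \<in> L \<Longrightarrow> b [^] r \<otimes> k \<notin> ?G" by blast
  show thesis
  proof (rule that[OF co_normal_Int[OF K L(1)]])
    fix i :: nat assume "b [^] i \<in> K \<inter> L"
    then have inv: "inv (b [^] i) \<in> L" using subgroup.m_inv_closed[OF co_normalD(3)[OF L(1)]] by blast
    have "int (i mod m) - int i = int m * (- int (i div m))"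
    proof -
      have "int i = int m * int (i div m) + int (i mod m)"
        by (metis mult_div_mod_eq of_nat_add of_nat_mult)
      then show ?thesis by simp
    qed
    \<comment> \<open>Division by \<open>b [^] i\<close>, an element of \<open>L\<close>, moves
      \<open>b [^] (i mod m)\<close> into the subgroup generated by \<open>b [^] m\<close>, which
      \<open>L\<close> permits only for remainder 0.\<close>
    then have "b [^] int (i mod m) \<otimes> inv (b [^] int i) = (b [^] int m) [^] (- int (i div m))"
      using b by (simp only: B.int_pow_diff[symmetric] B.int_pow_pow)
    then have "b [^] (i mod m) \<otimes> inv (b [^] i) = (b [^] m) [^] (- int (i div m))"
      by (simp only: int_pow_int)
    then have "b [^] (i mod m) \<otimes> inv (b [^] i) \<in> ?G"
      using B.generate_pow[OF bm] by blast
    then have "i mod m \<notin> {0<..<m}" using L(2) inv by blast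
    then show "b [^] i = \<one> \<or> m dvd i" using m by (simp add: dvd_eq_mod_eq_0)
  qed simp
next
  case False
  have "\<exists>L\<in>co_normal_subgroups \<C> B. b [^] r \<notin> L" if r: "r \<in> {0<..<B.ord b}" for r
  proof -
    have "b [^] r \<noteq> \<one>" using B.pow_eq_id[OF b, of r] r by (auto dest: dvd_imp_le)
    then show ?thesis
      using residually_avoid[OF residually_top B.group_axioms, of "b [^] r"] b by auto
  qed
  then have "\<exists>L\<in>co_normal_subgroups \<C> B. \<forall>r\<in>{0<..<B.ord b}. b [^] r \<notin> L"
    using B.group_axioms by (intro co_normal_choice) blast+
  then obtain L where L: "L \<in> co_normal_subgroups \<C> B"
    "\<And>r. r \<in> {0<..<B.ord b} \<Longrightarrow> b [^] r \<notin> L" by blast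
  show thesis
  proof (rule that[OF co_normal_Int[OF K L(1)]])
    fix i :: nat assume i: "b [^] i \<in> K \<inter> L"
    have "b [^] i = (b [^] B.ord b) [^] (i div B.ord b) \<otimes> b [^] (i mod B.ord b)"
      unfolding B.nat_pow_pow[OF b] B.nat_pow_mult[OF b] by simp
    then have eq: "b [^] i = b [^] (i mod B.ord b)" using b by simp
    then have "i mod B.ord b \<notin> {0<..<B.ord b}" using L(2) i by auto
    then have "i mod B.ord b = 0" using False by simp
    then show "b [^] i = \<one> \<or> m dvd i" using eq by simp
  qed simp
qed

text \<open>The set is a union of cycles of \<open>b\<close> and, \<open>K\<close> being normal,
  also of cosets of \<open>K\<close>. The former makes sums over it vanish on the image of
  \<open>diff b\<close>, the latter makes \<open>sum_over_open\<close> applicable.\<close>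

lemma cyc_mult_props:
  assumes b: "b \<in> carrier B" and s: "s \<in> carrier B" and K: "K \<in> co_normal_subgroups \<C> B"
  shows "cyc b s <#> K \<subseteq> carrier B"
    and "{z \<in> carrier B. b \<otimes> z \<in> cyc b s <#> K} = (cyc b s <#> K) \<inter> carrier B"
    and "\<forall>k\<in>K. \<forall>y\<in>cyc b s <#> K. k \<otimes> y \<in> cyc b s <#> K"
proof -
  note K' = co_normalD[OF K]
  interpret K: normal K B by fact
  have cB: "cyc b s \<subseteq> carrier B" by (rule cyc_subset[OF b s])
  show sub: "cyc b s <#> K \<subseteq> carrier B"
    using cB K'(4) by (auto simp: set_mult_def)
  have shift: "b [^] (i::int) \<otimes> z \<in> cyc b s <#> K" if z: "z \<in> cyc b s <#> K" for z i
  proof -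
    have "\<exists>(j::int) k. k \<in> K \<and> z = b [^] j \<otimes> s \<otimes> k"
    proof -
      obtain c k where "c \<in> cyc b s" "k \<in> K" "z = c \<otimes> k"
        using z unfolding set_mult_def by blast
      moreover from this(1) obtain j :: int where "c = b [^] j \<otimes> s" unfolding mem_cyc[OF b] by blast
      ultimately show ?thesis by blast
    qed
    then obtain j :: int and k where jk: "k \<in> K" "z = b [^] j \<otimes> s \<otimes> k" by blast
    then have "b [^] i \<otimes> z = b [^] (i + j) \<otimes> s \<otimes> k"
      using b s by (simp add: B.int_pow_mult B.m_assoc)
    then show ?thesis
      using jk(1) mem_cyc[OF b] unfolding set_mult_def by blast
  qed
  show "{z \<in> carrier B. b \<otimes> z \<in> cyc b s <#> K} = (cyc b s <#> K) \<inter> carrier B"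
  proof -
    have "z \<in> cyc b s <#> K" if "z \<in> carrier B" "b \<otimes> z \<in> cyc b s <#> K" for z
      using shift[OF that(2), of "-1"] that(1) b by (simp add: B.int_pow_neg B.group_simps)
    moreover have "b \<otimes> z \<in> cyc b s <#> K" if "z \<in> cyc b s <#> K" for z
      using shift[OF that, of 1] b by simp
    ultimately show ?thesis by blast
  qed
  show "\<forall>k\<in>K. \<forall>y\<in>cyc b s <#> K. k \<otimes> y \<in> cyc b s <#> K"
  proof (intro ballI)
    fix k y assume k: "k \<in> K" and y: "y \<in> cyc b s <#> K"
    obtain c k' where ck: "c \<in> cyc b s" "k' \<in> K" "y = c \<otimes> k'" using y by (auto simp: set_mult_def)
    have cc: "c \<in> carrier B" using ck cB by blast
    have "k \<otimes> y = c \<otimes> ((inv c \<otimes> k \<otimes> c) \<otimes> k')"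
      using ck k cc by (simp add: B.group_simps)
    moreover have "(inv c \<otimes> k \<otimes> c) \<otimes> k' \<in> K"
      using K.inv_op_closed1[OF cc k] ck(2) by simp
    ultimately show "k \<otimes> y \<in> cyc b s <#> K" using ck(1) unfolding set_mult_def by blast
  qed
qed

text \<open>The cycle is a translate of a closed subgroup and \<open>h\<close> has finite support,
  so thickening the cycle by a small \<open>K\<close> picks up no new support point and leaves the
  sum unchanged. All smaller \<open>K'\<close> are covered because later choices shrink
  \<open>K\<close> further.\<close>

lemma separate_sum:
  assumes b: "b \<in> carrier B" and s: "s \<in> carrier B" and h: "h \<in> carrier V"
    and ne: "sum_over (cyc b s) h \<noteq> \<one>\<^bsub>A\<^esub>"
  obtains K M where "K \<in> co_normal_subgroups \<C> B" "M \<in> co_normal_subgroups \<C> A"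
    "\<And>K'. K' \<in> co_normal_subgroups \<C> B \<Longrightarrow> K' \<subseteq> K \<Longrightarrow> sum_over (cyc b s <#> K') h \<notin> M"
proof -
  let ?G = "generate B {b}"
  have sub: "subgroup ?G B" by (rule subgroup_cyclic[OF b])
  have cB: "cyc b s \<subseteq> carrier B" by (rule cyc_subset[OF b s])
  have suppB: "supp h \<subseteq> carrier B" by (auto simp: supp_def)
  have "\<exists>L\<in>co_normal_subgroups \<C> B. \<forall>k\<in>L. z \<otimes> k \<notin> cyc b s" if z: "z \<in> supp h - cyc b s" for z
  proof -
    have zB: "z \<in> carrier B" using z suppB by blast
    have "z \<otimes> inv s \<notin> ?G"
    proof
      assume "z \<otimes> inv s \<in> ?G"
      then have "(z \<otimes> inv s) \<otimes> s \<in> cyc b s" by (auto simp: r_coset_def)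
      then show False using z zB s by (simp add: B.m_assoc)
    qed
    then obtain L where L: "L \<in> co_normal_subgroups \<C> B"
      "\<And>n. n \<in> L \<Longrightarrow> z \<otimes> inv s \<otimes> n \<notin> ?G"
      using separable_avoid[OF B.group_axioms cyclic[OF b], of "z \<otimes> inv s"] zB s by auto
    have "z \<otimes> k \<notin> cyc b s" if k: "k \<in> L" for k
    proof
      assume "z \<otimes> k \<in> cyc b s"
      then obtain g where g: "g \<in> ?G" "z \<otimes> k = g \<otimes> s" by (auto simp: r_coset_def)
      have kB: "k \<in> carrier B" "g \<in> carrier B"
        using k co_normalD(4)[OF L(1)] g(1) subgroup.subset[OF sub] by auto
      have "z \<otimes> inv s \<otimes> (s \<otimes> k \<otimes> inv s) = (z \<otimes> k) \<otimes> inv s"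
        using zB s kB by (simp add: B.group_simps)
      also have "\<dots> = g" unfolding g(2) using s kB by (simp add: B.group_simps)
      finally show False
        using L(2)[OF normal.inv_op_closed2[OF co_normalD(1)[OF L(1)] s k]] g(1) by simp
    qed
    then show ?thesis using L(1) by blast
  qed
  then have "\<exists>L\<in>co_normal_subgroups \<C> B. \<forall>z\<in>supp h - cyc b s. \<forall>k\<in>L. z \<otimes> k \<notin> cyc b s"
    using B.group_axioms finite_supp[OF h] by (intro co_normal_choice) blast+
  then obtain K where K: "K \<in> co_normal_subgroups \<C> B"
    "\<And>z k. z \<in> supp h - cyc b s \<Longrightarrow> k \<in> K \<Longrightarrow> z \<otimes> k \<notin> cyc b s" by blast
  obtain M where M: "M \<in> co_normal_subgroups \<C> A" "sum_over (cyc b s) h \<notin> M"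
    using residually_avoid[OF residually A.group_axioms _ ne] h by auto
  show thesis
  proof (rule that[OF K(1) M(1)])
    fix K' assume K': "K' \<in> co_normal_subgroups \<C> B" "K' \<subseteq> K"
    have "(cyc b s <#> K') \<inter> supp h = cyc b s \<inter> supp h"
    proof
      show "cyc b s \<inter> supp h \<subseteq> (cyc b s <#> K') \<inter> supp h"
      proof
        fix c assume c: "c \<in> cyc b s \<inter> supp h"
        then have "c \<otimes> \<one> \<in> cyc b s <#> K'"
          unfolding set_mult_def using co_normalD(5)[OF K'(1)] by blast
        then show "c \<in> (cyc b s <#> K') \<inter> supp h" using c cB by auto
      qed
      show "(cyc b s <#> K') \<inter> supp h \<subseteq> cyc b s \<inter> supp h"
      proof
        fix z assume z: "z \<in> (cyc b s <#> K') \<inter> supp h"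
        then obtain c k where ck: "c \<in> cyc b s" "k \<in> K'" "z = c \<otimes> k" by (auto simp: set_mult_def)
        have cc: "c \<in> carrier B" "k \<in> carrier B" using ck cB co_normalD(4)[OF K'(1)] by auto
        have "inv k \<in> K" using subgroup.m_inv_closed[OF co_normalD(3)[OF K'(1)] ck(2)] K'(2) by blast
        moreover have "z \<otimes> inv k \<in> cyc b s" using ck cc by (simp add: B.m_assoc)
        ultimately show "z \<in> cyc b s \<inter> supp h" using K(2) z by blast
      qed
    qed
    then show "sum_over (cyc b s <#> K') h \<notin> M"
      using M(2) sum_over_cong by metis
  qed
qed

lemma diff_base_closed:
  assumes N: "N \<in> co_normal_subgroups \<C> W" and b: "b \<in> carrier B" and h: "h \<in> carrier V"
    and adh: "\<And>L. L \<in> co_normal_subgroups \<C> W \<Longrightarrow> \<exists>n\<in>base N. \<exists>l\<in>base L. diff b n = h \<otimes>\<^bsub>V\<^esub> l"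
  shows "h \<in> diff b ` base N"
proof -
  have "sum_over (cyc b s) h = \<one>\<^bsub>A\<^esub>" if s: "s \<in> carrier B" for s
  proof (rule ccontr)
    assume ne: "sum_over (cyc b s) h \<noteq> \<one>\<^bsub>A\<^esub>"
    obtain K M where K: "K \<in> co_normal_subgroups \<C> B" and M: "M \<in> co_normal_subgroups \<C> A"
      and "\<And>K'. K' \<in> co_normal_subgroups \<C> B \<Longrightarrow> K' \<subseteq> K \<Longrightarrow> sum_over (cyc b s <#> K') h \<notin> M"
      using separate_sum[OF b s h ne] by blast
    then have nM: "sum_over (cyc b s <#> K) h \<notin> M" by blast
    define S where "S = cyc b s <#> K"
    note S = cyc_mult_props[OF b s K, folded S_def]
    obtain L where L: "L \<in> co_normal_subgroups \<C> W" "\<And>v. v \<in> base L \<Longrightarrow> sum_over S v \<in> M"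
      using sum_over_open[OF K M S(1) S(3)] by blast
    obtain n l where nl: "n \<in> base N" "l \<in> base L" "diff b n = h \<otimes>\<^bsub>V\<^esub> l" using adh[OF L(1)] by blast
    note nV = base_closed[OF nl(1)] and lV = base_closed[OF nl(2)]
    have "sum_over S h \<otimes>\<^bsub>A\<^esub> sum_over S l = \<one>\<^bsub>A\<^esub>"
      using sum_over_diff[OF b nV S(2)] nl(3) h lV by simp
    then have "sum_over S h = inv\<^bsub>A\<^esub> (sum_over S l)"
      using h lV by (simp add: A.inv_equality)
    then have "sum_over S h \<in> M"
      using subgroup.m_inv_closed[OF co_normalD(3)[OF M] L(2)[OF nl(2)]] by simp
    then show False using nM by (simp add: S_def)
  qed
  from sums_over_cycles_imp_diff[OF b h this] obtain u where u: "u \<in> carrier V" "h = diff b u" by blast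
  define m where "m = order (W Mod N)"
  have m: "m > 0" using order_quotient_pos[OF N] by (simp add: m_def)
  \<comment> \<open>Modulo this \<open>M\<close>, and for \<open>K\<close> inside
    \<open>top_part N\<close>, the sums over cosets of \<open>K\<close> suffice to place an element
    in \<open>base N\<close>.\<close>
  define M where "M = {a \<in> carrier A. (delta \<one> a, \<one>) \<in> N}"
  have M: "M \<in> co_normal_subgroups \<C> A"
    unfolding M_def by (rule co_normal_vimage[OF A.group_axioms delta_hom N])
  obtain K where K: "K \<in> co_normal_subgroups \<C> B" "K \<subseteq> top_part N"
    "\<And>i::nat. b [^] i \<in> K \<Longrightarrow> b [^] i = \<one> \<or> m dvd i"
    using powers_avoiding[OF b m top_part_co_normal[OF N]] by blast
  note K' = co_normalD[OF K(1)]
  have KB: "k \<in> carrier B" if "k \<in> K" for k using that K'(4) by blast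
  obtain L where L: "L \<in> co_normal_subgroups \<C> W" "\<And>v. v \<in> base L \<Longrightarrow> sum_over K v \<in> M"
    using sum_over_open[OF K(1) M K'(4)] by (auto simp: subgroup.m_closed[OF K'(3)])
  obtain n l where nl: "n \<in> base N" "l \<in> base L" "diff b n = h \<otimes>\<^bsub>V\<^esub> l" using adh[OF L(1)] by blast
  note nV = base_closed[OF nl(1)] and lV = base_closed[OF nl(2)]
  \<comment> \<open>The exact preimage \<open>u\<close> compared with the approximate one
    \<open>n\<close>: \<open>diff b w\<close> is the inverse of the error \<open>l\<close>, so
    \<open>w\<close> is invariant modulo \<open>K\<close> and \<open>M\<close>.\<close>
  define w where "w = u \<otimes>\<^bsub>V\<^esub> inv\<^bsub>V\<^esub> n"
  have w: "w \<in> carrier V" using u nV by (simp add: w_def)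
  have "diff b w = inv\<^bsub>V\<^esub> l"
    using u nV lV nl(3) b h by (simp add: w_def diff_mult diff_inv V.inv_mult V.group_simps)
  then have inv: "sum_over (K #> y) (diff b w) \<in> M" if y: "y \<in> carrier B" for y
  proof -
    \<comment> \<open>\<open>L\<close> was chosen for the sum over \<open>K\<close> alone; the other
      cosets follow because \<open>base L\<close> is invariant under translation.\<close>
    have "{z \<in> carrier B. inv y \<otimes> z \<in> K} = K #> y"
      using coset_translate[OF K'(1) B.inv_closed[OF y] y] y B.coset_mult_one[OF K'(4)] by simp
    then have "sum_over (K #> y) l = sum_over K (tr (inv y) l)"
      using sum_over_tr[of "inv y" l K] y lV by simp
    also have "\<dots> \<in> M" using L(2) base_tr[OF L(1) nl(2)] y by simp
    finally show ?thesis
      using \<open>diff b w = inv\<^bsub>V\<^esub> l\<close> lV subgroup.m_inv_closed[OF co_normalD(3)[OF M]] by simp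
  qed
  define q where "q = (LEAST q::nat. q > 0 \<and> b [^] q \<in> K)"
  have "\<exists>q::nat. q > 0 \<and> b [^] q \<in> K"
    using order_quotient_pos[OF K(1)] pow_order_quotient_mem[OF K(1) b dvd_refl] by blast
  then have q: "q > 0 \<and> b [^] q \<in> K" unfolding q_def by (rule LeastI_ex)
  have q_min: "b [^] j \<notin> K" if "0 < j" "j < q" for j
    using not_less_Least[of j "\<lambda>q::nat. q > 0 \<and> b [^] q \<in> K"] that by (auto simp: q_def)
  obtain w' where w': "w' \<in> carrier V"
    "\<And>y. y \<in> carrier B \<Longrightarrow> sum_over (K #> y) (w \<otimes>\<^bsub>V\<^esub> inv\<^bsub>V\<^esub> (power_base w' b q)) \<in> M"
    using invariant_imp_norm[OF K'(1) co_normalD(3)[OF M] b _ _ q_min w inv, of q] q by blast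
  define p where "p = power_base w' b q"
  have p: "p \<in> carrier V" using w' b by (simp add: p_def)
  have wp: "w \<otimes>\<^bsub>V\<^esub> inv\<^bsub>V\<^esub> p \<in> base N"
  proof (rule block_sums_imp_mem[of _ M "\<lambda>z. K #> z"])
    show "subgroup (base N) V" by (rule base_subgroup[OF N])
    show "subgroup M A" by (rule co_normalD(3)[OF M])
    show "z \<in> K #> z" if "z \<in> carrier B" for z by (rule B.rcos_self[OF that K'(3)])
    show "z' \<in> carrier B \<and> K #> z' = K #> z" if "z \<in> carrier B" "z' \<in> K #> z" for z z'
      using B.r_coset_subset_G[OF K'(4) that(1)] that B.repr_independence[OF that(2,1) K'(3)] by auto
    show "delta z a \<otimes>\<^bsub>V\<^esub> inv\<^bsub>V\<^esub> (delta z' a) \<in> base N"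
      if z: "z \<in> carrier B" and z': "z' \<in> K #> z" and a: "a \<in> carrier A" for z z' a
    proof -
      obtain k where k: "k \<in> K" "z' = k \<otimes> z" using z' by (auto simp: r_coset_def)
      have "tr k (delta z a) \<otimes>\<^bsub>V\<^esub> inv\<^bsub>V\<^esub> (delta z a) \<in> base N"
        using base_top[OF N _ delta_closed[OF a]] k K(2) by blast
      from base_inv[OF N this] show ?thesis
        using k KB z a by (simp add: tr_delta V.inv_mult V.m_comm)
    qed
    show "delta z a \<in> base N" if z: "z \<in> carrier B" and a: "a \<in> M" for z a
    proof -
      have aA: "a \<in> carrier A" and "delta \<one> a \<in> base N" using a by (auto simp: M_def base_def)
      from base_tr[OF N this(2) z] show ?thesis using z aA by (simp add: tr_delta)
    qed
    show "w \<otimes>\<^bsub>V\<^esub> inv\<^bsub>V\<^esub> p \<in> carrier V" using w p by simp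
  qed (use w' in \<open>simp add: p_def\<close>)
  \<comment> \<open>If \<open>p\<close> lies in \<open>base N\<close>, then so does
    \<open>u\<close>. If \<open>diff b\<close> kills \<open>p\<close>, then \<open>u\<close> is
    replaced by another preimage of \<open>h\<close>, which does lie in
    \<open>base N\<close>.\<close>
  have "b [^] q = \<one> \<or> m dvd q" using K(3) q by blast
  then show ?thesis
  proof
    assume "m dvd q"
    then have "p \<in> base N" unfolding p_def using power_base_mem[OF N w'(1) b] by (simp add: m_def)
    from base_mult[OF N base_mult[OF N wp this] nl(1)]
    have "u \<in> base N" using u nV p by (simp add: w_def V.group_simps)
    then show ?thesis using u by blast
  next
    assume "b [^] q = \<one>"
    then have "diff b p = \<one>\<^bsub>V\<^esub>" using w' b by (simp add: p_def diff_power_base)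
    then have "diff b (w \<otimes>\<^bsub>V\<^esub> inv\<^bsub>V\<^esub> p \<otimes>\<^bsub>V\<^esub> n) = diff b u"
      using u nV p b by (simp add: w_def diff_mult diff_inv V.group_simps)
    then show ?thesis using base_mult[OF N wp nl(1)] u(2) by (metis image_eqI)
  qed
qed

end


section \<open>From approximate to exact centralizing elements\<close>

context separating_wreath
begin

text \<open>The centralizer condition in \<open>B\<close> splits the top component of an approximate
  conjugator as \<open>c e\<close>, with \<open>c\<close> centralizing \<open>b\<close> and
  \<open>e\<close> in \<open>top_part L\<close>; modulo \<open>L\<close> the factor \<open>e\<close>
  disappears. The element \<open>c\<close> obtained here still depends on \<open>L\<close>.\<close>

lemma adherent_centralizer:
  assumes hB: "hereditarily_conjugacy_separable \<C> B"
    and N: "N \<in> co_normal_subgroups \<C> W" and f: "f \<in> carrier V" and f0: "f0 \<in> carrier V"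
    and b: "b \<in> carrier B"
    and adh: "adherent W (class_under W {x \<in> N. snd x \<in> top_part N} (f, b)) (f0, b)"
    and L: "L \<in> co_normal_subgroups \<C> W"
  shows "\<exists>c\<in>top_part N. c \<otimes> b = b \<otimes> c \<and>
    (\<exists>n\<in>base N. \<exists>l\<in>base L. tr c f \<otimes>\<^bsub>V\<^esub> diff b n = f0 \<otimes>\<^bsub>V\<^esub> l)"
proof -
  note N' = co_normalD[OF N] and L' = co_normalD[OF L]
  note tN = top_part_co_normal[OF N] and tL = top_part_co_normal[OF L]
  note tN' = co_normalD[OF tN]
  interpret L: normal L W by (rule L'(1))
  interpret Q: group "W Mod L" by (rule L.factorgroup_is_group)
  interpret \<rho>: group_hom W "W Mod L" "\<lambda>x. L #>\<^bsub>W\<^esub> x"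
    using L.r_coset_hom_Mod by unfold_locales
  obtain K where K: "K \<in> co_normal_subgroups \<C> B"
    and cc: "\<And>k l. k \<in> carrier B \<Longrightarrow> l \<in> K \<Longrightarrow> k \<otimes> b \<otimes> inv k = b \<otimes> l \<Longrightarrow>
      \<exists>c\<in>carrier B. c \<otimes> b = b \<otimes> c \<and> (\<exists>e\<in>top_part N \<inter> top_part L. k = c \<otimes> e)"
    using centralizer_condition[OF B.group_axioms hB co_normal_Int[OF tN tL] b] by blast
  have "L \<inter> {x \<in> carrier W. snd x \<in> K} \<in> co_normal_subgroups \<C> W"
    by (rule co_normal_Int[OF L vimage_snd_co_normal[OF K]])
  from adh[unfolded adherent_def, rule_format, OF this] obtain l0 where l0: "l0 \<in> L" "l0 \<in> carrier W" "snd l0 \<in> K"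
    "(f0, b) \<otimes>\<^bsub>W\<^esub> l0 \<in> class_under W {x \<in> N. snd x \<in> top_part N} (f, b)"
    by blast
  from l0(4) obtain m where m: "m \<in> N" "snd m \<in> top_part N"
    "(f0, b) \<otimes>\<^bsub>W\<^esub> l0 = m \<otimes>\<^bsub>W\<^esub> (f, b) \<otimes>\<^bsub>W\<^esub> inv\<^bsub>W\<^esub> m"
    by (rule class_underE) blast
  obtain n k where nk: "m = (n, k)" "n \<in> carrier V" "k \<in> carrier B"
    using m(1) N'(4) by (force simp: carrier_W)
  obtain l1 l2 where ll: "l0 = (l1, l2)" "l1 \<in> carrier V" "l2 \<in> carrier B"
    using l0(2) by (auto simp: carrier_W)
  have k: "k \<in> top_part N" using m(2) nk by simp
  have "(\<one>\<^bsub>V\<^esub>, k) \<in> N" using k by (simp add: top_part_def)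
  then have "(n, k) \<otimes>\<^bsub>W\<^esub> inv\<^bsub>W\<^esub> (\<one>\<^bsub>V\<^esub>, k) \<in> N"
    using m(1) nk(1) subgroup.m_closed[OF N'(3)] subgroup.m_inv_closed[OF N'(3)] by blast
  then have n: "n \<in> base N" using nk by (simp add: base_def W_inv)
  have "k \<otimes> b \<otimes> inv k = b \<otimes> l2"
    using m(3) W_conj[OF nk(2) f nk(3) b] by (simp add: nk(1) ll(1))
  then obtain c e where c: "c \<in> carrier B" "c \<otimes> b = b \<otimes> c"
    and e: "e \<in> top_part N" "e \<in> top_part L" and kce: "k = c \<otimes> e"
    using cc[OF nk(3), of l2] l0(3) ll(1) by auto
  have eB: "e \<in> carrier B" using e tN'(4) by blast
  have cN: "c \<in> top_part N"
  proof -
    have "k \<otimes> inv e \<in> top_part N"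
      using k e subgroup.m_closed[OF tN'(3)] subgroup.m_inv_closed[OF tN'(3)] by blast
    then show ?thesis using c eB by (simp add: kce B.m_assoc)
  qed
  have W: "(n, c) \<in> carrier W" "(\<one>\<^bsub>V\<^esub>, e) \<in> carrier W" "(f, b) \<in> carrier W" "(f0, b) \<in> carrier W"
    using nk c eB f f0 b by (simp_all add: carrier_W)
  have "(\<one>\<^bsub>V\<^esub>, e) \<in> L" using e(2) by (simp add: top_part_def)
  then have \<rho>e: "L #>\<^bsub>W\<^esub> (\<one>\<^bsub>V\<^esub>, e) = \<one>\<^bsub>W Mod L\<^esub>" "L #>\<^bsub>W\<^esub> l0 = \<one>\<^bsub>W Mod L\<^esub>"
    using r_coset_eq_iff_mem[OF L'(1)] W l0 by simp_all
  have "m = (n, c) \<otimes>\<^bsub>W\<^esub> (\<one>\<^bsub>V\<^esub>, e)" using nk c eB kce by simp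
  then have "L #>\<^bsub>W\<^esub> m = L #>\<^bsub>W\<^esub> (n, c)"
    using W \<rho>e(1) \<rho>.hom_mult[OF W(1,2)] Q.r_one[OF \<rho>.hom_closed[OF W(1)]] by simp
  moreover have mW: "m \<in> carrier W" using nk by (simp add: carrier_W)
  ultimately have "L #>\<^bsub>W\<^esub> (m \<otimes>\<^bsub>W\<^esub> (f, b) \<otimes>\<^bsub>W\<^esub> inv\<^bsub>W\<^esub> m) =
      L #>\<^bsub>W\<^esub> ((n, c) \<otimes>\<^bsub>W\<^esub> (f, b) \<otimes>\<^bsub>W\<^esub> inv\<^bsub>W\<^esub> (n, c))"
    using W by (simp del: mult_FactGroup one_FactGroup W_mult)
  moreover have "L #>\<^bsub>W\<^esub> ((f0, b) \<otimes>\<^bsub>W\<^esub> l0) = L #>\<^bsub>W\<^esub> (f0, b)"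
    using W l0(2) \<rho>e(2) Q.r_one[OF \<rho>.hom_closed[OF W(4)]] \<rho>.hom_mult[OF W(4) l0(2)]
    by (simp del: mult_FactGroup one_FactGroup W_mult)
  ultimately have "L #>\<^bsub>W\<^esub> (f0, b) = L #>\<^bsub>W\<^esub> (tr c f \<otimes>\<^bsub>V\<^esub> diff b n, b)"
    using m(3) W_conj_centralizer[OF nk(2) c(1) f b c(2)] by simp
  then have "inv\<^bsub>W\<^esub> (f0, b) \<otimes>\<^bsub>W\<^esub> (tr c f \<otimes>\<^bsub>V\<^esub> diff b n, b) \<in> L"
    by (subst (asm) r_coset_eq_iff[OF L'(1)]) (use W nk c f b in \<open>simp_all add: carrier_W\<close>)
  then have "tr (inv b) (inv\<^bsub>V\<^esub> f0 \<otimes>\<^bsub>V\<^esub> (tr c f \<otimes>\<^bsub>V\<^esub> diff b n)) \<in> base L"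
    using f0 b c nk f by (simp add: base_def W_inv tr_mult tr_inv)
  from base_tr[OF L this b]
  have "inv\<^bsub>V\<^esub> f0 \<otimes>\<^bsub>V\<^esub> (tr c f \<otimes>\<^bsub>V\<^esub> diff b n) \<in> base L"
    using f0 b c nk f by (simp add: tr_tr)
  moreover have "tr c f \<otimes>\<^bsub>V\<^esub> diff b n = f0 \<otimes>\<^bsub>V\<^esub> (inv\<^bsub>V\<^esub> f0 \<otimes>\<^bsub>V\<^esub> (tr c f \<otimes>\<^bsub>V\<^esub> diff b n))"
    using f0 b c nk f by (simp add: V.group_simps)
  ultimately show ?thesis using c(2) cN n by blast
qed

lemma commute_mod:
  assumes b: "b \<in> carrier B" and d: "d \<in> carrier B" and ne: "d \<otimes> b \<noteq> b \<otimes> d"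
  obtains K where "K \<in> co_normal_subgroups \<C> B" "inv (b \<otimes> d) \<otimes> (d \<otimes> b) \<notin> K"
proof -
  have "inv (b \<otimes> d) \<otimes> (d \<otimes> b) \<noteq> \<one>"
  proof
    assume "inv (b \<otimes> d) \<otimes> (d \<otimes> b) = \<one>"
    then have "(b \<otimes> d) \<otimes> (inv (b \<otimes> d) \<otimes> (d \<otimes> b)) = b \<otimes> d" using b d by simp
    then show False using ne b d B.mult_inv_cancel_left[of "b \<otimes> d" "d \<otimes> b"] by simp
  qed
  then show thesis
    using residually_avoid[OF residually_top B.group_axioms] b d that by (metis B.inv_closed B.m_closed)
qed

lemma tr_close:
  assumes L: "L \<in> co_normal_subgroups \<C> W" and e: "e \<in> top_part L" and d: "d \<in> carrier B" and f: "f \<in> carrier V"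
  obtains l where "l \<in> base L" "tr (d \<otimes> e) f = tr d f \<otimes>\<^bsub>V\<^esub> l"
proof -
  have eB: "e \<in> carrier B" using e by (simp add: top_part_def)
  have "tr d (tr e f \<otimes>\<^bsub>V\<^esub> inv\<^bsub>V\<^esub> f) \<in> base L" by (rule base_tr[OF L base_top[OF L e f] d])
  moreover have "tr (d \<otimes> e) f = tr d f \<otimes>\<^bsub>V\<^esub> tr d (tr e f \<otimes>\<^bsub>V\<^esub> inv\<^bsub>V\<^esub> f)"
  proof -
    have "tr d f \<otimes>\<^bsub>V\<^esub> (tr (d \<otimes> e) f \<otimes>\<^bsub>V\<^esub> inv\<^bsub>V\<^esub> (tr d f)) = tr (d \<otimes> e) f"
      using d eB f by (simp add: V.m_comm[of "tr (d \<otimes> e) f"] V.mult_inv_cancel_left)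
    then show ?thesis using d eB f by (simp add: tr_mult tr_inv tr_tr)
  qed
  ultimately show thesis using that by blast
qed

text \<open>If the class of \<open>f\<close> modulo the image of \<open>diff b\<close> is nontrivial, its support determines a
  conjugating element \<open>c\<close> up to finitely many choices modulo powers of \<open>b\<close>, and up to
  the elements of \<open>base N\<close> only finitely many of these powers matter.\<close>

lemma uniform_centralizer:
  assumes N: "N \<in> co_normal_subgroups \<C> W" and f: "f \<in> carrier V" and f0: "f0 \<in> carrier V"
    and b: "b \<in> carrier B"
    and ex: "\<And>L. L \<in> co_normal_subgroups \<C> W \<Longrightarrow> \<exists>c\<in>top_part N. c \<otimes> b = b \<otimes> c \<and>
      (\<exists>n\<in>base N. \<exists>l\<in>base L. tr c f \<otimes>\<^bsub>V\<^esub> diff b n = f0 \<otimes>\<^bsub>V\<^esub> l)"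
  shows "\<exists>c\<in>top_part N. c \<otimes> b = b \<otimes> c \<and> (\<forall>L\<in>co_normal_subgroups \<C> W.
      \<exists>n\<in>base N. \<exists>l\<in>base L. tr c f \<otimes>\<^bsub>V\<^esub> diff b n = f0 \<otimes>\<^bsub>V\<^esub> l)"
proof (cases "\<forall>z\<in>carrier B. sum_over (cyc b z) f = \<one>\<^bsub>A\<^esub>")
  case True
  then obtain u where u: "u \<in> carrier V" "f = diff b u"
    using sums_over_cycles_imp_diff[OF b f] by blast
  have "\<exists>n\<in>base N. \<exists>l\<in>base L. tr \<one> f \<otimes>\<^bsub>V\<^esub> diff b n = f0 \<otimes>\<^bsub>V\<^esub> l" if L: "L \<in> co_normal_subgroups \<C> W" for L
  proof -
    obtain c n l where c: "c \<in> top_part N" "c \<otimes> b = b \<otimes> c"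
      and nl: "n \<in> base N" "l \<in> base L" "tr c f \<otimes>\<^bsub>V\<^esub> diff b n = f0 \<otimes>\<^bsub>V\<^esub> l"
      using ex[OF L] by blast
    have cB: "c \<in> carrier B" using c by (simp add: top_part_def)
    \<comment> \<open>For \<open>f = diff b u\<close>, translation by \<open>c\<close> in
      \<open>top_part N\<close> only adds \<open>diff b v\<close> with \<open>v\<close> in
      \<open>base N\<close>, so \<open>c\<close> can be traded for the identity.\<close>
    define v where "v = tr c u \<otimes>\<^bsub>V\<^esub> inv\<^bsub>V\<^esub> u"
    have v: "v \<in> base N" unfolding v_def by (rule base_top[OF N c(1) u(1)])
    have vV: "v \<in> carrier V" by (rule base_closed[OF v])
    have "tr c u = u \<otimes>\<^bsub>V\<^esub> v"
      using u cB by (simp add: v_def V.m_comm[of "tr c u"] V.mult_inv_cancel_left)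
    then have "tr c f = f \<otimes>\<^bsub>V\<^esub> diff b v"
      using u cB c b vV by (simp add: tr_diff diff_mult)
    then have "tr \<one> f \<otimes>\<^bsub>V\<^esub> diff b (v \<otimes>\<^bsub>V\<^esub> n) = f0 \<otimes>\<^bsub>V\<^esub> l"
      using nl(3) f vV base_closed[OF nl(1)] b by (simp add: diff_mult V.m_assoc)
    then show ?thesis using base_mult[OF N v nl(1)] nl(2) by blast
  qed
  moreover have "\<one> \<in> top_part N" by (rule co_normalD(5)[OF top_part_co_normal[OF N]])
  ultimately show ?thesis using b by (intro bexI[of _ "\<one>"]) auto
next
  case False
  then obtain s where s: "s \<in> carrier B" "sum_over (cyc b s) f \<noteq> \<one>\<^bsub>A\<^esub>" by blast
  define m where "m = order (W Mod N)"
  have m: "m > 0" using order_quotient_pos[OF N] by (simp add: m_def)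
  define good where "good c L \<longleftrightarrow> (\<exists>n\<in>base N. \<exists>l\<in>base L. tr c f \<otimes>\<^bsub>V\<^esub> diff b n = f0 \<otimes>\<^bsub>V\<^esub> l)" for c L
  \<comment> \<open>\<open>c\<close> has to carry a point near the cycle of \<open>s\<close> to a
    support point \<open>t\<close> of \<open>f0\<close>. Up to a small error it is then a power of
    \<open>b\<close> times \<open>t inv s\<close>, and the exponent matters only modulo
    \<open>m\<close>.\<close>
  define E where "E = {c \<in> top_part N. c \<otimes> b = b \<otimes> c} \<inter>
    (\<lambda>(j, t). b [^] (j::nat) \<otimes> (t \<otimes> inv s)) ` ({..<m} \<times> supp f0)"
  have finE: "finite E" unfolding E_def using finite_supp[OF f0] by simp
  note tN = top_part_co_normal[OF N]
  note tN' = co_normalD[OF tN]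
  have "\<exists>c\<in>E. \<forall>L\<in>co_normal_subgroups \<C> W. good c L"
  proof (rule ccontr)
    assume "\<not> (\<exists>c\<in>E. \<forall>L\<in>co_normal_subgroups \<C> W. good c L)"
    then have bad: "\<exists>L\<in>co_normal_subgroups \<C> W. \<not> good c L" if "c \<in> E" for c using that by blast
    have "\<exists>L\<in>co_normal_subgroups \<C> W. \<forall>c\<in>E. \<not> good c L"
      using bad base_mono unfolding good_def
      by (intro co_normal_choice[OF finE W.group_axioms]) blast+
    then obtain L1 where L1: "L1 \<in> co_normal_subgroups \<C> W" "\<And>c. c \<in> E \<Longrightarrow> \<not> good c L1" by blast
    obtain K2 M where K2: "K2 \<in> co_normal_subgroups \<C> B" and M: "M \<in> co_normal_subgroups \<C> A"
      and nM: "\<And>K'. K' \<in> co_normal_subgroups \<C> B \<Longrightarrow> K' \<subseteq> K2 \<Longrightarrow> sum_over (cyc b s <#> K') f \<notin> M"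
      using separate_sum[OF b s(1) f s(2)] by blast
    \<comment> \<open>There are finitely many elements \<open>t inv s\<close>, so for them commuting
      with \<open>b\<close> modulo \<open>K3\<close> can be made to imply commuting with
      \<open>b\<close>.\<close>
    have "\<exists>K\<in>co_normal_subgroups \<C> B. \<forall>t\<in>{t \<in> supp f0. (t \<otimes> inv s) \<otimes> b \<noteq> b \<otimes> (t \<otimes> inv s)}.
        inv (b \<otimes> (t \<otimes> inv s)) \<otimes> ((t \<otimes> inv s) \<otimes> b) \<notin> K"
    proof (rule co_normal_choice[OF _ B.group_axioms])
      fix t assume "t \<in> {t \<in> supp f0. (t \<otimes> inv s) \<otimes> b \<noteq> b \<otimes> (t \<otimes> inv s)}"
      then have "t \<otimes> inv s \<in> carrier B" "(t \<otimes> inv s) \<otimes> b \<noteq> b \<otimes> (t \<otimes> inv s)"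
        using s by (auto simp: supp_def)
      from commute_mod[OF b this] show "\<exists>K\<in>co_normal_subgroups \<C> B.
        inv (b \<otimes> (t \<otimes> inv s)) \<otimes> ((t \<otimes> inv s) \<otimes> b) \<notin> K" by blast
    qed (use finite_supp[OF f0] in auto)
    then obtain K3 where K3: "K3 \<in> co_normal_subgroups \<C> B"
      and K3_comm: "\<And>t. t \<in> supp f0 \<Longrightarrow> (t \<otimes> inv s) \<otimes> b \<noteq> b \<otimes> (t \<otimes> inv s) \<Longrightarrow>
        inv (b \<otimes> (t \<otimes> inv s)) \<otimes> ((t \<otimes> inv s) \<otimes> b) \<notin> K3" by blast
    define K where "K = K2 \<inter> K3 \<inter> (top_part N \<inter> top_part L1)"
    have K: "K \<in> co_normal_subgroups \<C> B"
      unfolding K_def by (intro co_normal_Int K2 K3 tN top_part_co_normal L1(1))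
    note K' = co_normalD[OF K]
    interpret K: normal K B by (rule K'(1))
    define S where "S = cyc b s <#> K"
    note S = cyc_mult_props[OF b s(1) K, folded S_def]
    have Sf: "sum_over S f \<notin> M" unfolding S_def by (rule nM[OF K]) (auto simp: K_def)
    obtain L2 where L2: "L2 \<in> co_normal_subgroups \<C> W" "\<forall>v\<in>base L2. sum_over S v \<in> M"
      using sum_over_open[OF K M S(1) S(3)] by blast
    obtain c n l where c: "c \<in> top_part N" "c \<otimes> b = b \<otimes> c"
      and nl: "n \<in> base N" "l \<in> base (L1 \<inter> L2)" "tr c f \<otimes>\<^bsub>V\<^esub> diff b n = f0 \<otimes>\<^bsub>V\<^esub> l"
      using ex[OF co_normal_Int[OF L1(1) L2(1)]] by blast
    have lL: "l \<in> base L1" "l \<in> base L2" using nl(2) by (auto simp: base_def)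
    note nV = base_closed[OF nl(1)] and lV = base_closed[OF nl(2)]
    have cB: "c \<in> carrier B" using c by (simp add: top_part_def)
    have cb': "inv c \<otimes> b = b \<otimes> inv c"
    proof -
      have "inv c \<otimes> b = inv c \<otimes> (b \<otimes> c) \<otimes> inv c"
        using cB b by (simp add: B.group_simps)
      then show ?thesis unfolding c(2)[symmetric] using cB b by (simp add: B.group_simps)
    qed
    \<comment> \<open>Otherwise the sum of \<open>f\<close> over \<open>S\<close> would be that of
      an element of \<open>base L2\<close>, hence in \<open>M\<close>: terms in the image of
      \<open>diff b\<close> sum to the identity over \<open>S\<close>, and \<open>f0\<close> would
      contribute nothing.\<close>
    have "S \<inter> supp (tr (inv c) f0) \<noteq> {}"
    proof
      assume "S \<inter> supp (tr (inv c) f0) = {}"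
      then have f0S: "sum_over S (tr (inv c) f0) = \<one>\<^bsub>A\<^esub>" by (simp add: sum_over_def)
      have "tr (inv c) (tr c f \<otimes>\<^bsub>V\<^esub> diff b n) = tr (inv c) (f0 \<otimes>\<^bsub>V\<^esub> l)" using nl(3) by simp
      then have "f \<otimes>\<^bsub>V\<^esub> diff b (tr (inv c) n) = tr (inv c) f0 \<otimes>\<^bsub>V\<^esub> tr (inv c) l"
        using cB b f nV f0 lV by (simp add: tr_mult tr_tr tr_diff[OF b _ cb'])
      then have "sum_over S (f \<otimes>\<^bsub>V\<^esub> diff b (tr (inv c) n)) =
          sum_over S (tr (inv c) f0 \<otimes>\<^bsub>V\<^esub> tr (inv c) l)" by simp
      then have "sum_over S f = sum_over S (tr (inv c) l)"
        using cB b f nV f0 lV f0S sum_over_diff[OF b tr_closed[OF B.inv_closed[OF cB] nV] S(2)] by simp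
      moreover have "sum_over S (tr (inv c) l) \<in> M"
        using L2(2) base_tr[OF L2(1) lL(2)] cB by simp
      ultimately show False using Sf by simp
    qed
    then obtain y where y: "y \<in> S" "y \<in> supp (tr (inv c) f0)" by blast
    then obtain t where t: "t \<in> supp f0" "y = inv c \<otimes> t" using supp_tr[of "inv c" f0] cB by auto
    have tB: "t \<in> carrier B" using t by (simp add: supp_def)
    obtain y1 k where yk: "y1 \<in> cyc b s" "k \<in> K" "y = y1 \<otimes> k"
      using y(1) unfolding S_def set_mult_def by blast
    obtain i :: int where i: "y1 = b [^] i \<otimes> s" using yk(1) unfolding mem_cyc[OF b] by blast
    define d where "d = t \<otimes> inv s"
    have d: "d \<in> carrier B" using tB s by (simp add: d_def)
    have kB: "k \<in> carrier B" using yk(2) K'(4) by blast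
    \<comment> \<open>The error \<open>k\<close> stands to the right of \<open>s\<close>;
      conjugation by \<open>s\<close> moves it next to the power of \<open>b\<close>, within the
      normal subgroup \<open>K\<close>.\<close>
    define e where "e = s \<otimes> inv k \<otimes> inv s"
    have eK: "e \<in> K" unfolding e_def using K.inv_op_closed2[OF s(1) K.m_inv_closed[OF yk(2)]] .
    have eB: "e \<in> carrier B" using eK K'(4) by blast
    have bi: "b [^] i \<in> carrier B" "b [^] (- i) \<in> carrier B" using b by simp_all
    have binv: "b [^] (- i) = inv (b [^] i)" using b by (simp add: B.int_pow_neg)
    have t_eq: "t = c \<otimes> (b [^] i \<otimes> s \<otimes> k)"
      using t(2) yk(3) i cB tB by (simp add: B.mult_inv_cancel_left)
    have d_eq: "d = c \<otimes> b [^] i \<otimes> inv e"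
      unfolding d_def t_eq e_def using cB bi s kB by (simp add: B.group_simps)
    have c_eq: "c = d \<otimes> e \<otimes> b [^] (- i)"
      unfolding d_eq binv using cB bi eB by (simp add: B.group_simps)
    have bib: "b [^] i \<otimes> b = b \<otimes> b [^] i"
      using b B.int_pow_mult[of b i 1] B.int_pow_mult[of b 1 i] by (simp add: add.commute)
    have db: "d \<otimes> b = b \<otimes> d"
    proof (rule ccontr)
      assume "d \<otimes> b \<noteq> b \<otimes> d"
      then have nK: "inv (b \<otimes> d) \<otimes> (d \<otimes> b) \<notin> K3"
        using K3_comm[OF t(1)] by (simp add: d_def)
      define r where "r = c \<otimes> b [^] i"
      have r: "r \<in> carrier B" "d = r \<otimes> inv e" using cB bi by (simp_all add: r_def d_eq)
      have "r \<otimes> b = b \<otimes> r"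
      proof -
        have "r \<otimes> b = (c \<otimes> b) \<otimes> b [^] i"
          unfolding r_def using cB b bi bib by (simp add: B.m_assoc)
        also have "\<dots> = b \<otimes> r" unfolding c(2) r_def using cB b bi by (simp add: B.m_assoc)
        finally show ?thesis .
      qed
      then have comm: "inv r \<otimes> inv b = inv b \<otimes> inv r"
        using r(1) b by (simp add: B.inv_mult_group[symmetric])
      have "inv (b \<otimes> d) \<otimes> (d \<otimes> b) =
          e \<otimes> (inv r \<otimes> inv b) \<otimes> (r \<otimes> (inv e \<otimes> b))"
        unfolding r(2) using r(1) b eB by (simp add: B.group_simps)
      also have "\<dots> = e \<otimes> (inv b \<otimes> inv e \<otimes> b)"
        unfolding comm using r(1) b eB by (simp add: B.group_simps)
      also have "\<dots> \<in> K"
        using K.m_closed[OF eK K.inv_op_closed1[OF b K.m_inv_closed[OF eK]]] .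
      finally show False using nK by (simp add: K_def)
    qed
    \<comment> \<open>A natural exponent allows the use of \<open>power_base\<close> and the
      reduction modulo \<open>m\<close>; it costs another element of \<open>K\<close>.\<close>
    obtain I :: nat and k1 where k1: "k1 \<in> K" "b [^] (- i) = b [^] I \<otimes> k1"
      using int_pow_eq_nat_pow_mult[OF K b] by blast
    have k1B: "k1 \<in> carrier B" using k1 K'(4) by blast
    have pow_comm: "d \<otimes> b [^] (j::nat) = b [^] j \<otimes> d" for j
      using B.group_commutes_pow[OF db[symmetric] b d] by simp
    define e1 where "e1 = inv (b [^] I) \<otimes> e \<otimes> b [^] I \<otimes> k1"
    have e1K: "e1 \<in> K"
      unfolding e1_def using K.m_closed[OF K.inv_op_closed1[OF _ eK] k1(1)] b by simp
    have e1B: "e1 \<in> carrier B" using e1K K'(4) by blast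
    have c_eq2: "c = b [^] I \<otimes> d \<otimes> e1"
    proof -
      have "c = d \<otimes> b [^] I \<otimes> e1"
        unfolding c_eq k1(2) e1_def using d eB b k1B by (simp add: B.group_simps)
      then show ?thesis by (simp add: pow_comm)
    qed
    define j where "j = I mod m"
    define r where "r = m * (I div m)"
    have I: "I = j + r" by (simp add: j_def r_def)
    define cs where "cs = b [^] j \<otimes> d"
    have csB: "cs \<in> carrier B" using b d by (simp add: cs_def)
    have br: "b [^] r \<in> carrier B" using b by simp
    have c_eq3: "c = cs \<otimes> b [^] r \<otimes> e1"
    proof -
      have "b [^] I \<otimes> d = cs \<otimes> b [^] r"
        unfolding I cs_def B.nat_pow_mult[OF b, symmetric] using b d pow_comm[of r] by (simp add: B.m_assoc)
      then show ?thesis using c_eq2 by simp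
    qed
    have rN: "b [^] r \<in> top_part N" "power_base f b r \<in> base N"
      using power_base_mem[OF N f b, of r] by (simp_all add: r_def m_def)
    have csN: "cs \<in> top_part N"
    proof -
      have "e1 \<in> top_part N" using e1K by (simp add: K_def)
      then have "c \<otimes> inv (b [^] r \<otimes> e1) \<in> top_part N"
        using c(1) rN(1) subgroup.m_closed[OF tN'(3)] subgroup.m_inv_closed[OF tN'(3)] by blast
      then show ?thesis unfolding c_eq3 using csB br e1B by (simp add: B.group_simps)
    qed
    have csb: "cs \<otimes> b = b \<otimes> cs"
    proof -
      have "b [^] j \<otimes> b = b \<otimes> b [^] j" by (rule B.group_commutes_pow[OF refl b b])
      then have "b [^] j \<otimes> (b \<otimes> d) = b \<otimes> (b [^] j \<otimes> d)"
        using b d by (metis B.m_assoc B.nat_pow_closed)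
      then show ?thesis unfolding cs_def using b d by (simp add: B.m_assoc db)
    qed
    have csE: "cs \<in> E"
      unfolding E_def cs_def d_def
      using csN csb t(1) m unfolding cs_def d_def by (auto simp: j_def intro!: image_eqI[of _ _ "(j, t)"])
    have "good cs L1"
    proof -
      define p where "p = tr cs (power_base f b r)"
      have p: "p \<in> base N" unfolding p_def by (rule base_tr[OF N rN(2) csB])
      have pV: "p \<in> carrier V" by (rule base_closed[OF p])
      have pb: "power_base f b r \<in> carrier V" using f b by simp
      have "e1 \<in> top_part L1" using e1K by (simp add: K_def)
      from tr_close[OF L1(1) this B.m_closed[OF csB br] f]
      obtain l' where l': "l' \<in> base L1" "tr c f = tr (cs \<otimes> b [^] r) f \<otimes>\<^bsub>V\<^esub> l'"
        unfolding c_eq3 by blast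
      have l'V: "l' \<in> carrier V" by (rule base_closed[OF l'(1)])
      \<comment> \<open>As \<open>m\<close> divides \<open>r\<close>, this translate differs from
        \<open>f\<close> by \<open>diff b\<close> of an element of \<open>base N\<close>, which can
        be absorbed into \<open>n\<close>. The factor \<open>e1\<close> affects only the error in
        \<open>base L1\<close>.\<close>
      have "tr (b [^] r) f = f \<otimes>\<^bsub>V\<^esub> inv\<^bsub>V\<^esub> (diff b (power_base f b r))"
        using f b by (simp add: diff_power_base V.inv_mult V.mult_inv_cancel_left)
      then have "tr (cs \<otimes> b [^] r) f = tr cs (f \<otimes>\<^bsub>V\<^esub> inv\<^bsub>V\<^esub> (diff b (power_base f b r)))"
        using f csB br by (simp add: tr_tr[symmetric])
      also have "\<dots> = tr cs f \<otimes>\<^bsub>V\<^esub> inv\<^bsub>V\<^esub> (diff b p)"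
        unfolding p_def using f csB b pb by (simp add: tr_mult tr_inv tr_diff[OF b csB csb])
      finally have eq: "tr cs f \<otimes>\<^bsub>V\<^esub> inv\<^bsub>V\<^esub> (diff b p) \<otimes>\<^bsub>V\<^esub> l' \<otimes>\<^bsub>V\<^esub> diff b n = f0 \<otimes>\<^bsub>V\<^esub> l"
        using l'(2) nl(3) by simp
      have "tr cs f \<otimes>\<^bsub>V\<^esub> diff b (n \<otimes>\<^bsub>V\<^esub> inv\<^bsub>V\<^esub> p) =
          (tr cs f \<otimes>\<^bsub>V\<^esub> inv\<^bsub>V\<^esub> (diff b p) \<otimes>\<^bsub>V\<^esub> l' \<otimes>\<^bsub>V\<^esub> diff b n) \<otimes>\<^bsub>V\<^esub> inv\<^bsub>V\<^esub> l'"
      proof -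
        have "tr cs f \<otimes>\<^bsub>V\<^esub> inv\<^bsub>V\<^esub> (diff b p) \<otimes>\<^bsub>V\<^esub> l' \<otimes>\<^bsub>V\<^esub> diff b n =
            tr cs f \<otimes>\<^bsub>V\<^esub> diff b (n \<otimes>\<^bsub>V\<^esub> inv\<^bsub>V\<^esub> p) \<otimes>\<^bsub>V\<^esub> l'"
          using b f csB nV pV l'V by (simp add: diff_mult diff_inv V.m_ac)
        then show ?thesis using b f csB nV pV l'V by (simp add: V.group_simps)
      qed
      also have "\<dots> = f0 \<otimes>\<^bsub>V\<^esub> (l \<otimes>\<^bsub>V\<^esub> inv\<^bsub>V\<^esub> l')"
        unfolding eq using f0 lV l'V by (simp add: V.m_assoc)
      finally show ?thesis
        unfolding good_def using base_mult[OF N nl(1) base_inv[OF N p]]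
          base_mult[OF L1(1) lL(1) base_inv[OF L1(1) l'(1)]] by blast
    qed
    then show False using L1(2)[OF csE] by simp
  qed
  then show ?thesis unfolding E_def good_def by blast
qed

lemma hereditarily_conjugacy_separable_abelian_base:
  assumes hB: "hereditarily_conjugacy_separable \<C> B"
  shows "hereditarily_conjugacy_separable \<C> W"
proof (rule hereditarily_conjugacy_separableI[OF W.group_axioms])
  fix N g assume N: "N \<in> co_normal_subgroups \<C> W" and g: "g \<in> carrier W"
  obtain f b where fb: "g = (f, b)" "f \<in> carrier V" "b \<in> carrier B" using g by (auto simp: carrier_W)
  note f = fb(2) and b = fb(3)
  note N' = co_normalD[OF N]
  note tN = top_part_co_normal[OF N]
  note tN' = co_normalD[OF tN]
  \<comment> \<open>The product of \<open>base N\<close> and \<open>top_part N\<close>. An element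
    \<open>(n, k)\<close> of \<open>N\<close> need not have its components in \<open>N\<close>, so
    this open normal subgroup may be smaller than \<open>N\<close>.\<close>
  define M where "M = {x \<in> N. snd x \<in> top_part N}"
  have "N \<inter> {x \<in> carrier W. snd x \<in> top_part N} = M" using N'(4) by (auto simp: M_def)
  then have M: "M \<in> co_normal_subgroups \<C> W" using co_normal_Int[OF N vimage_snd_co_normal[OF tN]] by simp
  note M' = co_normalD[OF M]
  have memM: "(n, k) \<in> M" if "n \<in> base N" "k \<in> top_part N" for n k
  proof -
    have "(n, \<one>) \<otimes>\<^bsub>W\<^esub> (\<one>\<^bsub>V\<^esub>, k) \<in> N"
      using that subgroup.m_closed[OF N'(3)] by (simp add: base_def top_part_def del: W_mult)
    then show ?thesis using that by (simp add: base_def top_part_def M_def)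
  qed
  have oneN: "\<one>\<^bsub>V\<^esub> \<in> base N" by (rule subgroup.one_closed[OF base_subgroup[OF N]])
  have "x \<in> class_under W M g"
    if x: "x \<in> carrier W" and adh: "adherent W (class_under W M g) x" for x
  proof -
    obtain f' b' where fb': "x = (f', b')" "f' \<in> carrier V" "b' \<in> carrier B" using x by (auto simp: carrier_W)
    \<comment> \<open>Projection to \<open>B\<close> shows that the top components are conjugate
      under \<open>top_part N\<close>; conjugating \<open>x\<close> inside \<open>M\<close> then
      makes them equal.\<close>
    have "b' \<in> class_under B (top_part N) b"
    proof (rule adherent_class_under[OF B.group_axioms hB tN b fb'(3)])
      show "adherent B (class_under B (top_part N) b) b'"
        unfolding adherent_def
      proof
        fix K assume K: "K \<in> co_normal_subgroups \<C> B"
        obtain l where l: "l \<in> carrier W" "snd l \<in> K" "x \<otimes>\<^bsub>W\<^esub> l \<in> class_under W M g"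
          using adh[unfolded adherent_def, rule_format, OF vimage_snd_co_normal[OF K]] by blast
        from l(3) obtain h where h: "h \<in> M" "x \<otimes>\<^bsub>W\<^esub> l = h \<otimes>\<^bsub>W\<^esub> g \<otimes>\<^bsub>W\<^esub> inv\<^bsub>W\<^esub> h"
          by (rule class_underE)
        have hW: "h \<in> carrier W" using h M'(4) by blast
        interpret snd: group_hom W B snd using snd_hom by unfold_locales
        have "snd (x \<otimes>\<^bsub>W\<^esub> l) = snd (h \<otimes>\<^bsub>W\<^esub> g \<otimes>\<^bsub>W\<^esub> inv\<^bsub>W\<^esub> h)" using h(2) by simp
        then have "b' \<otimes> snd l = snd h \<otimes> b \<otimes> inv (snd h)"
          using hW l(1) x g by (simp add: fb(1) fb'(1) del: W_mult)
        moreover have "snd h \<in> top_part N" using h(1) by (simp add: M_def)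
        ultimately have "b' \<otimes> snd l \<in> class_under B (top_part N) b"
          using class_underI[of "snd h" "top_part N" B b] by simp
        then show "\<exists>n\<in>K. b' \<otimes> n \<in> class_under B (top_part N) b" using l(2) by blast
      qed
    qed
    then obtain k where k: "k \<in> top_part N" "b' = k \<otimes> b \<otimes> inv k"
      by (rule class_underE)
    have kB: "k \<in> carrier B" using k tN'(4) by blast
    have \<kappa>: "(\<one>\<^bsub>V\<^esub>, k) \<in> M" by (rule memM[OF oneN k(1)])
    have \<kappa>W: "(\<one>\<^bsub>V\<^esub>, k) \<in> carrier W" using \<kappa> M'(4) by blast
    define f0 where "f0 = tr (inv k) f'"
    have f0: "f0 \<in> carrier V" using fb' kB by (simp add: f0_def)
    have x0: "inv\<^bsub>W\<^esub> (\<one>\<^bsub>V\<^esub>, k) \<otimes>\<^bsub>W\<^esub> x \<otimes>\<^bsub>W\<^esub> (\<one>\<^bsub>V\<^esub>, k) = (f0, b)"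
      using kB fb' b by (simp add: W_inv f0_def k(2) B.group_simps)
    have adh0: "adherent W (class_under W M g) (f0, b)"
      using adherent_conj[OF W.group_axioms M'(3) \<kappa> g x adh] x0 by simp
    obtain c where c: "c \<in> top_part N" "c \<otimes> b = b \<otimes> c"
      and cL: "\<forall>L\<in>co_normal_subgroups \<C> W. \<exists>n\<in>base N. \<exists>l\<in>base L. tr c f \<otimes>\<^bsub>V\<^esub> diff b n = f0 \<otimes>\<^bsub>V\<^esub> l"
      using uniform_centralizer[OF N f f0 b
          adherent_centralizer[OF hB N f f0 b adh0[unfolded M_def fb(1)]]] by blast
    have cB: "c \<in> carrier B" using c tN'(4) by blast
    \<comment> \<open>The order of quantifiers is essential: \<open>c\<close> is fixed before
      \<open>L\<close>, so a single element is a limit of values of \<open>diff b\<close> on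
      \<open>base N\<close>.\<close>
    have "f0 \<otimes>\<^bsub>V\<^esub> inv\<^bsub>V\<^esub> (tr c f) \<in> diff b ` base N"
    proof (rule diff_base_closed[OF N b])
      fix L assume "L \<in> co_normal_subgroups \<C> W"
      then obtain n l where nl: "n \<in> base N" "l \<in> base L" "tr c f \<otimes>\<^bsub>V\<^esub> diff b n = f0 \<otimes>\<^bsub>V\<^esub> l"
        using cL by blast
      note nV = base_closed[OF nl(1)] and lV = base_closed[OF nl(2)]
      have "diff b n = inv\<^bsub>V\<^esub> (tr c f) \<otimes>\<^bsub>V\<^esub> (tr c f \<otimes>\<^bsub>V\<^esub> diff b n)"
        using cB f b nV by (simp add: V.inv_mult_cancel_left)
      also have "\<dots> = f0 \<otimes>\<^bsub>V\<^esub> inv\<^bsub>V\<^esub> (tr c f) \<otimes>\<^bsub>V\<^esub> l"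
        unfolding nl(3) using cB f f0 lV by (simp add: V.m_ac)
      finally show "\<exists>n\<in>base N. \<exists>l\<in>base L. diff b n = f0 \<otimes>\<^bsub>V\<^esub> inv\<^bsub>V\<^esub> (tr c f) \<otimes>\<^bsub>V\<^esub> l"
        using nl by blast
    qed (use cB f f0 in simp)
    then obtain n where n: "n \<in> base N" "f0 \<otimes>\<^bsub>V\<^esub> inv\<^bsub>V\<^esub> (tr c f) = diff b n" by blast
    have nV: "n \<in> carrier V" by (rule base_closed[OF n(1)])
    have "f0 = tr c f \<otimes>\<^bsub>V\<^esub> diff b n"
      unfolding n(2)[symmetric] using cB f f0 by (simp add: V.m_comm[of f0] V.mult_inv_cancel_left)
    then have "(f0, b) = (n, c) \<otimes>\<^bsub>W\<^esub> g \<otimes>\<^bsub>W\<^esub> inv\<^bsub>W\<^esub> (n, c)"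
      using W_conj_centralizer[OF nV cB f b c(2)] by (simp add: fb(1) del: W_mult)
    moreover have ncW: "(n, c) \<in> carrier W" using nV cB by (simp add: carrier_W)
    moreover have "x = (\<one>\<^bsub>V\<^esub>, k) \<otimes>\<^bsub>W\<^esub> (f0, b) \<otimes>\<^bsub>W\<^esub> inv\<^bsub>W\<^esub> (\<one>\<^bsub>V\<^esub>, k)"
      unfolding x0[symmetric] using x \<kappa>W by (simp add: W.group_simps del: W_mult)
    ultimately have "x = ((\<one>\<^bsub>V\<^esub>, k) \<otimes>\<^bsub>W\<^esub> (n, c)) \<otimes>\<^bsub>W\<^esub> g \<otimes>\<^bsub>W\<^esub> inv\<^bsub>W\<^esub> ((\<one>\<^bsub>V\<^esub>, k) \<otimes>\<^bsub>W\<^esub> (n, c))"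
      using \<kappa>W g by (simp add: W.group_simps del: W_mult)
    then show ?thesis
      using class_underI[OF subgroup.m_closed[OF M'(3) \<kappa> memM[OF n(1) c(1)]], of W g] by simp
  qed
  then show "\<exists>R\<in>co_normal_subgroups \<C> W. \<exists>M. R \<subseteq> M \<and> M \<subseteq> N \<and>
      (\<forall>x\<in>carrier W. adherent W (class_under W M g) x \<longrightarrow> x \<in> class_under W M g)"
    using M by (intro bexI[of _ M] exI[of _ M]) (auto simp: M_def)
qed

end

theorem theorem4p15:
  fixes \<C> :: "nat monoid set"
    and A :: "('a, 'm) monoid_scheme"
    and B :: "('b, 'n) monoid_scheme"
  assumes "extension_closed_pseudovariety \<C>"
    and "group A" and "carrier A \<noteq> {\<one>\<^bsub>A\<^esub>}" and "hereditarily_conjugacy_separable \<C> A"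
    and "group B" and "carrier B \<noteq> {\<one>\<^bsub>B\<^esub>}" and "hereditarily_conjugacy_separable \<C> B"
  shows "hereditarily_conjugacy_separable \<C> (wreath_product A B) \<longleftrightarrow>
      (in_class \<C> B \<and> hereditarily_conjugacy_separable \<C> A) \<or>
      (comm_group A \<and> residually \<C> A \<and> hereditarily_conjugacy_separable \<C> B \<and>
        (\<forall>b\<in>carrier B. separable_in \<C> B (generate B {b})))"
proof -
  interpret pseudovariety \<C> by unfold_locales (rule assms(1))
  interpret A: group A by (rule assms(2))
  interpret B: group B by (rule assms(5))
  interpret pro_wreath A B \<C> by unfold_locales
  have resA: "residually \<C> A"
    using assms(4) by (intro residually_of_conjugacy_separable assms(2))
      (simp add: hereditarily_conjugacy_separable_def)
  show ?thesis
  proof (intro iffI)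
    assume "hereditarily_conjugacy_separable \<C> (wreath_product A B)"
    then have cs: "conjugacy_separable \<C> (wreath_product A B)"
      by (simp add: hereditarily_conjugacy_separable_def)
    show "(in_class \<C> B \<and> hereditarily_conjugacy_separable \<C> A) \<or>
      (comm_group A \<and> residually \<C> A \<and> hereditarily_conjugacy_separable \<C> B \<and>
        (\<forall>b\<in>carrier B. separable_in \<C> B (generate B {b})))"
    proof (cases "comm_group A")
      case True
      interpret comm_pro_wreath A B \<C>
        using True by (simp add: comm_pro_wreath_def comm_wreath_def pro_wreath_axioms wreath_axioms)
      show ?thesis using True resA assms(7) separable_cyclic[OF cs assms(3)] by blast
    next
      case False
      then obtain a a' where a: "a \<in> carrier A" "a' \<in> carrier A" "a \<otimes>\<^bsub>A\<^esub> a' \<noteq> a' \<otimes>\<^bsub>A\<^esub> a"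
        using A.group_comm_groupI by blast
      define e where "e = a \<otimes>\<^bsub>A\<^esub> a' \<otimes>\<^bsub>A\<^esub> inv\<^bsub>A\<^esub> a \<otimes>\<^bsub>A\<^esub> inv\<^bsub>A\<^esub> a'"
      have e: "e \<in> carrier A" using a by (simp add: e_def)
      have "e \<noteq> \<one>\<^bsub>A\<^esub>"
      proof
        assume "e = \<one>\<^bsub>A\<^esub>"
        then have "e \<otimes>\<^bsub>A\<^esub> (a' \<otimes>\<^bsub>A\<^esub> a) = a' \<otimes>\<^bsub>A\<^esub> a" using a by simp
        then show False using a by (simp add: e_def A.group_simps)
      qed
      then have "delta \<one>\<^bsub>B\<^esub> e \<one>\<^bsub>B\<^esub> \<noteq> \<one>\<^bsub>V\<^esub> \<one>\<^bsub>B\<^esub>" by simp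
      then have "(delta \<one>\<^bsub>B\<^esub> e, \<one>\<^bsub>B\<^esub>) \<noteq> \<one>\<^bsub>W\<^esub>" unfolding W_one by (metis prod.inject)
      then obtain N where "N \<in> co_normal_subgroups \<C> W" "(delta \<one>\<^bsub>B\<^esub> e, \<one>\<^bsub>B\<^esub>) \<notin> N"
        using residually_avoid[OF residually_of_conjugacy_separable[OF W.group_axioms cs] W.group_axioms,
            of "(delta \<one>\<^bsub>B\<^esub> e, \<one>\<^bsub>B\<^esub>)"] e by (auto simp: carrier_W)
      then show ?thesis using in_class_top a assms(4) by (auto simp: e_def)
    qed
  next
    assume "(in_class \<C> B \<and> hereditarily_conjugacy_separable \<C> A) \<or>
      (comm_group A \<and> residually \<C> A \<and> hereditarily_conjugacy_separable \<C> B \<and>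
        (\<forall>b\<in>carrier B. separable_in \<C> B (generate B {b})))"
    then show "hereditarily_conjugacy_separable \<C> (wreath_product A B)"
    proof (elim disjE conjE)
      assume "in_class \<C> B" "hereditarily_conjugacy_separable \<C> A"
      then show ?thesis by (rule hereditarily_conjugacy_separable_finite_top)
    next
      assume A: "comm_group A" and sep: "\<forall>b\<in>carrier B. separable_in \<C> B (generate B {b})"
      interpret separating_wreath A B \<C>
        using A sep resA by (simp add: separating_wreath_def separating_wreath_axioms_def
            comm_pro_wreath_def comm_wreath_def pro_wreath_axioms wreath_axioms)
      show ?thesis by (rule hereditarily_conjugacy_separable_abelian_base[OF assms(7)])
    qed
  qed
qed

end
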